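(* Let $\gamma\in\mathbb{R}$ with $\gamma\geq 1$, let $M=(-1,1)_x\times\mathbb{T}_y$, and let $\omega\subset M$ be an open set containing a horizontal strip $(-1,1)\times I$, where $I\subset\mathbb{T}$ is a non-empty open interval. Let $\Delta_\gamma=\partial_x^2+|x|^{2\gamma}\partial_y^2$ with domain $D(\Delta_\gamma)=\{u\in\mathcal{D}'(M): \partial_x^2u,\ |x|^{2\gamma}\partial_y^2u\in L^2(M),\ u_{|\partial M}=0\}$. Then there exist $C,h_0>0$ such that for any $v\in D(\Delta_\gamma)$ and any $0<h\leq h_0$, $$\|v\|_{L^2(M)}\leq C\Big(\|v\|_{L^2(\omega)}+h^{-(\gamma+1)}\|(h^2\Delta_\gamma+1)v\|_{L^2(M)}\Big).$$
   Context: $\mathbb{T}$ denotes the one-dimensional torus (circle) in the variable $y$. The boundary of $M$ is $\{x=\pm1\}\times\mathbb{T}$. *)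

theory Defs
  imports "HOL-Analysis.Analysis"
begin

text \<open>The cylinder M = (-1,1) x T, with T = R/(2 pi Z), is represented by the
fundamental domain (-1,1) x [0,2pi). Functions on M are functions
real x real => complex; test functions are 2pi-periodic in y.\<close>

definition Mset :: "(real \<times> real) set" where
  "Mset = {-1<..<1} \<times> {0..<2*pi}"

definition L2_on :: "(real \<times> real) set \<Rightarrow> (real \<times> real \<Rightarrow> complex) \<Rightarrow> bool" where
  "L2_on S f \<longleftrightarrow> f \<in> borel_measurable (lebesgue_on S) \<and>
      integrable (lebesgue_on S) (\<lambda>p. (norm (f p))\<^sup>2)"

definition L2norm :: "(real \<times> real) set \<Rightarrow> (real \<times> real \<Rightarrow> complex) \<Rightarrow> real" where
  "L2norm S f = sqrt (integral\<^sup>L (lebesgue_on S) (\<lambda>p. (norm (f p))\<^sup>2))"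

definition px :: "(real \<times> real \<Rightarrow> real) \<Rightarrow> real \<times> real \<Rightarrow> real" where
  "px \<phi> = (\<lambda>(x,y). deriv (\<lambda>t. \<phi> (t,y)) x)"

definition py :: "(real \<times> real \<Rightarrow> real) \<Rightarrow> real \<times> real \<Rightarrow> real" where
  "py \<phi> = (\<lambda>(x,y). deriv (\<lambda>t. \<phi> (x,t)) y)"

fun iter_pd :: "bool list \<Rightarrow> (real \<times> real \<Rightarrow> real) \<Rightarrow> real \<times> real \<Rightarrow> real" where
  "iter_pd [] \<phi> = \<phi>"
| "iter_pd (b # bs) \<phi> = (if b then px else py) (iter_pd bs \<phi>)"

text \<open>Test functions C_c^infty(M): smooth (all iterated partial derivatives are
differentiable), 2pi-periodic in y, support compact in M, i.e. contained in
[-1+delta,1-delta] x T.\<close>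
definition test_fun :: "(real \<times> real \<Rightarrow> real) \<Rightarrow> bool" where
  "test_fun \<phi> \<longleftrightarrow>
     (\<forall>ds p. iter_pd ds \<phi> differentiable (at p)) \<and>
     (\<forall>x y. \<phi> (x, y + 2*pi) = \<phi> (x, y)) \<and>
     (\<exists>\<delta>>0. \<forall>x y. 1 - \<delta> \<le> \<bar>x\<bar> \<longrightarrow> \<phi> (x, y) = 0)"

definition weak_dxx :: "(real \<times> real \<Rightarrow> complex) \<Rightarrow> (real \<times> real \<Rightarrow> complex) \<Rightarrow> bool" where
  "weak_dxx u f \<longleftrightarrow> (\<forall>\<phi>. test_fun \<phi> \<longrightarrow>
     (LINT p | lebesgue_on Mset. u p * of_real (px (px \<phi>) p)) =
     (LINT p | lebesgue_on Mset. f p * of_real (\<phi> p)))"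

definition weak_xdyy :: "real \<Rightarrow> (real \<times> real \<Rightarrow> complex) \<Rightarrow> (real \<times> real \<Rightarrow> complex) \<Rightarrow> bool" where
  "weak_xdyy \<gamma> u g \<longleftrightarrow> (\<forall>\<phi>. test_fun \<phi> \<longrightarrow>
     (LINT p | lebesgue_on Mset. u p * of_real (\<bar>fst p\<bar> powr (2*\<gamma>) * py (py \<phi>) p)) =
     (LINT p | lebesgue_on Mset. g p * of_real (\<phi> p)))"

text \<open>Dirichlet trace condition u|dM = 0: u has a representative whose
x-slices are, for a.e. y, continuous on [-1,1] and vanish at x = -1 and x = 1.\<close>
definition trace_zero :: "(real \<times> real \<Rightarrow> complex) \<Rightarrow> bool" where
  "trace_zero u \<longleftrightarrow> (\<exists>w. (AE p in lebesgue_on Mset. w p = u p) \<and>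
     (AE y in lebesgue_on {0..2*pi}.
        continuous_on {-1..1} (\<lambda>x. w (x, y)) \<and> w (-1, y) = 0 \<and> w (1, y) = 0))"

text \<open>v \<in> D(Delta_gamma), with Delta_gamma v = f + g where f = d_x^2 v and
g = |x|^(2gamma) d_y^2 v (both in L2(M)).\<close>
definition in_dom :: "real \<Rightarrow> (real \<times> real \<Rightarrow> complex) \<Rightarrow> (real \<times> real \<Rightarrow> complex)
                        \<Rightarrow> (real \<times> real \<Rightarrow> complex) \<Rightarrow> bool" where
  "in_dom \<gamma> v f g \<longleftrightarrow> L2_on Mset v \<and> L2_on Mset f \<and> L2_on Mset g \<and>
     weak_dxx v f \<and> weak_xdyy \<gamma> v g \<and> trace_zero v"

end

theory Submission
  imports Defs
begin

text \<open>Put \<open>\<Lambda> = h\<^sup>-\<^sup>2\<close> and \<open>q = |x| powr (2 \<gamma>)\<close>. The Fourier modes in \<open>y\<close> of \<open>v\<close> solve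
  \<open>V\<^sub>n'' = (n\<^sup>2 q - \<Lambda>) V\<^sub>n + F\<^sub>n\<close> with Dirichlet conditions, where \<open>F = (\<Delta>\<^sub>\<gamma> + \<Lambda>) v\<close>.
  Green's identity gives \<open>(n\<^sup>2 - m\<^sup>2) \<langle>q V\<^sub>n, V\<^sub>m\<rangle> = \<langle>V\<^sub>n, F\<^sub>m\<rangle> - \<langle>F\<^sub>n, V\<^sub>m\<rangle>\<close>, so the modes are almost orthogonal for
  the weight \<open>q\<close>. Hence for a weight \<open>w\<close> supported in the observed strip,
  \<open>\<integral>\<integral> w q (|v|\<^sup>2 + h\<^sup>2 |v\<^sub>y|\<^sup>2)\<close> bounds \<open>\<Sum>(1 + h\<^sup>2 n\<^sup>2) \<integral> q |V\<^sub>n|\<^sup>2\<close> from above, up to errors in \<open>F\<close>.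
  By the energy identity the former is at most a multiple of \<open>\<parallel>v\<parallel>\<^sup>2\<close> on the strip, and a Morawetz
  multiplier shows that the latter is at least a multiple of \<open>\<Sum>\<parallel>V\<^sub>n\<parallel>\<^sup>2\<close>, uniformly in \<open>n\<close>. The off-diagonal errors
  carry a factor \<open>h\<^sup>2 min(|n|, |m|)\<close>, which is \<open>O(h powr (1 - \<gamma>))\<close> for \<open>|n|\<close> up to a multiple of
  \<open>h powr (-(\<gamma> + 1))\<close>; beyond that the equation is elliptic and \<open>\<parallel>V\<^sub>n\<parallel> \<le> h\<^sup>2 \<parallel>F\<^sub>n\<parallel>\<close>.\<close>

section \<open>Square-integrable and absolutely continuous functions\<close>

text \<open>Without source, a mode solves \<open>V'' + \<Lambda> V = n^2 q V\<close>, an eigenvalue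
  problem in \<open>n^2\<close> that is symmetric for the weight \<open>q\<close>; this is why
  \<open>q\<close>, and not the plain \<open>L2\<close> product, separates the modes. Two obstacles
  shape the rest. First, \<open>n\<close> and \<open>-n\<close> share an eigenvalue, so nothing
  makes these two modes orthogonal; the window tells them apart because \<open>|hat w k|\<close>
  stays below \<open>hat w 0\<close> by a fixed gap. Second, \<open>q\<close> vanishes at
  \<open>x = 0\<close>, where modes with large \<open>n\<close> concentrate, so the
  \<open>q\<close>-mass alone does not see them uniformly; the term with the
  \<open>y\<close>-derivative supplies the factor that restores uniformity. The cutoff in
  \<open>n\<close> lies where the lowest eigenvalue of \<open>- d^2/dx^2 + n^2 q\<close>, of size
  \<open>|n| powr (2 / (\<gamma> + 1))\<close>, reaches \<open>h^(-2)\<close>. Since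
  \<open>F\<close> carries a factor \<open>h^(-2)\<close> against \<open>(h^2 Delta + 1) v\<close>,
  a loss of \<open>h powr (1 - \<gamma>)\<close> is exactly the stated power of \<open>h\<close>. On
  the analytic side the domain offers only weak derivatives and a trace for almost every
  \<open>y\<close>; turning this into boundary values of each single mode is what the later sections
  prepare.\<close>

definition L2 :: "'a measure \<Rightarrow> ('a \<Rightarrow> complex) \<Rightarrow> bool" where
  "L2 M f \<longleftrightarrow> f \<in> borel_measurable M \<and> integrable M (\<lambda>x. (norm (f x))\<^sup>2)"

definition nsq :: "'a measure \<Rightarrow> ('a \<Rightarrow> complex) \<Rightarrow> real" where
  "nsq M f = (\<integral>x. (norm (f x))\<^sup>2 \<partial>M)"

definition ip :: "'a measure \<Rightarrow> ('a \<Rightarrow> complex) \<Rightarrow> ('a \<Rightarrow> complex) \<Rightarrow> complex" where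
  "ip M f g = (\<integral>x. f x * cnj (g x) \<partial>M)"

lemma L2_measurable [measurable_dest]: "L2 M f \<Longrightarrow> f \<in> borel_measurable M"
  by (simp add: L2_def)

lemma L2_integrable_sq: "L2 M f \<Longrightarrow> integrable M (\<lambda>x. (norm (f x))\<^sup>2)"
  by (simp add: L2_def)

lemma cnj_measurable [measurable]: "cnj \<in> borel_measurable borel"
  by (intro borel_measurable_continuous_onI continuous_intros)

lemma nsq_nonneg: "nsq M f \<ge> 0"
  unfolding nsq_def by (intro integral_nonneg_AE) auto

lemma mult_le_am_gm: "t > 0 \<Longrightarrow> a * b \<le> (t * a\<^sup>2 + b\<^sup>2 / t) / 2" for a b t :: real
proof -
  assume t: "t > 0"
  have "0 \<le> (t * a - b)\<^sup>2 / t" using t by simp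
  also have "\<dots> = t * a\<^sup>2 + b\<^sup>2 / t - 2 * (a * b)"
    using t by (simp add: field_simps power2_eq_square)
  finally show ?thesis by simp
qed

lemma L2_mult_integrable:
  assumes "L2 M f" "L2 M g"
  shows "integrable M (\<lambda>x. f x * g x)"
proof (rule Bochner_Integration.integrable_bound)
  show "integrable M (\<lambda>x. (norm (f x))\<^sup>2 + (norm (g x))\<^sup>2)"
    using assms by (intro Bochner_Integration.integrable_add L2_integrable_sq)
  show "(\<lambda>x. f x * g x) \<in> borel_measurable M"
    using assms by (auto simp: L2_def)
  show "AE x in M. norm (f x * g x) \<le> norm ((norm (f x))\<^sup>2 + (norm (g x))\<^sup>2)"
  proof (intro AE_I2)
    fix x
    show "norm (f x * g x) \<le> norm ((norm (f x))\<^sup>2 + (norm (g x))\<^sup>2)"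
      using mult_le_am_gm[of 1 "norm (f x)" "norm (g x)"]
      by (simp add: norm_mult) (smt (verit) zero_le_power2)
  qed
qed

lemma L2_bounded_mult:
  assumes f: "L2 M f" and [measurable]: "\<rho> \<in> borel_measurable M"
    and B: "\<And>x. x \<in> space M \<Longrightarrow> norm (\<rho> x) \<le> B"
  shows "L2 M (\<lambda>x. \<rho> x * f x)"
  unfolding L2_def
proof (intro conjI)
  note [measurable] = L2_measurable[OF f]
  show "(\<lambda>x. \<rho> x * f x) \<in> borel_measurable M" by measurable
  show "integrable M (\<lambda>x. (norm (\<rho> x * f x))\<^sup>2)"
  proof (rule Bochner_Integration.integrable_bound)
    show "integrable M (\<lambda>x. B\<^sup>2 * (norm (f x))\<^sup>2)"
      using L2_integrable_sq[OF f] by simp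
    show "(\<lambda>x. (norm (\<rho> x * f x))\<^sup>2) \<in> borel_measurable M" by measurable
    show "AE x in M. norm ((norm (\<rho> x * f x))\<^sup>2) \<le> norm (B\<^sup>2 * (norm (f x))\<^sup>2)"
      using B by (intro AE_I2) (simp add: norm_mult power_mult_distrib mult_right_mono power_mono)
  qed
qed

lemma L2_cmult: "L2 M f \<Longrightarrow> L2 M (\<lambda>x. c * f x)"
  by (rule L2_bounded_mult[where B = "norm c"]) auto

lemma L2_cnj: "L2 M f \<Longrightarrow> L2 M (\<lambda>x. cnj (f x))"
  by (auto simp: L2_def intro: measurable_compose[OF _ cnj_measurable])

lemma norm_add_sq_le: "(norm (a + b))\<^sup>2 \<le> 2 * (norm a)\<^sup>2 + 2 * (norm b)\<^sup>2"
  for a b :: "'a::real_normed_vector"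
proof -
  have "(norm (a + b))\<^sup>2 \<le> (norm a + norm b)\<^sup>2"
    by (intro power_mono norm_triangle_ineq) auto
  also have "\<dots> \<le> 2 * (norm a)\<^sup>2 + 2 * (norm b)\<^sup>2"
    using sum_squares_bound[of "norm a" "norm b"] by (simp add: power2_sum)
  finally show ?thesis .
qed

lemma L2_add:
  assumes "L2 M f" "L2 M g"
  shows "L2 M (\<lambda>x. f x + g x)"
  unfolding L2_def
proof (intro conjI)
  note [measurable] = L2_measurable[OF assms(1)] L2_measurable[OF assms(2)]
  show "(\<lambda>x. f x + g x) \<in> borel_measurable M" by measurable
  show "integrable M (\<lambda>x. (norm (f x + g x))\<^sup>2)"
  proof (rule Bochner_Integration.integrable_bound)
    show "integrable M (\<lambda>x. 2 * (norm (f x))\<^sup>2 + 2 * (norm (g x))\<^sup>2)"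
      using assms[THEN L2_integrable_sq] by simp
    show "(\<lambda>x. (norm (f x + g x))\<^sup>2) \<in> borel_measurable M" by measurable
    show "AE x in M. norm ((norm (f x + g x))\<^sup>2)
       \<le> norm (2 * (norm (f x))\<^sup>2 + 2 * (norm (g x))\<^sup>2)"
      using norm_add_sq_le[of "f _" "g _"] by (intro AE_I2) simp
  qed
qed

lemma L2_diff: "L2 M f \<Longrightarrow> L2 M g \<Longrightarrow> L2 M (\<lambda>x. f x - g x)"
  using L2_add[of M f "\<lambda>x. - 1 * g x"] L2_cmult[of M g "- 1"] by simp

lemma L2_zero [simp]: "L2 M (\<lambda>x. 0)"
  by (simp add: L2_def)

lemma L2_sum: "(\<And>i. i \<in> A \<Longrightarrow> L2 M (f i)) \<Longrightarrow> L2 M (\<lambda>x. \<Sum>i\<in>A. f i x)"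
proof (induction A rule: infinite_finite_induct)
  case (insert i A)
  then show ?case using L2_add[of M "f i" "\<lambda>x. \<Sum>i\<in>A. f i x"] by auto
qed auto

lemma (in finite_measure) L2_bounded:
  assumes [measurable]: "f \<in> borel_measurable M"
    and B: "\<And>x. x \<in> space M \<Longrightarrow> norm (f x) \<le> B"
  shows "L2 M f"
proof -
  have "L2 M (\<lambda>x. 1)" by (simp add: L2_def)
  from L2_bounded_mult[OF this assms] show ?thesis by (simp only: mult_1_right)
qed

lemma (in finite_measure) L2_imp_integrable:
  assumes "L2 M f"
  shows "integrable M f"
proof -
  have "L2 M (\<lambda>x. 1)" by (rule L2_bounded[where B = 1]) auto
  from L2_mult_integrable[OF assms this] show ?thesis by (simp only: mult_1_right)
qed

lemma ip_integrable: "L2 M f \<Longrightarrow> L2 M g \<Longrightarrow> integrable M (\<lambda>x. f x * cnj (g x))"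
  by (intro L2_mult_integrable L2_cnj)

lemma ip_self: "ip M f f = of_real (nsq M f)"
proof -
  have "ip M f f = (\<integral>x. complex_of_real ((norm (f x))\<^sup>2) \<partial>M)"
    unfolding ip_def by (intro Bochner_Integration.integral_cong refl) (rule complex_norm_square[symmetric])
  then show ?thesis unfolding nsq_def by (simp only: integral_complex_of_real)
qed

lemma ip_cnj: "cnj (ip M f g) = ip M g f"
proof -
  have "cnj (ip M f g) = (\<integral>x. cnj (f x * cnj (g x)) \<partial>M)"
    unfolding ip_def by (simp only: Bochner_Integration.integral_cnj)
  then show ?thesis unfolding ip_def by (simp add: mult.commute)
qed

lemma ip_add_left:
  "L2 M f \<Longrightarrow> L2 M g \<Longrightarrow> L2 M k \<Longrightarrow> ip M (\<lambda>x. f x + g x) k = ip M f k + ip M g k"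
  unfolding ip_def by (simp add: distrib_right ip_integrable)

lemma ip_cmult_left: "ip M (\<lambda>x. c * f x) g = c * ip M f g"
  unfolding ip_def by (simp add: mult.assoc)

lemma ip_cmult_right: "ip M f (\<lambda>x. c * g x) = cnj c * ip M f g"
  unfolding ip_def by (simp add: mult.left_commute)

text \<open>Cauchy-Schwarz in the form of Young's inequality with a free parameter: later steps
  choose \<open>t\<close> so that one of the two terms can be absorbed, and no square roots
  appear.\<close>

lemma norm_ip_le:
  assumes f: "L2 M f" and g: "L2 M g" and t: "t > 0"
  shows "norm (ip M f g) \<le> (t * nsq M f + nsq M g / t) / 2"
proof -
  have "norm (ip M f g) \<le> (\<integral>x. norm (f x * cnj (g x)) \<partial>M)"
    unfolding ip_def by (rule integral_norm_bound)
  also have "\<dots> \<le> (\<integral>x. (t * (norm (f x))\<^sup>2 + (norm (g x))\<^sup>2 / t) / 2 \<partial>M)"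
  proof (rule integral_mono)
    show "integrable M (\<lambda>x. norm (f x * cnj (g x)))"
      using ip_integrable[OF f g] by (rule integrable_norm)
    show "integrable M (\<lambda>x. (t * (norm (f x))\<^sup>2 + (norm (g x))\<^sup>2 / t) / 2)"
      using f[THEN L2_integrable_sq] g[THEN L2_integrable_sq] by simp
    show "norm (f x * cnj (g x)) \<le> (t * (norm (f x))\<^sup>2 + (norm (g x))\<^sup>2 / t) / 2" for x
      using mult_le_am_gm[OF t, of "norm (f x)" "norm (g x)"] by (simp add: norm_mult)
  qed
  also have "\<dots> = (t * nsq M f + nsq M g / t) / 2"
    using f[THEN L2_integrable_sq] g[THEN L2_integrable_sq] by (simp add: nsq_def)
  finally show ?thesis .
qed

lemma nsq_mono:
  assumes "L2 M g" "f \<in> borel_measurable M" "\<And>x. x \<in> space M \<Longrightarrow> norm (f x) \<le> norm (g x)"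
  shows "nsq M f \<le> nsq M g"
  unfolding nsq_def
proof (rule integral_mono_AE)
  show "integrable M (\<lambda>x. (norm (g x))\<^sup>2)" using assms by (simp add: L2_def)
  show "AE x in M. (norm (f x))\<^sup>2 \<le> (norm (g x))\<^sup>2"
    using assms(3) by (auto intro: power_mono)
  then show "integrable M (\<lambda>x. (norm (f x))\<^sup>2)"
    using assms by (intro Bochner_Integration.integrable_bound[OF L2_integrable_sq[OF assms(1)]]) auto
qed

lemma nsq_add_le:
  assumes f: "L2 M f" and g: "L2 M g"
  shows "nsq M (\<lambda>x. f x + g x) \<le> 2 * nsq M f + 2 * nsq M g"
proof -
  have "nsq M (\<lambda>x. f x + g x) \<le> (\<integral>x. 2 * (norm (f x))\<^sup>2 + 2 * (norm (g x))\<^sup>2 \<partial>M)"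
    unfolding nsq_def
  proof (rule integral_mono)
    show "integrable M (\<lambda>x. (norm (f x + g x))\<^sup>2)" using L2_add[OF f g] by (simp add: L2_def)
    show "integrable M (\<lambda>x. 2 * (norm (f x))\<^sup>2 + 2 * (norm (g x))\<^sup>2)"
      using f g by (simp add: L2_def)
  qed (rule norm_add_sq_le)
  also have "\<dots> = 2 * nsq M f + 2 * nsq M g"
    using f g by (simp add: L2_def nsq_def)
  finally show ?thesis .
qed

section \<open>Borel measure on bounded intervals\<close>

text \<open>\<open>lborel\<close> rather than the completed \<open>lebesgue\<close>, so that product
  measures stay Borel and Fubini applies directly. Closed intervals keep the end points, where
  boundary values are read off, inside the space.\<close>

definition MI :: "real \<Rightarrow> real \<Rightarrow> real measure" where
  "MI a b = restrict_space lborel {a..b}"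

abbreviation "IX \<equiv> MI (- 1) 1"
abbreviation "IY \<equiv> MI 0 (2 * pi)"

lemma space_MI [simp]: "space (MI a b) = {a..b}"
  by (simp add: MI_def space_restrict_space)

lemma finite_measure_MI: "finite_measure (MI a b)"
  by (rule finite_measureI)
    (simp add: MI_def space_restrict_space emeasure_restrict_space emeasure_lborel_Icc_eq)

interpretation MI: finite_measure "MI a b" for a b by (rule finite_measure_MI)
interpretation MI2: pair_sigma_finite "MI a b" "MI c d" for a b c d ..

lemma borel_measurable_MI [measurable (raw)]: "f \<in> borel_measurable borel \<Longrightarrow> f \<in> borel_measurable (MI a b)"
  unfolding MI_def by (intro measurable_restrict_space1) simp

lemma sets_MI: "sets (MI a b) = sets (restrict_space borel {a..b})"
  unfolding MI_def by (rule sets_restrict_space_cong) simp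

lemma continuous_measurable_MI: "continuous_on {a..b} f \<Longrightarrow> f \<in> borel_measurable (MI a b)"
  using borel_measurable_continuous_on_restrict[of "{a..b}" f] sets_MI measurable_cong_sets by blast

lemma continuous_bounded_MI:
  fixes f :: "real \<Rightarrow> 'a::real_normed_vector"
  assumes "continuous_on {a..b} f"
  obtains B where "\<And>x. x \<in> {a..b} \<Longrightarrow> norm (f x) \<le> B"
proof -
  have "bounded (f ` {a..b})"
    using compact_continuous_image[OF assms] compact_imp_bounded by blast
  then obtain B where "\<forall>x\<in>{a..b}. norm (f x) \<le> B" by (auto simp: bounded_iff)
  then show ?thesis by (intro that[of B]) blast
qed

lemma L2_continuous: "continuous_on {a..b} f \<Longrightarrow> L2 (MI a b) f"
  by (rule continuous_bounded_MI[of a b f], assumption) (rule MI.L2_bounded, auto intro: continuous_measurable_MI)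

lemma L2_continuous_mult:
  "continuous_on {a..b} \<rho> \<Longrightarrow> L2 (MI a b) f \<Longrightarrow> L2 (MI a b) (\<lambda>x. \<rho> x * f x)"
  by (rule continuous_bounded_MI[of a b \<rho>], assumption) (rule L2_bounded_mult, auto intro: continuous_measurable_MI)

lemma integrable_continuous_MI:
  fixes f :: "real \<Rightarrow> 'a::euclidean_space"
  assumes "continuous_on {a..b} f" shows "integrable (MI a b) f"
proof -
  obtain B where "\<And>x. x \<in> {a..b} \<Longrightarrow> norm (f x) \<le> B"
    using continuous_bounded_MI[OF assms] by blast
  then show ?thesis
    by (intro MI.integrable_const_bound[where B = B]) (auto simp: continuous_measurable_MI assms)
qed

lemma integrable_continuous_mult_MI:
  fixes f :: "real \<Rightarrow> complex"
  assumes "continuous_on {a..b} \<rho>" "integrable (MI a b) f"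
  shows "integrable (MI a b) (\<lambda>x. \<rho> x * f x)"
proof -
  obtain B where B: "\<And>x. x \<in> {a..b} \<Longrightarrow> norm (\<rho> x) \<le> B"
    using continuous_bounded_MI[OF assms(1)] by blast
  note [measurable] = continuous_measurable_MI[OF assms(1)] borel_measurable_integrable[OF assms(2)]
  show ?thesis
  proof (rule Bochner_Integration.integrable_bound)
    show "integrable (MI a b) (\<lambda>x. B * norm (f x))" using assms(2) by simp
    show "AE x in MI a b. norm (\<rho> x * f x) \<le> norm (B * norm (f x))"
      using B by (intro AE_I2) (auto simp: norm_mult abs_mult intro!: mult_right_mono order_trans[OF B])
  qed measurable
qed

lemma integral_MI: "integral\<^sup>L (MI a b) f = (LBINT x:{a..b}. f x)"
  for f :: "real \<Rightarrow> 'a::euclidean_space"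
  unfolding MI_def set_lebesgue_integral_def by (subst integral_restrict_space) auto

lemma integrable_MI: "integrable (MI a b) f \<longleftrightarrow> set_integrable lborel {a..b} f"
  for f :: "real \<Rightarrow> 'a::euclidean_space"
  unfolding MI_def set_integrable_def by (subst integrable_restrict_space) auto

lemma integral_MI_HK:
  fixes f :: "real \<Rightarrow> 'a::euclidean_space"
  assumes "integrable (MI a b) f"
  shows "integral\<^sup>L (MI a b) f = integral {a..b} f" and "f integrable_on {a..b}"
  using set_borel_integral_eq_integral[of "{a..b}" f] assms by (auto simp: integral_MI integrable_MI)

lemma integral_MI_FTC:
  fixes F :: "real \<Rightarrow> 'a::euclidean_space"
  assumes "a \<le> b" "continuous_on {a..b} f"
    and "\<And>x. x \<in> {a..b} \<Longrightarrow> (F has_vector_derivative f x) (at x within {a..b})"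
  shows "integral\<^sup>L (MI a b) f = F b - F a"
  using integral_MI_HK(1)[OF integrable_continuous_MI[OF assms(2)]]
    fundamental_theorem_of_calculus[OF assms(1,3)] by (simp add: integral_unique)

text \<open>Moves a variable upper limit into the integrand over a fixed interval, the form in which
  Fubini can be used.\<close>

lemma integral_MI_sub:
  fixes f :: "real \<Rightarrow> 'a::euclidean_space"
  assumes "x \<in> {a..b}"
  shows "(\<integral>t. (if t \<le> x then f t else 0) \<partial>MI a b) = integral\<^sup>L (MI a x) f"
  unfolding integral_MI set_lebesgue_integral_def
  using assms by (intro Bochner_Integration.integral_cong) (auto simp: indicator_def)

lemma integrable_MI_sub:
  fixes f :: "real \<Rightarrow> 'a::euclidean_space"
  assumes "integrable (MI a b) f" "x \<in> {a..b}"
  shows "integrable (MI a x) f"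
  using set_integrable_subset[of lborel "{a..b}" f "{a..x}"] assms by (auto simp: integrable_MI)

section \<open>Absolutely continuous functions and integration by parts\<close>

text \<open>The derivative \<open>f\<close> is carried along as data, fixed only up to a null set;
  nothing has to be known about pointwise derivatives of \<open>F\<close>.\<close>

definition AC :: "(real \<Rightarrow> complex) \<Rightarrow> (real \<Rightarrow> complex) \<Rightarrow> bool" where
  "AC F f \<longleftrightarrow> integrable IX f \<and> (\<forall>x\<in>{-1..1}. F x = F (-1) + integral\<^sup>L (MI (-1) x) f)"

lemma AC_D: "AC F f \<Longrightarrow> integrable IX f"
  "AC F f \<Longrightarrow> x \<in> {-1..1} \<Longrightarrow> F x = F (-1) + integral\<^sup>L (MI (-1) x) f"
  unfolding AC_def by blast+

lemma continuous_on_integral_MI: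
  fixes f :: "real \<Rightarrow> 'a::euclidean_space"
  assumes "integrable (MI a b) f"
  shows "continuous_on {a..b} (\<lambda>x. integral\<^sup>L (MI a x) f)"
proof -
  have "continuous_on {a..b} (\<lambda>x. integral {a..x} f)"
    using integral_MI_HK(2)[OF assms] by (rule indefinite_integral_continuous_1)
  then show ?thesis
    by (rule continuous_on_eq) (use integral_MI_HK(1)[OF integrable_MI_sub[OF assms]] in simp)
qed

lemma AC_continuous: assumes "AC F f" shows "continuous_on {-1..1} F"
proof -
  have "continuous_on {-1..1} (\<lambda>x. F (-1) + integral\<^sup>L (MI (-1) x) f)"
    using continuous_on_integral_MI[OF AC_D(1)[OF assms]] by (intro continuous_intros)
  then show ?thesis by (rule continuous_on_eq) (rule AC_D(2)[OF assms, symmetric])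
qed

lemma AC_C1:
  assumes "continuous_on {-1..1} f"
    and "\<And>x. x \<in> {-1..1} \<Longrightarrow> (F has_vector_derivative f x) (at x within {-1..1})"
  shows "AC F f"
  unfolding AC_def
proof (intro conjI ballI)
  show "integrable IX f" using assms(1) by (rule integrable_continuous_MI)
  fix x :: real assume x: "x \<in> {-1..1}"
  have sub: "{-1..x} \<subseteq> {-1..1}" using x by auto
  have "integral\<^sup>L (MI (-1) x) f = F x - F (-1)"
    using x sub by (intro integral_MI_FTC continuous_on_subset[OF assms(1)] has_vector_derivative_within_subset[OF assms(2)]) auto
  then show "F x = F (-1) + integral\<^sup>L (MI (-1) x) f" by simp
qed

lemma integral_MI_point [simp]: "integral\<^sup>L (MI a a) f = 0" for f :: "real \<Rightarrow> 'a::euclidean_space"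
proof -
  have "(\<integral>x. indicator {a} x *\<^sub>R f x \<partial>lborel) = 0"
    by (rule integral_eq_zero_AE, rule AE_I[where N="{a}"]) (auto simp: indicator_def)
  then show ?thesis by (simp add: integral_MI set_lebesgue_integral_def)
qed

lemma AC_integral: "integrable IX f \<Longrightarrow> AC (\<lambda>x. c + integral\<^sup>L (MI (-1) x) f) f"
  unfolding AC_def by (simp add: integral_MI_point)

lemma AC_I:
  assumes "integrable IX f" "\<And>x. x \<in> {-1..1} \<Longrightarrow> F x = F (-1) + integral\<^sup>L (MI (-1) x) f"
  shows "AC F f"
  unfolding AC_def using assms by blast

lemma AC_integrable_sub: "AC F f \<Longrightarrow> x \<in> {-1..1} \<Longrightarrow> integrable (MI (-1) x) f"
  by (rule integrable_MI_sub[OF AC_D(1)])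

lemma AC_add:
  assumes F: "AC F f" and G: "AC G g"
  shows "AC (\<lambda>x. F x + G x) (\<lambda>x. f x + g x)"
proof (rule AC_I)
  show "integrable IX (\<lambda>x. f x + g x)" using AC_D(1)[OF F] AC_D(1)[OF G] by simp
  fix x :: real assume x: "x \<in> {-1..1}"
  show "F x + G x = F (-1) + G (-1) + (\<integral>x. f x + g x \<partial>MI (-1) x)"
    using AC_integrable_sub[OF F x] AC_integrable_sub[OF G x] AC_D(2)[OF F x] AC_D(2)[OF G x] by simp
qed

lemma AC_cmult:
  assumes F: "AC F f"
  shows "AC (\<lambda>x. c * F x) (\<lambda>x. c * f x)"
proof (rule AC_I)
  show "integrable IX (\<lambda>x. c * f x)" using AC_D(1)[OF F] by simp
  fix x :: real assume x: "x \<in> {-1..1}"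
  show "c * F x = c * F (-1) + (\<integral>x. c * f x \<partial>MI (-1) x)"
    by (subst AC_D(2)[OF F x]) (simp add: distrib_left)
qed

lemma AC_cnj:
  assumes F: "AC F f"
  shows "AC (\<lambda>x. cnj (F x)) (\<lambda>x. cnj (f x))"
proof (rule AC_I)
  show "integrable IX (\<lambda>x. cnj (f x))" using AC_D(1)[OF F] by simp
  fix x :: real assume x: "x \<in> {-1..1}"
  show "cnj (F x) = cnj (F (-1)) + (\<integral>x. cnj (f x) \<partial>MI (-1) x)"
    by (subst AC_D(2)[OF F x]) simp
qed

lemma AC_boundary: assumes "AC F f" shows "integral\<^sup>L IX f = F 1 - F (-1)"
proof -
  have "F 1 = F (-1) + integral\<^sup>L IX f" by (rule AC_D(2)[OF assms]) simp
  then show ?thesis by (simp only: add_diff_cancel_left')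
qed

lemma AE_MI_neq: "AE s in MI a b. s \<noteq> t"
proof -
  have "AE s in lborel. s \<noteq> t" by (rule AE_I[where N="{t}"]) auto
  then show ?thesis unfolding MI_def by (subst AE_restrict_space_iff) auto
qed

lemma borel_measurable_fst_MI [measurable]: "fst \<in> borel_measurable (MI a b \<Otimes>\<^sub>M M)"
  by (rule measurable_compose[OF measurable_fst borel_measurable_MI]) simp

lemma borel_measurable_snd_MI [measurable]: "snd \<in> borel_measurable (M \<Otimes>\<^sub>M MI a b)"
  by (rule measurable_compose[OF measurable_snd borel_measurable_MI]) simp

lemma integrable_prod_MI:
  fixes f g :: "real \<Rightarrow> complex"
  assumes f: "integrable (MI a b) f" and g: "integrable (MI c d) g"
  shows "integrable (MI a b \<Otimes>\<^sub>M MI c d) (\<lambda>(t, s). f t * g s)"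
proof -
  note [measurable] = borel_measurable_integrable[OF f] borel_measurable_integrable[OF g]
  show ?thesis
  proof (rule MI2.Fubini_integrable)
    show "(\<lambda>(t, s). f t * g s) \<in> borel_measurable (MI a b \<Otimes>\<^sub>M MI c d)" by measurable
    show "integrable (MI a b) (\<lambda>x. \<integral>y. norm (case (x, y) of (t, s) \<Rightarrow> f t * g s) \<partial>MI c d)"
      using f by (simp add: norm_mult)
    show "AE x in MI a b. integrable (MI c d) (\<lambda>y. case (x, y) of (t, s) \<Rightarrow> f t * g s)"
      using g by simp
  qed
qed

text \<open>Fubini on the triangles \<open>s \<le> t\<close> and \<open>t \<le> s\<close>.\<close>
lemma integral_by_parts_indefinite:
  fixes f g :: "real \<Rightarrow> complex"
  assumes f: "integrable (MI a b) f" and g: "integrable (MI a b) g"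
  shows "(\<integral>t. f t * integral\<^sup>L (MI a t) g + integral\<^sup>L (MI a t) f * g t \<partial>MI a b)
     = integral\<^sup>L (MI a b) f * integral\<^sup>L (MI a b) g"
proof -
  let ?M = "MI a b"
  note [measurable] = borel_measurable_integrable[OF f] borel_measurable_integrable[OF g]
  have i1: "integrable (?M \<Otimes>\<^sub>M ?M) (\<lambda>(t, s). if s \<le> t then f t * g s else 0)"
    by (rule Bochner_Integration.integrable_bound[OF integrable_prod_MI[OF f g]])
      (measurable, auto intro!: AE_I2)
  have i2: "integrable (?M \<Otimes>\<^sub>M ?M) (\<lambda>(t, s). if t \<le> s then f t * g s else 0)"
    by (rule Bochner_Integration.integrable_bound[OF integrable_prod_MI[OF f g]])
      (measurable, auto intro!: AE_I2)
  have e1: "f t * integral\<^sup>L (MI a t) g = (\<integral>s. (if s \<le> t then f t * g s else 0) \<partial>?M)"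
    if "t \<in> {a..b}" for t
  proof -
    have "(\<integral>s. (if s \<le> t then f t * g s else 0) \<partial>?M) = (\<integral>s. f t * (if s \<le> t then g s else 0) \<partial>?M)"
      by (intro Bochner_Integration.integral_cong) auto
    then show ?thesis using integral_MI_sub[OF that, of g] by simp
  qed
  have e2: "integral\<^sup>L (MI a t) f * g t = (\<integral>s. (if s \<le> t then f s * g t else 0) \<partial>?M)"
    if "t \<in> {a..b}" for t
  proof -
    have "(\<integral>s. (if s \<le> t then f s * g t else 0) \<partial>?M) = (\<integral>s. (if s \<le> t then f s else 0) * g t \<partial>?M)"
      by (intro Bochner_Integration.integral_cong) auto
    then show ?thesis using integral_MI_sub[OF that, of f] by simp
  qed
  have I1: "integrable ?M (\<lambda>t. f t * integral\<^sup>L (MI a t) g)"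
    using MI2.integrable_fst[OF i1] by (subst Bochner_Integration.integrable_cong[OF refl e1]) auto
  have I2: "integrable ?M (\<lambda>t. integral\<^sup>L (MI a t) f * g t)"
    using MI2.integrable_snd[OF i2] by (subst Bochner_Integration.integrable_cong[OF refl e2]) auto
  have "(\<integral>t. integral\<^sup>L (MI a t) f * g t \<partial>?M) = (\<integral>t. (\<integral>s. (if s \<le> t then f s * g t else 0) \<partial>?M) \<partial>?M)"
    using e2 by (intro Bochner_Integration.integral_cong) auto
  also have "\<dots> = (\<integral>s. (\<integral>t. (if s \<le> t then f s * g t else 0) \<partial>?M) \<partial>?M)"
    using MI2.Fubini_integral[OF i2] by simp
  finally have sw: "(\<integral>t. integral\<^sup>L (MI a t) f * g t \<partial>?M) = (\<integral>s. (\<integral>t. (if s \<le> t then f s * g t else 0) \<partial>?M) \<partial>?M)" .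
  have "(\<integral>t. f t * integral\<^sup>L (MI a t) g + integral\<^sup>L (MI a t) f * g t \<partial>?M)
     = (\<integral>t. (\<integral>s. (if s \<le> t then f t * g s else 0) \<partial>?M) \<partial>?M) + (\<integral>t. (\<integral>s. (if t \<le> s then f t * g s else 0) \<partial>?M) \<partial>?M)"
  proof -
    have "(\<integral>t. f t * integral\<^sup>L (MI a t) g \<partial>?M) = (\<integral>t. (\<integral>s. (if s \<le> t then f t * g s else 0) \<partial>?M) \<partial>?M)"
      using e1 by (intro Bochner_Integration.integral_cong refl) simp
    then show ?thesis using I1 I2 sw by simp
  qed
  also have "\<dots> = (\<integral>t. (\<integral>s. (if s \<le> t then f t * g s else 0) \<partial>?M) + (\<integral>s. (if t \<le> s then f t * g s else 0) \<partial>?M) \<partial>?M)"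
    using MI2.integrable_fst[OF i1] MI2.integrable_fst[OF i2] by simp
  also have "\<dots> = (\<integral>t. (\<integral>s. f t * g s \<partial>?M) \<partial>?M)"
  proof (intro Bochner_Integration.integral_cong refl)
    fix t
    have "integrable ?M (\<lambda>s. if s \<le> t then f t * g s else 0)" "integrable ?M (\<lambda>s. if t \<le> s then f t * g s else 0)"
      by (rule Bochner_Integration.integrable_bound[of _ "\<lambda>s. f t * g s"]; use g in auto)+
    then have "(\<integral>s. (if s \<le> t then f t * g s else 0) \<partial>?M) + (\<integral>s. (if t \<le> s then f t * g s else 0) \<partial>?M)
       = (\<integral>s. (if s \<le> t then f t * g s else 0) + (if t \<le> s then f t * g s else 0) \<partial>?M)" by simp
    also have "\<dots> = (\<integral>s. f t * g s \<partial>?M)"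
    \<comment> \<open>The diagonal \<open>s = t\<close> belongs to both triangles, so the integrands
      agree only off that one point.\<close>
    proof (rule integral_cong_AE)
      show "AE s in ?M. (if s \<le> t then f t * g s else 0) + (if t \<le> s then f t * g s else 0) = f t * g s"
        using AE_MI_neq[where a=a and b=b and t=t] by eventually_elim auto
    qed measurable
    finally show "(\<integral>s. (if s \<le> t then f t * g s else 0) \<partial>?M) + (\<integral>s. (if t \<le> s then f t * g s else 0) \<partial>?M)
       = (\<integral>s. f t * g s \<partial>?M)" .
  qed
  also have "\<dots> = integral\<^sup>L ?M f * integral\<^sup>L ?M g" by simp
  finally show ?thesis .
qed

lemma AC_mult:
  assumes F: "AC F f" and G: "AC G g"
  shows "AC (\<lambda>x. F x * G x) (\<lambda>x. f x * G x + F x * g x)"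
  unfolding AC_def
proof (intro conjI ballI)
  have i: "integrable IX (\<lambda>x. f x * G x)" "integrable IX (\<lambda>x. F x * g x)"
    using integrable_continuous_mult_MI[OF AC_continuous[OF G] AC_D(1)[OF F]]
      integrable_continuous_mult_MI[OF AC_continuous[OF F] AC_D(1)[OF G]] by (auto simp: mult.commute)
  show "integrable IX (\<lambda>x. f x * G x + F x * g x)" using i by simp
  fix x :: real assume x: "x \<in> {-1..1}"
  let ?M = "MI (-1) x"
  have fi: "integrable ?M f" and gi: "integrable ?M g"
    using integrable_MI_sub[OF AC_D(1)[OF F] x] integrable_MI_sub[OF AC_D(1)[OF G] x] by auto
  have ii: "integrable ?M (\<lambda>x. f x * G x)" "integrable ?M (\<lambda>x. F x * g x)"
    using integrable_MI_sub[OF i(1) x] integrable_MI_sub[OF i(2) x] by auto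
  have G': "integral\<^sup>L (MI (-1) t) g = G t - G (-1)" and F': "integral\<^sup>L (MI (-1) t) f = F t - F (-1)"
    if "t \<in> {-1..x}" for t
    using AC_D(2)[OF G, of t] AC_D(2)[OF F, of t] that x by auto
  \<comment> \<open>The increments from -1 are indefinite integrals, so the triangle identity
    applies to them; expanding the product restores the boundary values.\<close>
  have "(F x - F (-1)) * (G x - G (-1)) =
      (\<integral>t. f t * (G t - G (-1)) + (F t - F (-1)) * g t \<partial>?M)"
  proof -
    have "(\<integral>t. f t * integral\<^sup>L (MI (-1) t) g + integral\<^sup>L (MI (-1) t) f * g t \<partial>?M)
        = (\<integral>t. f t * (G t - G (-1)) + (F t - F (-1)) * g t \<partial>?M)"
      by (intro Bochner_Integration.integral_cong refl) (simp add: F' G')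
    then show ?thesis using integral_by_parts_indefinite[OF fi gi] x F'[of x] G'[of x] by simp
  qed
  also have "\<dots> = (\<integral>t. (f t * G t + F t * g t) - (f t * G (-1) + F (-1) * g t) \<partial>?M)"
    by (intro Bochner_Integration.integral_cong) (auto simp: algebra_simps)
  also have "\<dots> = (\<integral>t. f t * G t + F t * g t \<partial>?M) - ((F x - F (-1)) * G (-1) + F (-1) * (G x - G (-1)))"
    using ii fi gi x F'[of x] G'[of x] by simp
  finally show "F x * G x = F (-1) * G (-1) + (\<integral>t. f t * G t + F t * g t \<partial>?M)"
    by (simp add: algebra_simps)
qed

section \<open>Estimates for a single Fourier mode\<close>

definition qw :: "real \<Rightarrow> real \<Rightarrow> real" where
  "qw \<gamma> x = \<bar>x\<bar> powr (2 * \<gamma>)"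

text \<open>Two one-sided powers instead of a sign times a power of the modulus: one formula,
  continuous also at 0.\<close>

definition dqw :: "real \<Rightarrow> real \<Rightarrow> real" where
  "dqw \<gamma> x = 2 * \<gamma> * ((max x 0) powr (2 * \<gamma> - 1) - (max (- x) 0) powr (2 * \<gamma> - 1))"

lemma continuous_on_max_powr: "a > 0 \<Longrightarrow> continuous_on S (\<lambda>x. (max (f x) 0) powr a)"
  if "continuous_on S f" for a :: real and f :: "'a::t2_space \<Rightarrow> real"
  using that by (intro continuous_on_powr' continuous_intros) auto

lemma has_real_derivative_max_powr:
  fixes a t :: real
  assumes a: "a > 1"
  shows "((\<lambda>t. (max t 0) powr a) has_real_derivative a * (max t 0) powr (a - 1)) (at t)"
proof (cases t "0::real" rule: linorder_cases)
  case less
  have "((\<lambda>t. 0) has_real_derivative 0) (at t)" by simp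
  then have "((\<lambda>t. (max t 0) powr a) has_real_derivative 0) (at t)"
    by (rule has_field_derivative_transform_within_open[where S = "{..<0}"]) (use less in auto)
  then show ?thesis using less by simp
next
  case equal
  have "continuous_on UNIV (\<lambda>t::real. (max t 0) powr (a - 1))"
    using a by (intro continuous_on_max_powr continuous_intros) auto
  then have "isCont (\<lambda>t::real. (max t 0) powr (a - 1)) 0"
    by (simp add: continuous_on_eq_continuous_at)
  then have "((\<lambda>t::real. (max t 0) powr (a - 1)) \<longlongrightarrow> (max 0 0) powr (a - 1)) (at 0)"
    by (simp only: isCont_def)
  then have "((\<lambda>t::real. (max t 0) powr (a - 1)) \<longlongrightarrow> 0) (at 0)" by simp
  \<comment> \<open>For an increment \<open>h\<close> different from 0 the quotient equals
    \<open>(max h 0) powr (a - 1)\<close>, whose limit was just found.\<close>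
  then have "((\<lambda>h::real. ((max (0 + h) 0) powr a - (max 0 0) powr a) / h) \<longlongrightarrow> 0) (at 0)"
    by (rule Lim_transform_eventually) (auto intro!: eventuallyI simp: eventually_at_filter powr_diff max_def)
  then show ?thesis using equal a by (simp add: DERIV_def)
next
  case greater
  have "((\<lambda>t. t powr a) has_real_derivative a * t powr (a - 1)) (at t)"
    using greater by (rule has_real_derivative_powr)
  then have "((\<lambda>t. (max t 0) powr a) has_real_derivative a * t powr (a - 1)) (at t)"
    by (rule has_field_derivative_transform_within_open[where S = "{0<..}"]) (use greater in auto)
  then show ?thesis using greater by simp
qed

lemma qw_altdef: "\<gamma> \<ge> 1 \<Longrightarrow> qw \<gamma> x = (max x 0) powr (2 * \<gamma>) + (max (- x) 0) powr (2 * \<gamma>)"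
  by (auto simp: qw_def max_def abs_if)

lemma has_real_derivative_qw:
  assumes "\<gamma> \<ge> 1" shows "(qw \<gamma> has_real_derivative dqw \<gamma> x) (at x)"
proof -
  have "((\<lambda>x. (max (- x) 0) powr (2 * \<gamma>)) has_real_derivative
      (2 * \<gamma> * (max (- x) 0) powr (2 * \<gamma> - 1)) * (- 1)) (at x)"
    using assms by (intro DERIV_chain2[OF has_real_derivative_max_powr]) (auto intro!: derivative_eq_intros)
  from DERIV_add[OF has_real_derivative_max_powr[of "2 * \<gamma>" x] this]
  moreover have "qw \<gamma> = (\<lambda>x. (max x 0) powr (2 * \<gamma>) + (max (- x) 0) powr (2 * \<gamma>))"
    using assms by (intro ext qw_altdef)
  ultimately show ?thesis using assms by (simp add: dqw_def algebra_simps)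
qed

lemma continuous_on_dqw: "\<gamma> \<ge> 1 \<Longrightarrow> continuous_on S (dqw \<gamma>)"
  unfolding dqw_def by (intro continuous_intros continuous_on_max_powr) auto

lemma continuous_on_qw: "\<gamma> \<ge> 1 \<Longrightarrow> continuous_on S (qw \<gamma>)"
  using has_real_derivative_qw by (intro DERIV_continuous_on) (auto intro: has_field_derivative_at_within)

text \<open>Euler's identity for a homogeneous function; it lets the multiplier computation be
  expressed by \<open>q\<close> alone, without its derivative.\<close>

lemma x_dqw: "\<gamma> \<ge> 1 \<Longrightarrow> x * dqw \<gamma> x = 2 * \<gamma> * qw \<gamma> x"
  by (cases x "0::real" rule: linorder_cases)
    (auto simp: dqw_def qw_def max_def powr_diff)

lemma qw_nonneg: "qw \<gamma> x \<ge> 0" by (simp add: qw_def)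

lemma qw_le_1: "\<gamma> \<ge> 1 \<Longrightarrow> \<bar>x\<bar> \<le> 1 \<Longrightarrow> qw \<gamma> x \<le> 1"
  unfolding qw_def by (rule powr_le1) auto

lemma dqw_sq_le: "\<gamma> \<ge> 1 \<Longrightarrow> \<bar>x\<bar> \<le> 1 \<Longrightarrow> (dqw \<gamma> x)\<^sup>2 \<le> 4 * \<gamma>\<^sup>2 * qw \<gamma> x"
proof -
  assume g: "\<gamma> \<ge> 1" and x: "\<bar>x\<bar> \<le> 1"
  have "(dqw \<gamma> x)\<^sup>2 = 4 * \<gamma>\<^sup>2 * (\<bar>x\<bar> powr (2 * \<gamma> - 1))\<^sup>2"
    by (cases x "0::real" rule: linorder_cases)
      (auto simp: dqw_def max_def power_mult_distrib)
  also have "(\<bar>x\<bar> powr (2 * \<gamma> - 1))\<^sup>2 = \<bar>x\<bar> powr (4 * \<gamma> - 2)"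
    by (simp add: power2_eq_square flip: powr_add)
  \<comment> \<open>\<open>4 \<gamma> - 2 \<ge> 2 \<gamma>\<close> because
    \<open>\<gamma> \<ge> 1\<close>, and for \<open>|x| \<le> 1\<close> the larger exponent gives
    the smaller power.\<close>
  also have "\<dots> \<le> \<bar>x\<bar> powr (2 * \<gamma>)"
    using g x by (intro powr_mono') auto
  finally show ?thesis using g by (simp add: qw_def mult_left_mono)
qed

lemma C1_of_real:
  assumes "\<And>x. (s has_real_derivative s' x) (at x)"
  shows "((\<lambda>x. complex_of_real (s x)) has_vector_derivative complex_of_real (s' x)) (at x within A)"
  using has_vector_derivative_of_real[OF assms] has_vector_derivative_at_within
    assms has_real_derivative_iff_has_vector_derivative
  by (metis (no_types))

lemma AC_of_real:
  assumes "\<And>x. (s has_real_derivative s' x) (at x)" "continuous_on {-1..1} s'"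
  shows "AC (\<lambda>x. complex_of_real (s x)) (\<lambda>x. complex_of_real (s' x))"
  using assms by (intro AC_C1 C1_of_real continuous_intros) auto

definition wsq :: "(real \<Rightarrow> real) \<Rightarrow> (real \<Rightarrow> complex) \<Rightarrow> real" where
  "wsq s V = (\<integral>x. s x * (norm (V x))\<^sup>2 \<partial>IX)"

lemma wsq_integrable:
  assumes "continuous_on {-1..1} s" "continuous_on {-1..1} V"
  shows "integrable IX (\<lambda>x. s x * (norm (V x))\<^sup>2)"
  using assms by (intro integrable_continuous_MI continuous_intros)

lemma nsq_eq_wsq: "nsq IX V = wsq (\<lambda>x. 1) V"
  by (simp add: nsq_def wsq_def)

lemma wsq_mono:
  assumes "continuous_on {-1..1} s" "continuous_on {-1..1} t" "continuous_on {-1..1} V"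
    and "\<And>x. x \<in> {-1..1} \<Longrightarrow> s x \<le> t x"
  shows "wsq s V \<le> wsq t V"
  unfolding wsq_def using assms by (intro integral_mono wsq_integrable) (auto intro: mult_right_mono)

lemma wsq_add: "continuous_on {-1..1} s \<Longrightarrow> continuous_on {-1..1} t \<Longrightarrow> continuous_on {-1..1} V \<Longrightarrow>
    wsq (\<lambda>x. s x + t x) V = wsq s V + wsq t V"
  unfolding wsq_def by (simp add: distrib_right wsq_integrable)

lemma wsq_cmult: "wsq (\<lambda>x. c * s x) V = c * wsq s V"
  unfolding wsq_def by (simp add: mult.assoc)

text \<open>Integrate the derivative of \<open>s |P|^2\<close>. With different \<open>s\<close> and
  \<open>P\<close> this one identity yields both halves of the Morawetz argument and the uncertainty
  estimate.\<close>

lemma AC_weighted_square: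
  assumes P: "AC P p" "L2 IX p"
    and s: "\<And>x. (s has_real_derivative s' x) (at x)" "continuous_on {-1..1} s'"
  shows "wsq s' P + 2 * Re (ip IX (\<lambda>x. of_real (s x) * p x) P)
    = s 1 * (norm (P 1))\<^sup>2 - s (-1) * (norm (P (-1)))\<^sup>2"
proof -
  have cs: "continuous_on {-1..1} s" using s(1) by (intro DERIV_continuous_on) (auto intro: has_field_derivative_at_within)
  have cP: "continuous_on {-1..1} P" by (rule AC_continuous[OF P(1)])
  let ?g = "\<lambda>x. complex_of_real (s' x) * (P x * cnj (P x))
      + complex_of_real (s x) * (p x * cnj (P x) + P x * cnj (p x))"
  have ac: "AC (\<lambda>x. complex_of_real (s x) * (P x * cnj (P x))) ?g"
    by (intro AC_mult AC_cnj AC_of_real s P)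
  have "Re (integral\<^sup>L IX ?g) = Re (complex_of_real (s 1) * (P 1 * cnj (P 1)) - complex_of_real (s (-1)) * (P (-1) * cnj (P (-1))))"
    by (simp only: AC_boundary[OF ac])
  also have "\<dots> = s 1 * (norm (P 1))\<^sup>2 - s (-1) * (norm (P (-1)))\<^sup>2"
    by (simp only: complex_norm_square[symmetric] of_real_mult[symmetric] of_real_diff[symmetric] Re_complex_of_real)
  also have "Re (integral\<^sup>L IX ?g) = (\<integral>x. Re (?g x) \<partial>IX)"
    using AC_D(1)[OF ac] by (rule integral_Re[symmetric])
  also have "\<dots> = (\<integral>x. s' x * (norm (P x))\<^sup>2 + 2 * Re (of_real (s x) * p x * cnj (P x)) \<partial>IX)"
  proof (intro Bochner_Integration.integral_cong refl)
    fix x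
    have "Re (?g x) = Re (complex_of_real (s' x * (norm (P x))\<^sup>2)) + s x * (Re (p x * cnj (P x)) + Re (P x * cnj (p x)))"
      by (simp only: complex_norm_square of_real_mult plus_complex.sel Re_complex_of_real times_complex.sel Im_complex_of_real)
    also have "Re (P x * cnj (p x)) = Re (p x * cnj (P x))" by simp
    finally show "Re (?g x) = s' x * (norm (P x))\<^sup>2 + 2 * Re (of_real (s x) * p x * cnj (P x))"
      by (simp add: algebra_simps)
  qed
  also have "\<dots> = wsq s' P + 2 * Re (ip IX (\<lambda>x. of_real (s x) * p x) P)"
  proof -
    have i: "integrable IX (\<lambda>x. of_real (s x) * p x * cnj (P x))"
      using cs by (intro ip_integrable L2_continuous_mult P L2_continuous cP continuous_intros)
    show ?thesis unfolding wsq_def ip_def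
      using wsq_integrable[OF s(2) cP] i by (simp del: times_complex.sel add: integral_Re)
  qed
  finally show ?thesis .
qed

text \<open>\<open>V\<close> is an \<open>H\<^sup>2\<close> function vanishing at both end points, with \<open>V' = W\<close> and \<open>V'' = f\<close>.\<close>

definition sol :: "(real \<Rightarrow> complex) \<Rightarrow> (real \<Rightarrow> complex) \<Rightarrow> (real \<Rightarrow> complex) \<Rightarrow> bool" where
  "sol V W f \<longleftrightarrow> AC V W \<and> AC W f \<and> L2 IX f \<and> V (-1) = 0 \<and> V 1 = 0"

lemma sol_continuous: "sol V W f \<Longrightarrow> continuous_on {-1..1} V" "sol V W f \<Longrightarrow> continuous_on {-1..1} W"
  by (auto simp: sol_def intro: AC_continuous)

lemma sol_L2: "sol V W f \<Longrightarrow> L2 IX V" "sol V W f \<Longrightarrow> L2 IX W" "sol V W f \<Longrightarrow> L2 IX f"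
  by (auto simp: sol_def intro!: AC_continuous L2_continuous)

text \<open>Integrate the derivative of \<open>W cnj U\<close>; the boundary term disappears because
  \<open>U\<close> vanishes at both ends.\<close>

lemma sol_energy:
  assumes s: "sol V W f" and t: "sol U Z g"
  shows "ip IX f U = - ip IX W Z"
proof -
  have ac: "AC (\<lambda>x. W x * cnj (U x)) (\<lambda>x. f x * cnj (U x) + W x * cnj (Z x))"
    using s t by (intro AC_mult AC_cnj) (auto simp: sol_def)
  have "ip IX f U + ip IX W Z = (\<integral>x. f x * cnj (U x) + W x * cnj (Z x) \<partial>IX)"
    unfolding ip_def by (rule Bochner_Integration.integral_add[symmetric]) (intro ip_integrable sol_L2[OF s] sol_L2[OF t])+
  also have "\<dots> = 0" using AC_boundary[OF ac] t by (simp add: sol_def)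
  finally show ?thesis by (simp add: eq_neg_iff_add_eq_0)
qed

lemma sol_green:
  assumes s: "sol V W f" and t: "sol U Z g"
  shows "ip IX f U = ip IX V g"
proof -
  have "ip IX V g = cnj (ip IX g V)" by (simp add: ip_cnj)
  also have "\<dots> = ip IX f U" by (simp add: sol_energy[OF t s] sol_energy[OF s t] ip_cnj)
  finally show ?thesis by simp
qed

lemma Re_ip_weight:
  assumes "continuous_on {-1..1} s" "continuous_on {-1..1} V"
  shows "Re (ip IX (\<lambda>x. of_real (s x) * V x) V) = wsq s V"
proof -
  have "ip IX (\<lambda>x. of_real (s x) * V x) V = (\<integral>x. complex_of_real (s x * (norm (V x))\<^sup>2) \<partial>IX)"
    unfolding ip_def by (simp only: mult.assoc of_real_mult complex_norm_square)
  then show ?thesis unfolding wsq_def by (simp only: integral_complex_of_real Re_complex_of_real)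
qed

lemma Re_ip_le:
  assumes "L2 M f" "L2 M g" "t > 0"
  shows "\<bar>Re (ip M f g)\<bar> \<le> (t * nsq M f + nsq M g / t) / 2"
  using norm_ip_le[OF assms] abs_Re_le_cmod[of "ip M f g"] by linarith

text \<open>With \<open>\<Lambda> = h\<^sup>-\<^sup>2\<close> this is the \<open>n\<close>-th Fourier mode of \<open>(\<Delta>\<^sub>\<gamma> + \<Lambda>) v\<close> when \<open>V\<close> and \<open>f\<close> are those of
  \<open>v\<close> and \<open>\<partial>\<^sub>x\<^sup>2 v\<close>.\<close>

definition resid :: "real \<Rightarrow> real \<Rightarrow> real \<Rightarrow> (real \<Rightarrow> complex) \<Rightarrow> (real \<Rightarrow> complex) \<Rightarrow> real \<Rightarrow> complex" where
  "resid \<gamma> \<Lambda> n V f x = f x - of_real (n\<^sup>2 * qw \<gamma> x - \<Lambda>) * V x"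

context
  fixes \<gamma> \<Lambda> n :: real and V W f F :: "real \<Rightarrow> complex"
  assumes \<gamma>: "\<gamma> \<ge> 1" and sol: "sol V W f"
  defines "F \<equiv> resid \<gamma> \<Lambda> n V f"
begin

lemma L2_resid: "L2 IX F"
  unfolding F_def resid_def
  using sol \<gamma> by (intro L2_diff L2_continuous_mult sol_L2[OF sol] continuous_intros continuous_on_qw)

lemma f_eq_resid: "f x = of_real (n\<^sup>2 * qw \<gamma> x - \<Lambda>) * V x + F x"
  by (simp add: F_def resid_def)

lemma ip_f_weight:
  assumes "continuous_on {-1..1} s" "L2 IX U"
  shows "ip IX (\<lambda>x. of_real (s x) * f x) U
    = ip IX (\<lambda>x. of_real (s x * (n\<^sup>2 * qw \<gamma> x - \<Lambda>)) * V x) U + ip IX (\<lambda>x. of_real (s x) * F x) U"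
proof -
  have "(\<lambda>x. of_real (s x) * f x) = (\<lambda>x. of_real (s x * (n\<^sup>2 * qw \<gamma> x - \<Lambda>)) * V x + of_real (s x) * F x)"
    by (intro ext) (simp add: f_eq_resid algebra_simps)
  then show ?thesis
    using \<gamma> assms by (simp only:) (intro ip_add_left L2_continuous_mult L2_resid sol_L2[OF sol] continuous_intros continuous_on_qw)
qed

lemma nsq_weight_le:
  assumes "continuous_on {-1..1} s" "\<And>x. x \<in> {-1..1} \<Longrightarrow> \<bar>s x\<bar> \<le> 1" "L2 IX U"
  shows "nsq IX (\<lambda>x. of_real (s x) * U x) \<le> nsq IX U"
  using assms by (intro nsq_mono borel_measurable_times L2_measurable[OF assms(3)] continuous_measurable_MI continuous_intros)
    (auto simp: norm_mult mult_left_le_one_le)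

text \<open>Pair the equation with \<open>q V\<close>. The term \<open>n^2 q^2 |V|^2\<close> has a
  favourable sign and is dropped, so the bound is uniform in \<open>n\<close>. It is needed because
  the Morawetz multiplier has derivative \<open>1 - (1 + 2 \<gamma>) q\<close>, whose negative part
  costs a multiple of \<open>q |V'|^2\<close>.\<close>

lemma weighted_energy:
  "wsq (qw \<gamma>) W \<le> (4 * \<gamma>\<^sup>2 + 1) * nsq IX V + 2 * \<Lambda> * wsq (qw \<gamma>) V + nsq IX F"
  if \<Lambda>: "\<Lambda> \<ge> 0"
proof -
  note cont = sol_continuous[OF sol] continuous_on_qw[OF \<gamma>] continuous_on_dqw[OF \<gamma>]
  note l2 = sol_L2[OF sol] L2_resid
  let ?q = "\<lambda>x. complex_of_real (qw \<gamma> x)"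
  let ?q' = "\<lambda>x. complex_of_real (dqw \<gamma> x)"
  have aV: "AC (\<lambda>x. cnj (V x)) (\<lambda>x. cnj (W x))" and aW: "AC W f" and b: "V 1 = 0" "V (-1) = 0"
    using sol by (auto simp: sol_def intro: AC_cnj)
  have aq: "AC ?q ?q'"
    by (intro AC_of_real has_real_derivative_qw \<gamma> continuous_on_dqw)
  have ac: "AC (\<lambda>x. ?q x * W x * cnj (V x)) (\<lambda>x. (?q' x * W x + ?q x * f x) * cnj (V x) + ?q x * W x * cnj (W x))"
    by (intro AC_mult aq aW aV)
  have i1: "integrable IX (\<lambda>x. ?q' x * W x * cnj (V x))"
    and i2: "integrable IX (\<lambda>x. ?q x * f x * cnj (V x))"
    and i3: "integrable IX (\<lambda>x. ?q x * W x * cnj (W x))"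
    by (intro ip_integrable L2_continuous_mult l2 cont continuous_intros)+
  have "0 = (\<integral>x. (?q' x * W x + ?q x * f x) * cnj (V x) + ?q x * W x * cnj (W x) \<partial>IX)"
    using AC_boundary[OF ac] b by simp
  also have "\<dots> = ip IX (\<lambda>x. ?q' x * W x) V + ip IX (\<lambda>x. ?q x * f x) V + ip IX (\<lambda>x. ?q x * W x) W"
    using i1 i2 i3 by (simp add: ip_def distrib_right)
  finally have "0 = Re (ip IX (\<lambda>x. ?q' x * W x) V + ip IX (\<lambda>x. ?q x * f x) V + ip IX (\<lambda>x. ?q x * W x) W)"
    by simp
  then have eq: "wsq (qw \<gamma>) W = - Re (ip IX (\<lambda>x. ?q' x * W x) V)
      - wsq (\<lambda>x. qw \<gamma> x * (n\<^sup>2 * qw \<gamma> x - \<Lambda>)) V - Re (ip IX (\<lambda>x. ?q x * F x) V)"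
  proof -
    have "Re (ip IX (\<lambda>x. of_real (qw \<gamma> x * (n\<^sup>2 * qw \<gamma> x - \<Lambda>)) * V x) V)
        = wsq (\<lambda>x. qw \<gamma> x * (n\<^sup>2 * qw \<gamma> x - \<Lambda>)) V"
      by (intro Re_ip_weight continuous_intros cont)
    moreover have "Re (ip IX (\<lambda>x. ?q x * W x) W) = wsq (qw \<gamma>) W"
      by (intro Re_ip_weight cont)
    moreover have "ip IX (\<lambda>x. ?q x * f x) V
        = ip IX (\<lambda>x. of_real (qw \<gamma> x * (n\<^sup>2 * qw \<gamma> x - \<Lambda>)) * V x) V + ip IX (\<lambda>x. ?q x * F x) V"
      by (intro ip_f_weight cont l2)
    ultimately show ?thesis using \<open>0 = Re _\<close> by (simp only: plus_complex.sel)
  qed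
  have e1: "- Re (ip IX (\<lambda>x. ?q' x * W x) V) \<le> wsq (qw \<gamma>) W / 2 + 2 * \<gamma>\<^sup>2 * nsq IX V"
  proof -
    \<comment> \<open>As the squared derivative of \<open>q\<close> is at most
      \<open>4 \<gamma>^2 q\<close>, this \<open>t\<close> leaves at most half of
      \<open>wsq (qw \<gamma>) W\<close>, which moves to the left side.\<close>
    define t where "t = 1 / (4 * \<gamma>\<^sup>2)"
    have t: "t > 0" using \<gamma> by (simp add: t_def)
    have "nsq IX (\<lambda>x. ?q' x * W x) \<le> wsq (\<lambda>x. 4 * \<gamma>\<^sup>2 * qw \<gamma> x) W"
      unfolding nsq_def wsq_def norm_mult power_mult_distrib norm_of_real power2_abs
      using \<gamma> dqw_sq_le[OF \<gamma>]
      by (intro integral_mono integrable_continuous_MI continuous_intros cont mult_right_mono) auto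
    then have "t * nsq IX (\<lambda>x. ?q' x * W x) \<le> t * (4 * \<gamma>\<^sup>2 * wsq (qw \<gamma>) W)"
      using t by (simp add: wsq_cmult)
    also have "\<dots> = wsq (qw \<gamma>) W" using \<gamma> by (simp add: t_def)
    finally have "t * nsq IX (\<lambda>x. ?q' x * W x) \<le> wsq (qw \<gamma>) W" .
    moreover have "\<bar>Re (ip IX (\<lambda>x. ?q' x * W x) V)\<bar> \<le> (t * nsq IX (\<lambda>x. ?q' x * W x) + nsq IX V / t) / 2"
      by (intro Re_ip_le t L2_continuous_mult l2 cont continuous_intros)
    moreover have "nsq IX V / t = 2 * (2 * \<gamma>\<^sup>2 * nsq IX V)" by (simp add: t_def)
    moreover have "- r \<le> w / 2 + c" if "a \<le> w" "\<bar>r\<bar> \<le> (a + b) / 2" "b = 2 * c" for a b c r w :: real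
      using abs_le_D2[OF that(2)] that(1,3) by (simp add: field_simps)
    ultimately show ?thesis by blast
  qed
  have e2: "- wsq (\<lambda>x. qw \<gamma> x * (n\<^sup>2 * qw \<gamma> x - \<Lambda>)) V \<le> \<Lambda> * wsq (qw \<gamma>) V"
  proof -
    have "wsq (\<lambda>x. (- \<Lambda>) * qw \<gamma> x) V \<le> wsq (\<lambda>x. qw \<gamma> x * (n\<^sup>2 * qw \<gamma> x - \<Lambda>)) V"
      by (intro wsq_mono continuous_intros cont) (auto simp: algebra_simps qw_nonneg)
    then show ?thesis by (simp only: wsq_cmult)
  qed
  have e3: "- Re (ip IX (\<lambda>x. ?q x * F x) V) \<le> (nsq IX F + nsq IX V) / 2"
  proof -
    have "nsq IX (\<lambda>x. ?q x * F x) \<le> nsq IX F"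
      using \<gamma> by (intro nsq_weight_le l2 cont) (auto simp: qw_nonneg qw_le_1)
    then show ?thesis
      using Re_ip_le[of IX "\<lambda>x. ?q x * F x" V 1] l2
      by (simp add: L2_continuous_mult cont continuous_intros)
  qed
  show ?thesis using eq e1 e2 e3 by (simp add: algebra_simps)
qed

text \<open>Morawetz multiplier \<open>\<rho> V'\<close> with \<open>\<rho> = x (1 - q)\<close>: \<open>\<rho>' = 1 - (1 + 2 \<gamma>) q\<close>, and \<open>\<rho>\<close> vanishes
  at \<open>x = 1\<close> and \<open>x = -1\<close>, so the boundary does not contribute.\<close>

lemma mode_lower_bound:
  assumes \<Lambda>: "\<Lambda> \<ge> 2 * (1 + 2 * \<gamma>) * (4 * \<gamma>\<^sup>2 + 1)"
  shows "\<Lambda> * nsq IX V \<le> 6 * (1 + 2 * \<gamma>) * (\<Lambda> + n\<^sup>2) * wsq (qw \<gamma>) V + (4 + 4 * \<gamma>) * nsq IX F"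
proof -
  note cont = sol_continuous[OF sol] continuous_on_qw[OF \<gamma>] continuous_on_dqw[OF \<gamma>]
  note l2 = sol_L2[OF sol] L2_resid
  define c where "c = 1 + 2 * \<gamma>"
  have \<Lambda>0: "\<Lambda> \<ge> 0" using \<Lambda> \<gamma> by (smt (verit) mult_nonneg_nonneg zero_le_power2)
  define \<rho> where "\<rho> x = x * (1 - qw \<gamma> x)" for x
  define \<rho>' where "\<rho>' x = 1 - c * qw \<gamma> x" for x
  define e where "e x = n\<^sup>2 * qw \<gamma> x - \<Lambda>" for x
  \<comment> \<open>Derivative of \<open>\<rho> e\<close>, with \<open>x\<close> times the
    derivative of \<open>q\<close> already replaced by \<open>2 \<gamma> q\<close>.\<close>
  define \<sigma>' where "\<sigma>' x = \<rho>' x * e x + n\<^sup>2 * (2 * \<gamma>) * qw \<gamma> x * (1 - qw \<gamma> x)" for x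
  have d\<rho>: "(\<rho> has_real_derivative \<rho>' x) (at x)" for x
  proof -
    have "((\<lambda>x. x * (1 - qw \<gamma> x)) has_real_derivative (1 * (1 - qw \<gamma> x) + (0 - dqw \<gamma> x) * x)) (at x)"
      by (intro DERIV_mult DERIV_diff DERIV_ident DERIV_const has_real_derivative_qw \<gamma>)
    then show ?thesis using x_dqw[OF \<gamma>, of x]
      by (simp add: \<rho>_def[abs_def] \<rho>'_def c_def algebra_simps)
  qed
  have de: "(e has_real_derivative n\<^sup>2 * dqw \<gamma> x) (at x)" for x
    unfolding e_def[abs_def] by (auto intro!: derivative_eq_intros has_real_derivative_qw \<gamma>)
  have d\<sigma>: "((\<lambda>x. \<rho> x * e x) has_real_derivative \<sigma>' x) (at x)" for x
  proof -
    have "\<rho> x * (n\<^sup>2 * dqw \<gamma> x) = n\<^sup>2 * (1 - qw \<gamma> x) * (x * dqw \<gamma> x)"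
      by (simp add: \<rho>_def)
    then have "\<sigma>' x = \<rho>' x * e x + n\<^sup>2 * dqw \<gamma> x * \<rho> x"
      by (simp add: \<sigma>'_def x_dqw[OF \<gamma>] algebra_simps)
    then show ?thesis using DERIV_mult[OF d\<rho> de, of x] by simp
  qed
  have c\<rho>: "continuous_on {-1..1} \<rho>" "continuous_on {-1..1} \<rho>'" "continuous_on {-1..1} e" "continuous_on {-1..1} \<sigma>'"
    unfolding \<rho>_def[abs_def] \<rho>'_def[abs_def] e_def[abs_def] \<sigma>'_def[abs_def] by (intro continuous_intros cont)+
  have q1: "qw \<gamma> 1 = 1" "qw \<gamma> (-1) = 1" by (simp_all add: qw_def)
  have b: "\<rho> 1 = 0" "\<rho> (-1) = 0" "V 1 = 0" "V (-1) = 0"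
    using sol q1 by (auto simp: \<rho>_def sol_def)
  have WW: "wsq \<rho>' W + 2 * Re (ip IX (\<lambda>x. of_real (\<rho> x) * f x) W) = 0"
    using AC_weighted_square[of W f \<rho> \<rho>'] sol d\<rho> c\<rho> b by (simp add: sol_def)
  have VV: "wsq \<sigma>' V + 2 * Re (ip IX (\<lambda>x. of_real (\<rho> x * e x) * W x) V) = 0"
    using AC_weighted_square[of V W "\<lambda>x. \<rho> x * e x" \<sigma>'] sol d\<sigma> c\<rho> b l2 by (simp add: sol_def)
  have "Re (ip IX (\<lambda>x. of_real (\<rho> x * e x) * V x) W) = Re (ip IX (\<lambda>x. of_real (\<rho> x * e x) * W x) V)"
  proof -
    have "cnj (ip IX (\<lambda>x. of_real (\<rho> x * e x) * V x) W) = ip IX (\<lambda>x. of_real (\<rho> x * e x) * W x) V"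
      unfolding ip_cnj by (simp add: ip_def algebra_simps)
    then show ?thesis by (metis cnj.sel(1))
  qed
  \<comment> \<open>Inserting the equation into the identity for \<open>W\<close> produces the
    pairing of \<open>\<rho> e V\<close> with \<open>W\<close>; its real part also occurs in the
    identity for \<open>V\<close>, so it can be eliminated.\<close>
  then have id: "wsq \<rho>' W = wsq \<sigma>' V - 2 * Re (ip IX (\<lambda>x. of_real (\<rho> x) * F x) W)"
    using WW VV ip_f_weight[of \<rho> W] c\<rho> l2 by (simp add: e_def)
  have "wsq \<rho>' W = wsq (\<lambda>x. 1) W + wsq (\<lambda>x. (- c) * qw \<gamma> x) W"
    unfolding \<rho>'_def[abs_def] by (subst wsq_add[symmetric]) (auto intro!: continuous_intros cont)
  then have w1: "wsq \<rho>' W = nsq IX W - c * wsq (qw \<gamma>) W"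
    by (simp only: wsq_cmult nsq_eq_wsq)
  \<comment> \<open>The discarded term \<open>- (c + 2 \<gamma>) n^2 q^2\<close> is nonpositive.
    What matters is the constant \<open>- \<Lambda>\<close>, which controls \<open>V\<close> also
    near \<open>x = 0\<close>, where \<open>q\<close> is of no help.\<close>
  have "wsq \<sigma>' V \<le> wsq (\<lambda>x. - \<Lambda> * 1 + (c * (n\<^sup>2 + \<Lambda>)) * qw \<gamma> x) V"
  proof (intro wsq_mono c\<rho> continuous_intros cont)
    fix x
    have "\<sigma>' x = - \<Lambda> * 1 + (c * (n\<^sup>2 + \<Lambda>)) * qw \<gamma> x - (c + 2 * \<gamma>) * n\<^sup>2 * (qw \<gamma> x)\<^sup>2"
      by (simp add: \<sigma>'_def \<rho>'_def e_def c_def algebra_simps power2_eq_square)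
    moreover have "(c + 2 * \<gamma>) * n\<^sup>2 * (qw \<gamma> x)\<^sup>2 \<ge> 0" using \<gamma> by (simp add: c_def)
    ultimately show "\<sigma>' x \<le> - \<Lambda> * 1 + (c * (n\<^sup>2 + \<Lambda>)) * qw \<gamma> x" by linarith
  qed
  also have "\<dots> = wsq (\<lambda>x. - \<Lambda> * 1) V + wsq (\<lambda>x. (c * (n\<^sup>2 + \<Lambda>)) * qw \<gamma> x) V"
    by (intro wsq_add continuous_intros cont)
  also have "\<dots> = - \<Lambda> * nsq IX V + c * (n\<^sup>2 + \<Lambda>) * wsq (qw \<gamma>) V"
    by (simp only: wsq_cmult nsq_eq_wsq)
  finally have w2: "wsq \<sigma>' V \<le> - \<Lambda> * nsq IX V + c * (n\<^sup>2 + \<Lambda>) * wsq (qw \<gamma>) V" .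
  \<comment> \<open>Parameter 1 in Young's inequality: the resulting \<open>nsq IX W\<close> cancels
    the one in \<open>w1\<close>, so \<open>W\<close> is left only with the weight
    \<open>q\<close>.\<close>
  have w3: "- 2 * Re (ip IX (\<lambda>x. of_real (\<rho> x) * F x) W) \<le> nsq IX F + nsq IX W"
  proof -
    have "nsq IX (\<lambda>x. of_real (\<rho> x) * F x) \<le> nsq IX F"
    proof (intro nsq_weight_le l2 c\<rho>)
      fix x :: real assume "x \<in> {-1..1}"
      then show "\<bar>\<rho> x\<bar> \<le> 1"
        using qw_nonneg[of \<gamma> x] qw_le_1[OF \<gamma>, of x] by (auto simp: \<rho>_def abs_mult intro!: mult_le_one)
    qed
    then show ?thesis
      using Re_ip_le[of IX "\<lambda>x. of_real (\<rho> x) * F x" W 1] l2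
      by (simp add: L2_continuous_mult c\<rho> continuous_intros)
  qed
  have "\<Lambda> * nsq IX V \<le> c * wsq (qw \<gamma>) W + c * (n\<^sup>2 + \<Lambda>) * wsq (qw \<gamma>) V + nsq IX F"
    using id w1 w2 w3 by linarith
  also have "c * wsq (qw \<gamma>) W \<le> c * ((4 * \<gamma>\<^sup>2 + 1) * nsq IX V + 2 * \<Lambda> * wsq (qw \<gamma>) V + nsq IX F)"
    using weighted_energy[OF \<Lambda>0] \<gamma> by (intro mult_left_mono) (auto simp: c_def)
  finally have A: "\<Lambda> * nsq IX V \<le> c * (4 * \<gamma>\<^sup>2 + 1) * nsq IX V + c * (3 * \<Lambda> + n\<^sup>2) * wsq (qw \<gamma>) V + (c + 1) * nsq IX F"
    by (simp add: algebra_simps)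
  \<comment> \<open>The lower bound on \<open>\<Lambda>\<close> is chosen for this step: the
    zeroth-order error is absorbed by half of the main term.\<close>
  have B: "c * (4 * \<gamma>\<^sup>2 + 1) * nsq IX V \<le> \<Lambda> / 2 * nsq IX V"
    using \<Lambda> by (intro mult_right_mono nsq_nonneg) (simp add: c_def algebra_simps)
  have X: "wsq (qw \<gamma>) V \<ge> 0" unfolding wsq_def
    by (intro integral_nonneg_AE) (auto simp: qw_nonneg)
  have C: "c * (3 * \<Lambda> + n\<^sup>2) * wsq (qw \<gamma>) V \<le> 3 * c * (\<Lambda> + n\<^sup>2) * wsq (qw \<gamma>) V"
    using \<gamma> X by (intro mult_right_mono) (auto simp: c_def algebra_simps)
  show ?thesis using A B C by (simp add: c_def algebra_simps)
qed

end

text \<open>Split at \<open>|x| = \<delta>\<close>; beyond it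
  \<open>|x| powr (2 \<gamma> - 2)\<close> is at least its value at \<open>\<delta>\<close>.\<close>

lemma sq_le_weight:
  assumes "\<gamma> \<ge> 1" "\<delta> > 0"
  shows "x\<^sup>2 \<le> \<delta>\<^sup>2 + \<delta> powr (2 - 2 * \<gamma>) * qw \<gamma> x"
proof (cases "\<bar>x\<bar> \<le> \<delta>")
  case True
  then have "x\<^sup>2 \<le> \<delta>\<^sup>2" using assms by (simp add: abs_le_square_iff[symmetric])
  then show ?thesis using qw_nonneg[of \<gamma> x] by (smt (verit) mult_nonneg_nonneg powr_ge_zero)
next
  case False
  then have x: "\<bar>x\<bar> > 0" using assms by linarith
  have "\<delta> powr (2 - 2 * \<gamma>) * \<delta> powr (2 * \<gamma> - 2) = 1"
    using assms by (simp flip: powr_add)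
  moreover have "\<delta> powr (2 * \<gamma> - 2) \<le> \<bar>x\<bar> powr (2 * \<gamma> - 2)"
    using False assms by (intro powr_mono2) auto
  ultimately have "1 \<le> \<delta> powr (2 - 2 * \<gamma>) * \<bar>x\<bar> powr (2 * \<gamma> - 2)"
    by (metis mult_left_mono powr_ge_zero)
  then have "x\<^sup>2 * 1 \<le> x\<^sup>2 * (\<delta> powr (2 - 2 * \<gamma>) * \<bar>x\<bar> powr (2 * \<gamma> - 2))"
    by (intro mult_left_mono) auto
  moreover have "x\<^sup>2 * \<bar>x\<bar> powr (2 * \<gamma> - 2) = qw \<gamma> x"
  proof -
    have "x\<^sup>2 = \<bar>x\<bar> powr 2" using x by (simp add: powr_numeral)
    then show ?thesis by (simp only: qw_def powr_add[symmetric]) simp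
  qed
  ultimately have "x\<^sup>2 \<le> \<delta> powr (2 - 2 * \<gamma>) * qw \<gamma> x"
    by (metis mult.left_commute mult.right_neutral)
  then show ?thesis by (smt (verit) zero_le_power2)
qed

lemma wsq_qw_nonneg: "wsq (qw \<gamma>) V \<ge> 0"
  unfolding wsq_def by (intro integral_nonneg_AE) (auto simp: qw_nonneg)

section \<open>Interaction of two modes\<close>

context
  fixes \<gamma> \<Lambda> n m :: real and V W f U Z g :: "real \<Rightarrow> complex"
  assumes \<gamma>: "\<gamma> \<ge> 1" and s: "sol V W f" and t: "sol U Z g"
begin

lemma ip_f_eq:
  "ip IX f U = of_real (n\<^sup>2) * ip IX (\<lambda>x. of_real (qw \<gamma> x) * V x) U - \<Lambda> * ip IX V U + ip IX (resid \<gamma> \<Lambda> n V f) U"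
proof -
  note cont = sol_continuous[OF s] continuous_on_qw[OF \<gamma>]
  have "ip IX f U = ip IX (\<lambda>x. of_real (n\<^sup>2 * qw \<gamma> x - \<Lambda>) * V x) U + ip IX (resid \<gamma> \<Lambda> n V f) U"
    using ip_f_weight[OF \<gamma> s, of "\<lambda>x. 1" U n \<Lambda>] sol_L2[OF t] by simp
  also have "(\<lambda>x. of_real (n\<^sup>2 * qw \<gamma> x - \<Lambda>) * V x) =
      (\<lambda>x. of_real (n\<^sup>2) * (of_real (qw \<gamma> x) * V x) + (- of_real \<Lambda>) * V x)"
    by (intro ext) (simp add: algebra_simps)
  also have "ip IX \<dots> U = ip IX (\<lambda>x. of_real (n\<^sup>2) * (of_real (qw \<gamma> x) * V x)) U + ip IX (\<lambda>x. (- of_real \<Lambda>) * V x) U"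
    by (intro ip_add_left L2_cmult L2_continuous_mult sol_L2[OF s] sol_L2[OF t] continuous_intros cont)
  finally show ?thesis by (simp only: ip_cmult_left) simp
qed

end

lemma ip_g_eq:
  assumes \<gamma>: "\<gamma> \<ge> 1" and s: "sol V W f" and t: "sol U Z g"
  shows "ip IX V g = of_real (m\<^sup>2) * ip IX (\<lambda>x. of_real (qw \<gamma> x) * V x) U - \<Lambda> * ip IX V U + ip IX V (resid \<gamma> \<Lambda> m U g)"
proof -
  have "ip IX V g = cnj (ip IX g V)" by (simp add: ip_cnj)
  also have "\<dots> = of_real (m\<^sup>2) * ip IX V (\<lambda>x. of_real (qw \<gamma> x) * U x) - \<Lambda> * ip IX V U + ip IX V (resid \<gamma> \<Lambda> m U g)"
    by (subst ip_f_eq[OF \<gamma> t s]) (simp add: ip_cnj)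
  also have "ip IX V (\<lambda>x. of_real (qw \<gamma> x) * U x) = ip IX (\<lambda>x. of_real (qw \<gamma> x) * V x) U"
    unfolding ip_def by (simp add: algebra_simps)
  finally show ?thesis .
qed

text \<open>In the difference of the two pairings \<open>\<Lambda>\<close> cancels and Green's
  identity removes the second derivatives. For \<open>n^2 = m^2\<close> the left side carries no
  information.\<close>

lemma mode_almost_orthogonal:
  assumes \<gamma>: "\<gamma> \<ge> 1" and s: "sol V W f" and t: "sol U Z g"
  shows "of_real (n\<^sup>2 - m\<^sup>2) * ip IX (\<lambda>x. of_real (qw \<gamma> x) * V x) U
    = ip IX V (resid \<gamma> \<Lambda> m U g) - ip IX (resid \<gamma> \<Lambda> n V f) U"
  using sol_green[OF s t] ip_f_eq[OF \<gamma> s t, of n \<Lambda>] ip_g_eq[OF \<gamma> s t, of m \<Lambda>]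
  by (simp add: algebra_simps)

text \<open>Average of the equation for \<open>V\<close> paired with \<open>U\<close> and the
  equation for \<open>U\<close> paired with \<open>V\<close>. The coefficient is the one that meets
  \<open>n m = (n^2 + m^2) / 2 - (m - n)^2 / 2\<close> in \<open>S_upper\<close>.\<close>

lemma mode_energy:
  assumes \<gamma>: "\<gamma> \<ge> 1" and s: "sol V W f" and t: "sol U Z g"
  shows "of_real ((n\<^sup>2 + m\<^sup>2) / 2) * ip IX (\<lambda>x. of_real (qw \<gamma> x) * V x) U
    = \<Lambda> * ip IX V U - ip IX W Z - (ip IX V (resid \<gamma> \<Lambda> m U g) + ip IX (resid \<gamma> \<Lambda> n V f) U) / 2"
proof -
  let ?a = "ip IX (\<lambda>x. of_real (qw \<gamma> x) * V x) U"
  have e1: "of_real (n\<^sup>2) * ?a = \<Lambda> * ip IX V U - ip IX W Z - ip IX (resid \<gamma> \<Lambda> n V f) U"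
    using sol_energy[OF s t] ip_f_eq[OF \<gamma> s t, of n \<Lambda>] by (simp add: algebra_simps)
  have e2: "of_real (m\<^sup>2) * ?a = \<Lambda> * ip IX V U - ip IX W Z - ip IX V (resid \<gamma> \<Lambda> m U g)"
    using sol_energy[OF s t] sol_green[OF s t] ip_g_eq[OF \<gamma> s t, of m \<Lambda>] by (simp add: algebra_simps)
  have "of_real ((n\<^sup>2 + m\<^sup>2) / 2) * ?a = (of_real (n\<^sup>2) * ?a + of_real (m\<^sup>2) * ?a) / 2"
    by (simp add: field_simps)
  then show ?thesis unfolding e1 e2 by (simp add: field_simps)
qed

text \<open>Uncertainty: \<open>\<parallel>V\<parallel>\<^sup>2 = -2 Re \<langle>x V', V\<rangle>\<close>, and \<open>x\<^sup>2 \<le> \<delta>\<^sup>2 + \<delta> powr (2 - 2 \<gamma>) q\<close>.\<close>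

lemma mode_elliptic:
  assumes \<gamma>: "\<gamma> \<ge> 1" and s: "sol V W f" and \<Lambda>: "\<Lambda> > 0" and \<delta>: "\<delta> > 0"
    and n: "n\<^sup>2 * \<delta> powr (2 * \<gamma> + 2) \<ge> 1" and \<delta>\<Lambda>: "10 * \<Lambda> * \<delta>\<^sup>2 \<le> 1"
  shows "\<Lambda>\<^sup>2 * nsq IX V \<le> nsq IX (resid \<gamma> \<Lambda> n V f)"
proof -
  note cont = sol_continuous[OF s] continuous_on_qw[OF \<gamma>]
  note l2 = sol_L2[OF s] L2_resid[OF \<gamma> s]
  let ?F = "resid \<gamma> \<Lambda> n V f"
  define X where "X = wsq (qw \<gamma>) V"
  define E where "E = nsq IX W + n\<^sup>2 * X"
  have X: "X \<ge> 0" unfolding X_def by (rule wsq_qw_nonneg)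
  have E: "E \<ge> 0" unfolding E_def using X nsq_nonneg by (smt (verit) mult_nonneg_nonneg zero_le_power2)
  let ?xV = "\<lambda>x. complex_of_real x * V x"
  have "wsq (\<lambda>x. 1) V + 2 * Re (ip IX (\<lambda>x. of_real x * W x) V) = 0"
    using AC_weighted_square[of V W "\<lambda>x. x" "\<lambda>x. 1"] s l2 by (simp add: sol_def)
  moreover have "ip IX (\<lambda>x. of_real x * W x) V = ip IX W ?xV"
    unfolding ip_def by (simp add: algebra_simps)
  \<comment> \<open>With parameter \<open>2 \<delta>^2\<close> the part of \<open>x^2\<close>
    bounded by \<open>\<delta>^2\<close> returns only half of \<open>nsq IX V\<close>, which can be
    absorbed.\<close>
  moreover have "\<bar>Re (ip IX W ?xV)\<bar> \<le> (2 * \<delta>\<^sup>2 * nsq IX W + nsq IX ?xV / (2 * \<delta>\<^sup>2)) / 2"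
    using \<delta> by (intro Re_ip_le L2_continuous_mult l2 continuous_intros) auto
  ultimately have N1: "nsq IX V \<le> 2 * \<delta>\<^sup>2 * nsq IX W + nsq IX ?xV / (2 * \<delta>\<^sup>2)"
    by (simp add: nsq_eq_wsq)
  have "nsq IX ?xV = wsq (\<lambda>x. x\<^sup>2) V"
    unfolding nsq_def wsq_def by (simp add: norm_mult power_mult_distrib)
  also have "\<dots> \<le> wsq (\<lambda>x. \<delta>\<^sup>2 * 1 + \<delta> powr (2 - 2 * \<gamma>) * qw \<gamma> x) V"
    by (intro wsq_mono continuous_intros cont) (simp add: sq_le_weight[OF \<gamma> \<delta>])
  also have "\<dots> = wsq (\<lambda>x. \<delta>\<^sup>2 * 1) V + wsq (\<lambda>x. \<delta> powr (2 - 2 * \<gamma>) * qw \<gamma> x) V"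
    by (intro wsq_add continuous_intros cont)
  also have "\<dots> = \<delta>\<^sup>2 * nsq IX V + \<delta> powr (2 - 2 * \<gamma>) * X"
    by (simp only: wsq_cmult nsq_eq_wsq X_def)
  \<comment> \<open>The hypothesis on \<open>n\<close> amounts to
    \<open>\<delta> powr (2 - 2 \<gamma>) \<le> n^2 \<delta>^4\<close>, so this part is paid for by
    the potential energy.\<close>
  also have "\<delta> powr (2 - 2 * \<gamma>) * X \<le> \<delta> ^ 4 * E"
  proof -
    have "\<delta> powr (2 - 2 * \<gamma>) * 1 \<le> \<delta> powr (2 - 2 * \<gamma>) * (n\<^sup>2 * \<delta> powr (2 * \<gamma> + 2))"
      using n by (intro mult_left_mono) auto
    also have "\<dots> = n\<^sup>2 * \<delta> powr 4" by (simp add: algebra_simps flip: powr_add)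
    also have "\<dots> = n\<^sup>2 * \<delta> ^ 4" using \<delta> by (simp add: powr_numeral)
    finally have "\<delta> powr (2 - 2 * \<gamma>) * X \<le> n\<^sup>2 * \<delta> ^ 4 * X" using X by (intro mult_right_mono) auto
    also have "\<dots> \<le> \<delta> ^ 4 * E" using nsq_nonneg[of IX W] by (simp add: E_def algebra_simps)
    finally show ?thesis .
  qed
  finally have "nsq IX ?xV / (2 * \<delta>\<^sup>2) \<le> (\<delta>\<^sup>2 * nsq IX V + \<delta> ^ 4 * E) / (2 * \<delta>\<^sup>2)"
    using \<delta> by (intro divide_right_mono) auto
  also have "\<dots> = nsq IX V / 2 + \<delta>\<^sup>2 * E / 2"
    using \<delta> by (simp add: field_simps power2_eq_square power4_eq_xxxx)
  finally have N2: "nsq IX ?xV / (2 * \<delta>\<^sup>2) \<le> nsq IX V / 2 + \<delta>\<^sup>2 * E / 2" .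
  have "2 * \<delta>\<^sup>2 * nsq IX W \<le> 2 * \<delta>\<^sup>2 * E" using X by (intro mult_left_mono) (auto simp: E_def)
  with N1 N2 have N: "nsq IX V \<le> 5 * \<delta>\<^sup>2 * E" by linarith
  then have "2 * \<Lambda> * nsq IX V \<le> 2 * \<Lambda> * (5 * \<delta>\<^sup>2 * E)" using \<Lambda> by (intro mult_left_mono) auto
  also have "\<dots> = 10 * \<Lambda> * \<delta>\<^sup>2 * E" by simp
  also have "\<dots> \<le> E" using mult_right_mono[OF \<delta>\<Lambda> E] by simp
  \<comment> \<open>The 10 in the bound on \<open>\<delta>\<close> is 5 times 2: the energy
    dominates \<open>\<Lambda> |V|^2\<close> twice, once to cancel it in the energy identity below
    and once to spare.\<close>
  finally have NE: "2 * \<Lambda> * nsq IX V \<le> E" .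
  have "- ip IX W W = of_real (n\<^sup>2) * ip IX (\<lambda>x. of_real (qw \<gamma> x) * V x) V - of_real \<Lambda> * ip IX V V + ip IX ?F V"
    using ip_f_eq[OF \<gamma> s s, of n \<Lambda>] sol_energy[OF s s] by simp
  then have "Re (- ip IX W W) = Re (n\<^sup>2 * ip IX (\<lambda>x. of_real (qw \<gamma> x) * V x) V - \<Lambda> * ip IX V V + ip IX ?F V)"
    by (rule arg_cong)
  then have "- nsq IX W = n\<^sup>2 * X - \<Lambda> * nsq IX V + Re (ip IX ?F V)"
    using Re_ip_weight[of "qw \<gamma>" V] cont by (simp add: ip_self X_def flip: of_real_power)
  then have Eeq: "E = \<Lambda> * nsq IX V - Re (ip IX ?F V)" by (simp add: E_def)
  have "\<bar>Re (ip IX ?F V)\<bar> \<le> (1 / \<Lambda> * nsq IX ?F + nsq IX V / (1 / \<Lambda>)) / 2"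
    using \<Lambda> by (intro Re_ip_le l2) auto
  moreover have "nsq IX V / (1 / \<Lambda>) = \<Lambda> * nsq IX V" "1 / \<Lambda> * nsq IX ?F = nsq IX ?F / \<Lambda>" by simp_all
  ultimately have "\<bar>Re (ip IX ?F V)\<bar> \<le> (nsq IX ?F / \<Lambda> + \<Lambda> * nsq IX V) / 2" by (simp only:)
  note abs_le_D2[OF this]
  moreover have "2 * (\<Lambda> * nsq IX V) \<le> \<Lambda> * nsq IX V - Re (ip IX ?F V)" using NE Eeq by simp
  moreover have "a \<le> b" if "- r \<le> (b + a) / 2" "2 * a \<le> a - r" for a b r :: real
    using that by (simp add: field_simps)
  ultimately have "\<Lambda> * nsq IX V \<le> nsq IX ?F / \<Lambda>" by blast
  then show ?thesis using \<Lambda> by (simp add: field_simps power2_eq_square)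
qed

section \<open>Observability of finitely many modes\<close>

definition em :: "int \<Rightarrow> real \<Rightarrow> complex" where
  "em n y = cis (of_int n * y)"

lemma em_add: "em (n + m) y = em n y * em m y"
  by (simp add: em_def cis_mult distrib_right)

lemma em_0 [simp]: "em 0 y = 1"
  by (simp add: em_def)

lemma cnj_em: "cnj (em n y) = em (- n) y"
  by (simp add: em_def cis_cnj)

lemma norm_em [simp]: "norm (em n y) = 1"
  by (simp add: em_def)

lemma has_vector_derivative_em:
  "(em n has_vector_derivative (\<i> * of_int n) * em n y) (at y within A)"
proof -
  have "((\<lambda>z. exp (\<i> * of_int n * z)) has_field_derivative (\<i> * of_int n) * exp (\<i> * of_int n * of_real y)) (at (of_real y))"
    by (auto intro!: derivative_eq_intros)
  from has_vector_derivative_at_within[OF has_vector_derivative_real_field[OF this]]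
  show ?thesis by (simp add: em_def[abs_def] cis_conv_exp mult.assoc)
qed

lemma continuous_on_em [continuous_intros]: "continuous_on A (em n)"
  unfolding em_def[abs_def] by (intro continuous_intros)

lemma measurable_em [measurable]: "em n \<in> borel_measurable borel"
  by (intro borel_measurable_continuous_onI continuous_intros)

text \<open>The observation weight \<open>w\<close> is a square so that \<open>w\<close> and \<open>w'\<close> vanish at both ends of \<open>[\<alpha>, \<beta>]\<close>.
  Its Fourier coefficients are then summable, and uniformly smaller than the zeroth one.\<close>

locale window =
  fixes \<alpha> \<beta> :: real
  assumes \<alpha>\<beta>: "\<alpha> < \<beta>"
begin

definition w :: "real \<Rightarrow> real" where "w y = ((y - \<alpha>) * (\<beta> - y))\<^sup>2"
definition w1 :: "real \<Rightarrow> real" where "w1 y = 2 * ((y - \<alpha>) * (\<beta> - y)) * (\<alpha> + \<beta> - 2 * y)"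
definition w2 :: "real \<Rightarrow> real" where "w2 y = 2 * (\<alpha> + \<beta> - 2 * y)\<^sup>2 - 4 * ((y - \<alpha>) * (\<beta> - y))"

text \<open>Fourier coefficient of \<open>s\<close> extended by zero from
  \<open>[\<alpha>, \<beta>]\<close>, without the factor \<open>1 / (2 pi)\<close>.\<close>

definition hat :: "(real \<Rightarrow> real) \<Rightarrow> int \<Rightarrow> complex" where
  "hat s k = (\<integral>y. of_real (s y) * em (- k) y \<partial>MI \<alpha> \<beta>)"

lemma w_deriv: "(w has_real_derivative w1 y) (at y)" "(w1 has_real_derivative w2 y) (at y)"
  unfolding w_def[abs_def] w1_def[abs_def] w2_def
  by (auto intro!: derivative_eq_intros simp: algebra_simps power2_eq_square)

lemma w_cont [continuous_intros]: "continuous_on A w" "continuous_on A w1" "continuous_on A w2"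
  unfolding w_def[abs_def] w1_def[abs_def] w2_def[abs_def] by (intro continuous_intros)+

lemma hat_by_parts:
  assumes d: "\<And>y. (s has_real_derivative s' y) (at y)" and c: "continuous_on {\<alpha>..\<beta>} s'"
    and b: "s \<alpha> = 0" "s \<beta> = 0"
  shows "hat s' k = \<i> * of_int k * hat s k"
proof -
  have cs: "continuous_on {\<alpha>..\<beta>} s" using d by (intro DERIV_continuous_on) (auto intro: has_field_derivative_at_within)
  have dv: "((\<lambda>y. of_real (s y) * em (- k) y) has_vector_derivative
      of_real (s y) * ((\<i> * of_int (- k)) * em (- k) y) + of_real (s' y) * em (- k) y) (at y within {\<alpha>..\<beta>})" for y
    by (intro has_vector_derivative_mult C1_of_real d has_vector_derivative_em)
  have i: "integrable (MI \<alpha> \<beta>) (\<lambda>y. of_real (s y) * em (- k) y)" "integrable (MI \<alpha> \<beta>) (\<lambda>y. of_real (s' y) * em (- k) y)"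
    by (intro integrable_continuous_MI continuous_intros cs c)+
  have "0 = (\<integral>y. of_real (s y) * ((\<i> * of_int (- k)) * em (- k) y) + of_real (s' y) * em (- k) y \<partial>MI \<alpha> \<beta>)"
    using \<alpha>\<beta> b by (subst integral_MI_FTC[OF _ _ dv]) (auto intro!: continuous_intros cs c)
  also have "\<dots> = (\<integral>y. (\<i> * of_int (- k)) * (of_real (s y) * em (- k) y) + of_real (s' y) * em (- k) y \<partial>MI \<alpha> \<beta>)"
    by (intro Bochner_Integration.integral_cong) (auto simp: algebra_simps)
  also have "\<dots> = (\<i> * of_int (- k)) * hat s k + hat s' k"
    using i by (simp add: hat_def del: of_int_minus mult_minus_left)
  finally show ?thesis by (simp add: eq_neg_iff_add_eq_0 add.commute)
qed

text \<open>Serves twice: it gives the quadratic decay of \<open>hat w\<close>, and in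
  \<open>S_upper\<close> it turns the factor \<open>(m - n)^2\<close> into a form with a bounded
  weight.\<close>

lemma hat_w2: "hat w2 k = - (of_int k)\<^sup>2 * hat w k"
proof -
  have "hat w1 k = \<i> * of_int k * hat w k"
    by (rule hat_by_parts) (auto intro: w_deriv w_cont simp: w_def)
  moreover have "hat w2 k = \<i> * of_int k * hat w1 k"
    by (rule hat_by_parts) (auto intro: w_deriv w_cont simp: w1_def)
  ultimately show ?thesis by (simp add: power2_eq_square algebra_simps)
qed

lemma norm_hat_le:
  assumes "continuous_on {\<alpha>..\<beta>} s"
  shows "norm (hat s k) \<le> (\<integral>y. \<bar>s y\<bar> \<partial>MI \<alpha> \<beta>)"
proof -
  have "norm (hat s k) \<le> (\<integral>y. norm (of_real (s y) * em (- k) y) \<partial>MI \<alpha> \<beta>)"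
    unfolding hat_def by (rule integral_norm_bound)
  then show ?thesis by (simp add: norm_mult)
qed

definition w2L1 :: real where "w2L1 = (\<integral>y. \<bar>w2 y\<bar> \<partial>MI \<alpha> \<beta>)"
definition wL1 :: real where "wL1 = (\<integral>y. w y \<partial>MI \<alpha> \<beta>)"

lemma norm_hat_w_le_wL1: "norm (hat w k) \<le> wL1"
  using norm_hat_le[OF w_cont(1), of k] by (simp add: wL1_def w_def)

lemma hat_decay: "(of_int k)\<^sup>2 * norm (hat w k) \<le> w2L1"
proof -
  have "(of_int k)\<^sup>2 * norm (hat w k) = norm (hat w2 k)"
    by (simp add: hat_w2 norm_mult norm_power)
  then show ?thesis using norm_hat_le[of w2 k] w_cont by (simp add: w2L1_def)
qed

text \<open>Equality in the triangle inequality would force the phase \<open>k y\<close> to be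
  constant modulo \<open>2 pi\<close> on the window, which is impossible on an interval.\<close>

lemma hat_strict:
  assumes k: "k \<noteq> 0"
  shows "norm (hat w k) < wL1"
proof (rule ccontr)
  assume "\<not> ?thesis"
  then have eq: "norm (hat w k) = wL1" using norm_hat_w_le_wL1[of k] by simp
  obtain \<theta> where \<theta>: "hat w k = of_real (norm (hat w k)) * cis \<theta>"
    by (metis rcis_Ex rcis_def norm_of_real rcis_cmod_Arg)
  have i: "integrable (MI \<alpha> \<beta>) (\<lambda>y. of_real (w y) * em (- k) y)"
    by (intro integrable_continuous_MI continuous_intros)
  let ?c = "\<lambda>y. w y * cos (of_int k * y + \<theta>)"
  have ic: "integrable (MI \<alpha> \<beta>) w" "integrable (MI \<alpha> \<beta>) ?c"
    by (intro integrable_continuous_MI continuous_intros)+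
  have "cis (- \<theta>) * hat w k = of_real wL1"
    by (subst \<theta>) (simp add: eq mult.left_commute cis_mult)
  then have "wL1 = Re (cis (- \<theta>) * hat w k)" by simp
  also have "cis (- \<theta>) * hat w k = (\<integral>y. cis (- \<theta>) * (of_real (w y) * em (- k) y) \<partial>MI \<alpha> \<beta>)"
    unfolding hat_def using i by simp
  also have "Re \<dots> = (\<integral>y. Re (cis (- \<theta>) * (of_real (w y) * em (- k) y)) \<partial>MI \<alpha> \<beta>)"
    using i by (subst integral_Re) auto
  also have "\<dots> = integral\<^sup>L (MI \<alpha> \<beta>) ?c"
  proof (intro Bochner_Integration.integral_cong refl)
    fix y
    have "cis (- \<theta>) * (of_real (w y) * em (- k) y) = of_real (w y) * cis (- (of_int k * y + \<theta>))"
      by (simp add: em_def cis_mult mult.left_commute algebra_simps)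
    then show "Re (cis (- \<theta>) * (of_real (w y) * em (- k) y)) = ?c y"
      by (simp only: times_complex.sel Re_complex_of_real Im_complex_of_real cis.sel cos_minus mult_zero_left diff_zero)
  qed
  finally have "(\<integral>y. w y - ?c y \<partial>MI \<alpha> \<beta>) = 0" using ic by (simp add: wL1_def)
  moreover have cw: "continuous_on {\<alpha>..\<beta>} (\<lambda>y. w y - ?c y)" by (intro continuous_intros)
  ultimately have "integral {\<alpha>..\<beta>} (\<lambda>y. w y - ?c y) = 0"
    using integral_MI_HK(1)[OF integrable_continuous_MI[OF cw]] by simp
  moreover have nn: "w y - ?c y \<ge> 0" for y
  proof -
    have "w y * cos (of_int k * y + \<theta>) \<le> w y * 1" by (intro mult_left_mono) (auto simp: w_def)
    then show ?thesis by simp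
  qed
  ultimately have z: "\<forall>y\<in>{\<alpha>..\<beta>}. w y - ?c y = 0"
    using integral_eq_0_iff[OF cw \<alpha>\<beta>] by simp
  have one: "cos (of_int k * y + \<theta>) = 1" if "\<alpha> < y" "y < \<beta>" for y
  proof -
    have "w y * (1 - cos (of_int k * y + \<theta>)) = 0" using z that by (simp add: algebra_simps)
    moreover have "w y \<noteq> 0" using that by (simp add: w_def)
    ultimately show ?thesis by simp
  qed
  \<comment> \<open>Leaves room for two points of the open window at distance
    \<open>\<epsilon>\<close>, with \<open>|k| \<epsilon> \<le> 1 < pi\<close>. Cosine 1 at both
    would give \<open>cos (k \<epsilon>) = 1\<close>, which is excluded in that range.\<close>
  define \<epsilon> where "\<epsilon> = min ((\<beta> - \<alpha>) / 3) (1 / \<bar>of_int k\<bar>)"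
  have \<epsilon>: "\<epsilon> > 0" using \<alpha>\<beta> k by (simp add: \<epsilon>_def)
  have \<epsilon>2: "\<epsilon> \<le> (\<beta> - \<alpha>) / 3" "\<bar>of_int k\<bar> * \<epsilon> \<le> 1"
    using k by (auto simp: \<epsilon>_def min_def field_simps)
  define y where "y = \<alpha> + \<epsilon>"
  have c1: "cos (of_int k * y + \<theta>) = 1" "cos (of_int k * (y + \<epsilon>) + \<theta>) = 1"
    using \<epsilon> \<epsilon>2 \<alpha>\<beta> by (intro one; simp add: y_def field_simps)+
  have s1: "sin (of_int k * y + \<theta>) = 0" using c1(1) sin_cos_squared_add[of "of_int k * y + \<theta>"] by simp
  have "of_int k * (y + \<epsilon>) + \<theta> = (of_int k * y + \<theta>) + of_int k * \<epsilon>" by (simp add: algebra_simps)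
  then have "cos (of_int k * \<epsilon>) = 1" using c1 s1 by (simp only: cos_add)
  then have "cos (\<bar>of_int k\<bar> * \<epsilon>) = 1" by (cases "k \<ge> 0") auto
  moreover have "cos (\<bar>of_int k\<bar> * \<epsilon>) < cos 0"
    using \<epsilon> \<epsilon>2 k pi_ge_two by (intro cos_monotone_0_pi) auto
  ultimately show False by simp
qed

lemma wL1_pos: "wL1 > 0"
  using hat_strict[of 1] norm_ge_zero[of "hat w 1"] by linarith

text \<open>The decay settles all but finitely many \<open>k\<close>; for the others the minimum of
  finitely many positive gaps is taken.\<close>

lemma hat_uniform: obtains \<kappa> where "\<kappa> > 0" "\<And>k. k \<noteq> 0 \<Longrightarrow> norm (hat w k) \<le> wL1 - \<kappa>"
proof -
  define K where "K = {k::int. k \<noteq> 0 \<and> (of_int k)\<^sup>2 \<le> 2 * w2L1 / wL1}"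
  have "finite K"
  proof (rule finite_subset)
    define B where "B = 2 * w2L1 / wL1"
    show "K \<subseteq> {- \<lceil>B\<rceil>..\<lceil>B\<rceil>}"
    proof
      fix k assume "k \<in> K"
      then have k: "k \<noteq> 0" "(of_int k)\<^sup>2 \<le> B" by (auto simp: K_def B_def)
      have "\<bar>k\<bar> \<le> k\<^sup>2" using mult_left_mono[of 1 "\<bar>k\<bar>" "\<bar>k\<bar>"] k(1) by (simp add: power2_eq_square)
      then have "of_int \<bar>k\<bar> \<le> (of_int (k\<^sup>2) :: real)" by (simp only: of_int_le_iff)
      then have "of_int \<bar>k\<bar> \<le> B" using k(2) by simp
      then have "\<bar>k\<bar> \<le> \<lceil>B\<rceil>" by (metis ceiling_mono ceiling_of_int)
      then show "k \<in> {- \<lceil>B\<rceil>..\<lceil>B\<rceil>}" by auto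
    qed
  qed simp
  define \<kappa> where "\<kappa> = Min (insert (wL1 / 2) ((\<lambda>k. wL1 - norm (hat w k)) ` K))"
  have "\<kappa> > 0" unfolding \<kappa>_def using \<open>finite K\<close> wL1_pos hat_strict by (auto simp: K_def)
  moreover have "norm (hat w k) \<le> wL1 - \<kappa>" if k: "k \<noteq> 0" for k
  proof (cases "k \<in> K")
    case True
    then have "\<kappa> \<le> wL1 - norm (hat w k)" unfolding \<kappa>_def using \<open>finite K\<close> by (intro Min_le) auto
    then show ?thesis by simp
  next
    case False
    then have *: "2 * w2L1 / wL1 < (of_int k)\<^sup>2" using k by (simp add: K_def)
    have "(of_int k)\<^sup>2 * norm (hat w k) \<le> (of_int k)\<^sup>2 * (wL1 / 2)"
      using hat_decay[of k] * wL1_pos by (simp add: field_simps)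
    then have "norm (hat w k) \<le> wL1 / 2" using k by simp
    moreover have "\<kappa> \<le> wL1 / 2" unfolding \<kappa>_def using \<open>finite K\<close> by (intro Min_le) auto
    ultimately show ?thesis by simp
  qed
  ultimately show ?thesis using that by blast
qed

text \<open>Zeroth coefficient plus two half-lines of \<open>w2L1 / k^2\<close>, each summing to at
  most \<open>2 w2L1\<close>.\<close>

definition Mw :: real where "Mw = wL1 + 4 * w2L1"

lemma w2L1_nonneg: "w2L1 \<ge> 0"
  unfolding w2L1_def by (intro integral_nonneg_AE) auto

lemma sum_inverse_squares: "(\<Sum>k=1..n. 1 / (real k)\<^sup>2) \<le> 2"
proof -
  \<comment> \<open>The sharper bound with \<open>- 1 / n\<close> is the one an induction can carry,
    by telescoping.\<close>
  have "(\<Sum>k=1..n. 1 / (real k)\<^sup>2) \<le> 2 - 1 / real n" if "n \<ge> 1"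
    using that
  proof (induction n rule: dec_induct)
    case (step n)
    have "1 / (real (Suc n))\<^sup>2 \<le> 1 / real n - 1 / real (Suc n)"
    proof -
      have "1 / (real (Suc n))\<^sup>2 \<le> 1 / (real n * real (Suc n))"
        using step(1) by (intro divide_left_mono mult_pos_pos) (auto simp: power2_eq_square)
      then show ?thesis using step(1) by (simp add: field_simps)
    qed
    then show ?case using step by simp
  qed simp
  then show ?thesis by (cases "n \<ge> 1") (auto intro: order_trans)
qed

lemma sum_hat_le: "finite A \<Longrightarrow> (\<Sum>k\<in>A. norm (hat w k)) \<le> Mw"
proof -
  assume A: "finite A"
  obtain n where n: "\<forall>k\<in>A. \<bar>k\<bar> \<le> int n"
  proof
    show "\<forall>k\<in>A. \<bar>k\<bar> \<le> int (nat (Max (insert 0 (abs ` A))))"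
      using A by (auto simp: Max_ge_iff)
  qed
  have sub: "A \<subseteq> {0} \<union> int ` {1..n} \<union> (\<lambda>k. - int k) ` {1..n}"
  proof
    fix k assume "k \<in> A"
    with n have "\<bar>k\<bar> \<le> int n" by blast
    then have "k = 0 \<or> (nat k \<in> {1..n} \<and> k = int (nat k)) \<or> (nat (- k) \<in> {1..n} \<and> k = - int (nat (- k)))" by auto
    then show "k \<in> {0} \<union> int ` {1..n} \<union> (\<lambda>k. - int k) ` {1..n}" by (auto intro: rev_image_eqI)
  qed
  have le: "norm (hat w k) \<le> w2L1 / (of_int k)\<^sup>2" if "k \<noteq> 0" for k
    using hat_decay[of k] that by (simp add: field_simps)
  have "(\<Sum>k\<in>A. norm (hat w k)) \<le> (\<Sum>k\<in>{0} \<union> int ` {1..n} \<union> (\<lambda>k. - int k) ` {1..n}. norm (hat w k))"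
    by (intro sum_mono2 sub) auto
  also have "\<dots> = (\<Sum>k\<in>{0}. norm (hat w k)) + (\<Sum>k\<in>int ` {1..n}. norm (hat w k)) + (\<Sum>k\<in>(\<lambda>k. - int k) ` {1..n}. norm (hat w k))"
    by (subst sum.union_disjoint, simp, simp, force, subst sum.union_disjoint) auto
  also have "(\<Sum>k\<in>int ` {1..n}. norm (hat w k)) = (\<Sum>k\<in>{1..n}. norm (hat w (int k)))"
    by (subst sum.reindex) auto
  also have "\<dots> \<le> (\<Sum>k\<in>{1..n}. w2L1 * (1 / (real k)\<^sup>2))"
    using le[of "int _"] by (intro sum_mono) auto
  also have "\<dots> \<le> w2L1 * 2"
    unfolding sum_distrib_left[symmetric] by (intro mult_left_mono sum_inverse_squares w2L1_nonneg)
  also have "(\<Sum>k\<in>(\<lambda>k. - int k) ` {1..n}. norm (hat w k)) = (\<Sum>k\<in>{1..n}. norm (hat w (- int k)))"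
    by (subst sum.reindex) (auto simp: inj_on_def)
  also have "\<dots> \<le> (\<Sum>k\<in>{1..n}. w2L1 * (1 / (real k)\<^sup>2))"
    using le[of "- int _"] by (intro sum_mono) auto
  also have "\<dots> \<le> w2L1 * 2"
    unfolding sum_distrib_left[symmetric] by (intro mult_left_mono sum_inverse_squares w2L1_nonneg)
  finally show ?thesis using norm_hat_w_le_wL1[of 0] by (simp add: Mw_def)
qed

end

section \<open>Quadratic forms of trigonometric polynomials on the window\<close>

context window
begin

definition trig :: "int set \<Rightarrow> (int \<Rightarrow> real \<Rightarrow> complex) \<Rightarrow> real \<Rightarrow> real \<Rightarrow> complex" where
  "trig A P x y = (\<Sum>n\<in>A. P n x * em n y)"

definition Q :: "int set \<Rightarrow> (real \<Rightarrow> real) \<Rightarrow> (real \<Rightarrow> real) \<Rightarrow> (int \<Rightarrow> real \<Rightarrow> complex) \<Rightarrow> real" where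
  "Q A s t P = (\<integral>x. t x * (\<integral>y. s y * (norm (trig A P x y))\<^sup>2 \<partial>MI \<alpha> \<beta>) \<partial>IX)"

lemma inner_form:
  assumes "finite A" "continuous_on {\<alpha>..\<beta>} s"
  shows "complex_of_real (\<integral>y. s y * (norm (trig A P x y))\<^sup>2 \<partial>MI \<alpha> \<beta>)
    = (\<Sum>n\<in>A. \<Sum>m\<in>A. hat s (m - n) * (P n x * cnj (P m x)))"
proof -
  have i: "integrable (MI \<alpha> \<beta>) (\<lambda>y. of_real (s y) * em (- k) y * c)" for k c
    by (intro integrable_continuous_MI continuous_intros assms)
  have "complex_of_real (\<integral>y. s y * (norm (trig A P x y))\<^sup>2 \<partial>MI \<alpha> \<beta>)
      = (\<integral>y. complex_of_real (s y * (norm (trig A P x y))\<^sup>2) \<partial>MI \<alpha> \<beta>)"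
    by (rule integral_complex_of_real[symmetric])
  also have "\<dots> = (\<integral>y. (\<Sum>n\<in>A. \<Sum>m\<in>A. of_real (s y) * em (- (m - n)) y * (P n x * cnj (P m x))) \<partial>MI \<alpha> \<beta>)"
  proof (intro Bochner_Integration.integral_cong refl)
    fix y
    have "complex_of_real (s y * (norm (trig A P x y))\<^sup>2) = of_real (s y) * (trig A P x y * cnj (trig A P x y))"
      by (simp only: of_real_mult complex_norm_square)
    also have "trig A P x y * cnj (trig A P x y) = (\<Sum>n\<in>A. \<Sum>m\<in>A. (P n x * em n y) * cnj (P m x * em m y))"
      by (simp add: trig_def sum_product)
    also have "of_real (s y) * \<dots> = (\<Sum>n\<in>A. \<Sum>m\<in>A. of_real (s y) * ((P n x * em n y) * cnj (P m x * em m y)))"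
      by (simp only: sum_distrib_left)
    also have "\<dots> = (\<Sum>n\<in>A. \<Sum>m\<in>A. of_real (s y) * em (- (m - n)) y * (P n x * cnj (P m x)))"
    proof (intro sum.cong refl)
      fix n m
      have "em (- (m - n)) y = em n y * cnj (em m y)" by (simp add: cnj_em flip: em_add)
      then show "of_real (s y) * ((P n x * em n y) * cnj (P m x * em m y)) = of_real (s y) * em (- (m - n)) y * (P n x * cnj (P m x))"
        by (simp add: algebra_simps)
    qed
    finally show "complex_of_real (s y * (norm (trig A P x y))\<^sup>2) = (\<Sum>n\<in>A. \<Sum>m\<in>A. of_real (s y) * em (- (m - n)) y * (P n x * cnj (P m x)))" .
  qed
  also have "\<dots> = (\<Sum>n\<in>A. \<Sum>m\<in>A. (\<integral>y. of_real (s y) * em (- (m - n)) y * (P n x * cnj (P m x)) \<partial>MI \<alpha> \<beta>))"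
    by (subst Bochner_Integration.integral_sum, intro Bochner_Integration.integrable_sum i)
      (intro sum.cong refl Bochner_Integration.integral_sum i)
  also have "\<dots> = (\<Sum>n\<in>A. \<Sum>m\<in>A. hat s (m - n) * (P n x * cnj (P m x)))"
    unfolding hat_def by (intro sum.cong refl Bochner_Integration.integral_mult_left integrable_continuous_MI continuous_intros assms)
  finally show ?thesis .
qed

lemma continuous_inner_form:
  assumes "finite A" "continuous_on {\<alpha>..\<beta>} s" "\<And>n. n \<in> A \<Longrightarrow> continuous_on {-1..1} (P n)"
  shows "continuous_on {-1..1} (\<lambda>x. \<integral>y. s y * (norm (trig A P x y))\<^sup>2 \<partial>MI \<alpha> \<beta>)"
proof -
  have "continuous_on {-1..1} (\<lambda>x. Re (\<Sum>n\<in>A. \<Sum>m\<in>A. hat s (m - n) * (P n x * cnj (P m x))))"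
    using assms by (intro continuous_intros) auto
  then show ?thesis by (simp add: inner_form[OF assms(1,2), symmetric])
qed

text \<open>Dictionary between double sums over modes, where the equations are used, and integrals
  over the window, where sign and size of the weights are visible.\<close>

lemma quadratic_form:
  assumes "finite A" "continuous_on {\<alpha>..\<beta>} s" "\<And>n. n \<in> A \<Longrightarrow> continuous_on {-1..1} (P n)"
    and t: "continuous_on {-1..1} t"
  shows "(\<Sum>n\<in>A. \<Sum>m\<in>A. hat s (m - n) * ip IX (\<lambda>x. of_real (t x) * P n x) (P m)) = complex_of_real (Q A s t P)"
proof -
  have i: "integrable IX (\<lambda>x. hat s (m - n) * (of_real (t x) * P n x * cnj (P m x)))" if "n \<in> A" "m \<in> A" for n m
    using that by (intro integrable_continuous_MI continuous_intros assms)
  have "complex_of_real (Q A s t P) = (\<integral>x. complex_of_real (t x * (\<integral>y. s y * (norm (trig A P x y))\<^sup>2 \<partial>MI \<alpha> \<beta>)) \<partial>IX)"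
    unfolding Q_def by (rule integral_complex_of_real[symmetric])
  also have "\<dots> = (\<integral>x. (\<Sum>n\<in>A. \<Sum>m\<in>A. hat s (m - n) * (of_real (t x) * P n x * cnj (P m x))) \<partial>IX)"
    by (intro Bochner_Integration.integral_cong refl)
      (simp only: of_real_mult inner_form[OF assms(1,2)] sum_distrib_left, simp add: mult_ac)
  also have "\<dots> = (\<Sum>n\<in>A. \<Sum>m\<in>A. (\<integral>x. hat s (m - n) * (of_real (t x) * P n x * cnj (P m x)) \<partial>IX))"
    by (subst Bochner_Integration.integral_sum, intro Bochner_Integration.integrable_sum i, assumption+)
      (intro sum.cong refl Bochner_Integration.integral_sum i)
  finally show ?thesis unfolding ip_def by simp
qed

lemma Q_mono:
  assumes "finite A" "\<And>n. n \<in> A \<Longrightarrow> continuous_on {-1..1} (P n)"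
    and "continuous_on {\<alpha>..\<beta>} s" "continuous_on {-1..1} t" "B \<ge> 0"
    and s: "\<And>x y. x \<in> {-1..1} \<Longrightarrow> y \<in> {\<alpha>..\<beta>} \<Longrightarrow> t x * s y \<le> B"
  shows "Q A s t P \<le> B * Q A (\<lambda>y. 1) (\<lambda>x. 1) P"
proof -
  have ct: "continuous_on {\<alpha>..\<beta>} (trig A P x)" for x
    unfolding trig_def[abs_def] by (intro continuous_intros)
  have "Q A s t P \<le> (\<integral>x. B * (\<integral>y. 1 * (norm (trig A P x y))\<^sup>2 \<partial>MI \<alpha> \<beta>) \<partial>IX)"
    unfolding Q_def
  proof (intro integral_mono)
    show "integrable IX (\<lambda>x. t x * (\<integral>y. s y * (norm (trig A P x y))\<^sup>2 \<partial>MI \<alpha> \<beta>))"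
      "integrable IX (\<lambda>x. B * (\<integral>y. 1 * (norm (trig A P x y))\<^sup>2 \<partial>MI \<alpha> \<beta>))"
      by (intro integrable_continuous_MI continuous_intros continuous_inner_form assms; assumption)+
    fix x assume x: "x \<in> space IX"
    have "(\<integral>y. t x * (s y * (norm (trig A P x y))\<^sup>2) \<partial>MI \<alpha> \<beta>) \<le> (\<integral>y. B * (1 * (norm (trig A P x y))\<^sup>2) \<partial>MI \<alpha> \<beta>)"
      using s x by (intro integral_mono integrable_continuous_MI continuous_intros ct assms)
        (auto simp flip: mult.assoc intro!: mult_right_mono)
    then show "t x * (\<integral>y. s y * (norm (trig A P x y))\<^sup>2 \<partial>MI \<alpha> \<beta>) \<le> B * (\<integral>y. 1 * (norm (trig A P x y))\<^sup>2 \<partial>MI \<alpha> \<beta>)"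
      by simp
  qed
  also have "\<dots> = B * Q A (\<lambda>y. 1) (\<lambda>x. 1) P" unfolding Q_def by simp
  finally show ?thesis .
qed

lemma Q_w_nonneg: "Q A w (\<lambda>x. 1) P \<ge> 0"
  unfolding Q_def by (intro integral_nonneg_AE AE_I2) (auto simp: w_def)

end

text \<open>Schur's test for the convolution kernel \<open>H (m - n)\<close>: along rows and columns
  \<open>H\<close> is only translated or reflected, so both sums stay below
  \<open>M\<close>.\<close>

lemma cross_sum_le:
  fixes H :: "int \<Rightarrow> real" and a b :: "int \<Rightarrow> real"
  assumes A: "finite A" and H: "\<And>k. H k \<ge> 0" "\<And>B. finite B \<Longrightarrow> sum H B \<le> M"
    and a: "\<And>n. n \<in> A \<Longrightarrow> a n \<ge> 0" and b: "\<And>n. n \<in> A \<Longrightarrow> b n \<ge> 0"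
  shows "(\<Sum>n\<in>A. \<Sum>m\<in>A. H (m - n) * (a n + b m)) \<le> M * (sum a A + sum b A)"
proof -
  have s1: "(\<Sum>m\<in>A. H (m - n)) \<le> M" for n
  proof -
    have "(\<Sum>m\<in>A. H (m - n)) = sum H ((\<lambda>m. m - n) ` A)" by (subst sum.reindex) (auto simp: inj_on_def)
    then show ?thesis using H(2) A by simp
  qed
  have s2: "(\<Sum>n\<in>A. H (m - n)) \<le> M" for m
  proof -
    have "(\<Sum>n\<in>A. H (m - n)) = sum H ((\<lambda>n. m - n) ` A)" by (subst sum.reindex) (auto simp: inj_on_def)
    then show ?thesis using H(2) A by simp
  qed
  have "(\<Sum>n\<in>A. \<Sum>m\<in>A. H (m - n) * (a n + b m)) =
     (\<Sum>n\<in>A. (\<Sum>m\<in>A. H (m - n)) * a n) + (\<Sum>n\<in>A. \<Sum>m\<in>A. H (m - n) * b m)"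
    by (simp add: distrib_left sum.distrib sum_distrib_right)
  also have "(\<Sum>n\<in>A. \<Sum>m\<in>A. H (m - n) * b m) = (\<Sum>m\<in>A. (\<Sum>n\<in>A. H (m - n)) * b m)"
    by (subst sum.swap) (simp add: sum_distrib_right)
  also have "(\<Sum>n\<in>A. (\<Sum>m\<in>A. H (m - n)) * a n) + \<dots> \<le> (\<Sum>n\<in>A. M * a n) + (\<Sum>m\<in>A. M * b m)"
    using a b s1 s2 by (intro add_mono sum_mono mult_right_mono) auto
  finally show ?thesis by (simp add: sum_distrib_left distrib_left)
qed

text \<open>Every index has at most one partner \<open>- n\<close>, and evenness of \<open>c\<close>
  lets each half of the average be charged to its own index. The antidiagonal thus costs at most one
  copy of the diagonal.\<close>

lemma opposite_pair_sum_le: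
  fixes c X :: "int \<Rightarrow> real"
  assumes A: "finite A" and X: "\<And>n. n \<in> A \<Longrightarrow> c n * X n \<ge> 0" and c: "\<And>n. c (- n) = c n"
  shows "(\<Sum>n\<in>A. \<Sum>m\<in>A. if m = - n then c n * (X n + X m) / 2 else 0) \<le> (\<Sum>n\<in>A. c n * X n)"
proof -
  have "(\<Sum>n\<in>A. \<Sum>m\<in>A. if m = - n then c n * (X n + X m) / 2 else 0)
      = (\<Sum>n\<in>A. \<Sum>m\<in>A. if m = - n then c n * X n / 2 else 0) + (\<Sum>n\<in>A. \<Sum>m\<in>A. if n = - m then c m * X m / 2 else 0)"
    unfolding sum.distrib[symmetric] by (intro sum.cong refl) (auto simp: field_simps c)
  also have "(\<Sum>n\<in>A. \<Sum>m\<in>A. if n = - m then c m * X m / 2 else 0) = (\<Sum>m\<in>A. \<Sum>n\<in>A. if n = - m then c m * X m / 2 else 0)"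
    by (rule sum.swap)
  also have "(\<Sum>n\<in>A. \<Sum>m\<in>A. if m = - n then c n * X n / 2 else 0) + \<dots> \<le> (\<Sum>n\<in>A. c n * X n / 2) + (\<Sum>m\<in>A. c m * X m / 2)"
    using A X by (intro add_mono sum_mono) (auto simp: sum.delta)
  also have "\<dots> = (\<Sum>n\<in>A. c n * X n)" by (simp add: mult.commute flip: sum.distrib)
  finally show ?thesis .
qed

section \<open>Lower and upper bounds for the observed form\<close>

context window
begin

context
  fixes \<gamma> \<Lambda> N :: real and A :: "int set" and V W f :: "int \<Rightarrow> real \<Rightarrow> complex"
  assumes \<gamma>: "\<gamma> \<ge> 1" and \<Lambda>: "\<Lambda> \<ge> 1" and A: "finite A" and all_AN: "\<forall>n\<in>A. \<bar>of_int n\<bar> \<le> N"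
    and all_sol: "\<forall>n\<in>A. sol (V n) (W n) (f n)"
begin

lemma AN: "n \<in> A \<Longrightarrow> \<bar>of_int n\<bar> \<le> N" and sol: "n \<in> A \<Longrightarrow> sol (V n) (W n) (f n)"
  using all_AN all_sol by blast+

text \<open>Up to the factor \<open>\<Lambda>\<close>, \<open>S\<close> below is \<open>\<integral>\<integral> w q (\<Lambda> |v|\<^sup>2 + |v\<^sub>y|\<^sup>2)\<close> for the trigonometric polynomial \<open>v\<close> with
  coefficients \<open>V n\<close>. Its entries with \<open>n\<^sup>2 \<noteq> m\<^sup>2\<close> are small by almost orthogonality; those with \<open>m = - n\<close>
  are absorbed by the diagonal because \<open>|hat w (2 n)| \<le> hat w 0 - \<kappa>\<close>.\<close>

definition Fr :: "int \<Rightarrow> real \<Rightarrow> complex" where "Fr n = resid \<gamma> \<Lambda> (of_int n) (V n) (f n)"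
definition am :: "int \<Rightarrow> int \<Rightarrow> complex" where "am n m = ip IX (\<lambda>x. of_real (qw \<gamma> x) * V n x) (V m)"
text \<open>Bounds the right-hand side of \<open>mode_almost_orthogonal\<close>; kept as inner
  products until the Young parameter is chosen in \<open>CS_le\<close>.\<close>

definition cr :: "int \<Rightarrow> int \<Rightarrow> real" where "cr n m = norm (ip IX (V n) (Fr m)) + norm (ip IX (Fr n) (V m))"
definition X :: "int \<Rightarrow> real" where "X n = wsq (qw \<gamma>) (V n)"
definition S :: complex where "S = (\<Sum>n\<in>A. \<Sum>m\<in>A. of_real (1 + of_int n * of_int m / \<Lambda>) * hat w (m - n) * am n m)"
definition CS :: real where "CS = (\<Sum>n\<in>A. \<Sum>m\<in>A. norm (hat w (m - n)) * cr n m)"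

lemma cont_V: "n \<in> A \<Longrightarrow> continuous_on {-1..1} (V n)" and cont_W: "n \<in> A \<Longrightarrow> continuous_on {-1..1} (W n)"
  using sol sol_continuous by blast+

lemma L2_V: "n \<in> A \<Longrightarrow> L2 IX (V n)" and L2_F: "n \<in> A \<Longrightarrow> L2 IX (Fr n)"
  unfolding Fr_def using sol sol_L2 L2_resid[OF \<gamma>] by blast+

lemma am_self: "n \<in> A \<Longrightarrow> am n n = of_real (X n)"
proof -
  assume n: "n \<in> A"
  have "am n n = (\<integral>x. complex_of_real (qw \<gamma> x * (norm (V n x))\<^sup>2) \<partial>IX)"
    unfolding am_def ip_def by (simp only: mult.assoc of_real_mult complex_norm_square)
  then show ?thesis unfolding X_def wsq_def by (simp only: integral_complex_of_real)
qed

lemma norm_am_le: "n \<in> A \<Longrightarrow> m \<in> A \<Longrightarrow> norm (am n m) \<le> (X n + X m) / 2"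
proof -
  assume n: "n \<in> A" "m \<in> A"
  let ?r = "\<lambda>x. complex_of_real (sqrt (qw \<gamma> x))"
  have cr: "continuous_on {-1..1} ?r"
    using continuous_on_qw[OF \<gamma>] by (intro continuous_intros)
  \<comment> \<open>Splitting \<open>q\<close> symmetrically as \<open>sqrt q * sqrt q\<close> gives
    both factors the \<open>q\<close>-mass as squared norm.\<close>
  have eq: "am n m = ip IX (\<lambda>x. ?r x * V n x) (\<lambda>x. ?r x * V m x)"
    unfolding am_def ip_def
  proof (intro Bochner_Integration.integral_cong refl)
    fix x
    have "complex_of_real (qw \<gamma> x) = ?r x * ?r x" by (simp add: qw_nonneg flip: of_real_mult)
    then show "of_real (qw \<gamma> x) * V n x * cnj (V m x) = ?r x * V n x * cnj (?r x * V m x)" by simp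
  qed
  have ns: "nsq IX (\<lambda>x. ?r x * V k x) = X k" for k
    unfolding nsq_def X_def wsq_def by (simp add: norm_mult power_mult_distrib qw_nonneg)
  have "norm (am n m) \<le> (1 * nsq IX (\<lambda>x. ?r x * V n x) + nsq IX (\<lambda>x. ?r x * V m x) / 1) / 2"
    unfolding eq using n by (intro norm_ip_le L2_continuous_mult cr L2_V) auto
  then show ?thesis by (simp add: ns)
qed

lemma X_nonneg: "X n \<ge> 0"
  unfolding X_def by (rule wsq_qw_nonneg)

text \<open>Integers of different modulus satisfy \<open>|n^2 - m^2| \<ge> |n| + |m|\<close>.
  Dividing \<open>n m / \<Lambda>\<close> by it leaves one factor, hence
  \<open>N / \<Lambda>\<close> instead of \<open>N^2 / \<Lambda>\<close>; this gain fixes the final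
  power of \<open>h\<close>.\<close>

lemma offdiag_le:
  assumes n: "n \<in> A" "m \<in> A" and nm: "m \<noteq> n" "m \<noteq> - n"
  shows "norm (of_real (1 + of_int n * of_int m / \<Lambda>) * am n m) \<le> (1 + N / \<Lambda>) * cr n m"
proof -
  define a b :: real where "a = \<bar>of_int n\<bar>" and "b = \<bar>of_int m\<bar>"
  have "of_real ((of_int n)\<^sup>2 - (of_int m)\<^sup>2) * am n m = ip IX (V n) (Fr m) - ip IX (Fr n) (V m)"
    unfolding am_def Fr_def by (rule mode_almost_orthogonal[OF \<gamma> sol[OF n(1)] sol[OF n(2)]])
  then have "\<bar>(of_int n)\<^sup>2 - (of_int m)\<^sup>2\<bar> * norm (am n m) = norm (ip IX (V n) (Fr m) - ip IX (Fr n) (V m))"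
    by (metis norm_mult norm_of_real)
  also have "\<dots> \<le> cr n m" unfolding cr_def by (rule norm_triangle_ineq4)
  finally have 1: "\<bar>a\<^sup>2 - b\<^sup>2\<bar> * norm (am n m) \<le> cr n m" by (simp add: a_def b_def)
  have ab: "\<bar>a - b\<bar> \<ge> 1" "a \<ge> 0" "b \<ge> 0" "a \<le> N"
  proof -
    have "\<bar>n\<bar> \<noteq> \<bar>m\<bar>" using nm by linarith
    then have "\<bar>\<bar>n\<bar> - \<bar>m\<bar>\<bar> \<ge> 1" by linarith
    then have "real_of_int \<bar>\<bar>n\<bar> - \<bar>m\<bar>\<bar> \<ge> 1" by linarith
    then show "\<bar>a - b\<bar> \<ge> 1" by (simp add: a_def b_def)
  qed (use AN n in \<open>auto simp: a_def b_def\<close>)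
  have big: "max a b \<le> \<bar>a\<^sup>2 - b\<^sup>2\<bar>"
  proof -
    have "\<bar>a\<^sup>2 - b\<^sup>2\<bar> = \<bar>a - b\<bar> * (a + b)" using ab by (simp add: power2_eq_square square_diff_square_factored abs_mult)
    moreover have "\<bar>a - b\<bar> * (a + b) \<ge> 1 * (a + b)" using ab by (intro mult_right_mono) auto
    ultimately show ?thesis using ab by auto
  qed
  have "max a b \<ge> 1" using ab by (auto simp: max_def abs_if split: if_splits)
  then have one: "1 \<le> \<bar>a\<^sup>2 - b\<^sup>2\<bar>" using big by linarith
  have "a * b \<le> a * \<bar>a\<^sup>2 - b\<^sup>2\<bar>" using big ab by (intro mult_left_mono) auto
  also have "\<dots> \<le> N * \<bar>a\<^sup>2 - b\<^sup>2\<bar>" using ab by (intro mult_right_mono) auto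
  finally have "a * b / \<Lambda> \<le> N * \<bar>a\<^sup>2 - b\<^sup>2\<bar> / \<Lambda>" using \<Lambda> by (intro divide_right_mono) auto
  moreover have "\<bar>1 + of_int n * of_int m / \<Lambda>\<bar> \<le> 1 + a * b / \<Lambda>"
    using \<Lambda> abs_triangle_ineq[of 1 "of_int n * of_int m / \<Lambda>"] by (simp add: a_def b_def abs_mult)
  ultimately have "\<bar>1 + of_int n * of_int m / \<Lambda>\<bar> \<le> (1 + N / \<Lambda>) * \<bar>a\<^sup>2 - b\<^sup>2\<bar>"
    using one by (simp add: algebra_simps)
  then have "\<bar>1 + of_int n * of_int m / \<Lambda>\<bar> * norm (am n m) \<le> (1 + N / \<Lambda>) * (\<bar>a\<^sup>2 - b\<^sup>2\<bar> * norm (am n m))"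
    by (metis mult.assoc mult_right_mono norm_ge_zero)
  also have "\<dots> \<le> (1 + N / \<Lambda>) * cr n m" using 1 ab \<Lambda> by (intro mult_left_mono) auto
  finally show ?thesis by (simp add: norm_mult del: of_real_add)
qed

lemma S_lower:
  assumes \<kappa>: "\<And>k. k \<noteq> 0 \<Longrightarrow> norm (hat w k) \<le> wL1 - \<kappa>"
  shows "\<kappa> * (\<Sum>n\<in>A. (1 + (of_int n)\<^sup>2 / \<Lambda>) * X n) \<le> Re S + (1 + N / \<Lambda>) * CS"
proof -
  define c where "c n = 1 + (of_int n)\<^sup>2 / \<Lambda>" for n :: int
  have c: "c n \<ge> 1" "c (- n) = c n" for n using \<Lambda> by (simp_all add: c_def)
  have c0: "c n \<ge> 0" for n using c(1)[of n] by linarith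
  have k0: "wL1 - \<kappa> \<ge> 0" using \<kappa>[of 1] norm_ge_zero[of "hat w 1"] by linarith
  have h0: "hat w 0 = of_real wL1"
    unfolding hat_def wL1_def by (simp add: integral_complex_of_real)
  define t where "t n m = of_real (1 + of_int n * of_int m / \<Lambda>) * hat w (m - n) * am n m" for n m
  have key: "(if m = n then wL1 * c n * X n else 0) - (if m = - n then (wL1 - \<kappa>) * c n * (X n + X m) / 2 else 0)
     - (1 + N / \<Lambda>) * (norm (hat w (m - n)) * cr n m) \<le> Re (t n m)" if n: "n \<in> A" "m \<in> A" for n m
  proof -
    have cr0: "(1 + N / \<Lambda>) * (norm (hat w (m - n)) * cr n m) \<ge> 0"
      using AN[OF n(1)] \<Lambda> by (intro mult_nonneg_nonneg) (auto simp: cr_def)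
    consider "m = n" | "m \<noteq> n" "m = - n" | "m \<noteq> n" "m \<noteq> - n" by blast
    then show ?thesis
    proof cases
      case 1
      have "t n n = of_real (wL1 * c n * X n)" unfolding t_def c_def using am_self[OF n(1)]
        by (simp add: h0 power2_eq_square mult_ac)
      then have "Re (t n n) = wL1 * c n * X n" by simp
      \<comment> \<open>For \<open>n = 0\<close> the antidiagonal entry is the diagonal one; then
        something nonnegative is merely subtracted from the exact value.\<close>
      moreover have "(if n = - n then (wL1 - \<kappa>) * c n * (X n + X n) / 2 else 0) \<ge> 0"
        using k0 c0 X_nonneg by auto
      ultimately show ?thesis using cr0 unfolding 1 by (simp only: if_True refl)
    next
      case 2
      have "norm (t n m) = \<bar>1 + of_int n * of_int m / \<Lambda>\<bar> * norm (hat w (m - n)) * norm (am n m)"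
        by (simp add: t_def norm_mult del: of_real_add)
      also have "\<dots> \<le> c n * (wL1 - \<kappa>) * ((X n + X m) / 2)"
      proof (intro mult_mono)
        have "\<bar>1 + of_int n * of_int m / \<Lambda>\<bar> \<le> 1 + \<bar>of_int n * of_int m / \<Lambda>\<bar>"
          using abs_triangle_ineq[of 1 "of_int n * of_int m / \<Lambda>"] by (simp only: abs_one)
        also have "\<dots> = c n" using 2 \<Lambda> by (simp add: c_def abs_mult power2_eq_square)
        finally show "\<bar>1 + of_int n * of_int m / \<Lambda>\<bar> \<le> c n" .
        show "norm (hat w (m - n)) \<le> wL1 - \<kappa>" using 2 by (intro \<kappa>) simp
        show "norm (am n m) \<le> (X n + X m) / 2" using n by (rule norm_am_le)
      qed (use c[of n] k0 in auto)
      finally have "- (c n * (wL1 - \<kappa>) * ((X n + X m) / 2)) \<le> Re (t n m)"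
        using abs_Re_le_cmod[of "t n m"] by linarith
      moreover have "c n * (wL1 - \<kappa>) * ((X n + X m) / 2) = (wL1 - \<kappa>) * c n * (X n + X m) / 2" by simp
      ultimately have "- ((wL1 - \<kappa>) * c n * (X n + X m) / 2) \<le> Re (t n m)" by (simp only:)
      then show ?thesis using 2 cr0 by simp
    next
      case 3
      have "norm (t n m) = norm (hat w (m - n)) * norm (of_real (1 + of_int n * of_int m / \<Lambda>) * am n m)"
        unfolding t_def norm_mult by simp
      also have "\<dots> \<le> norm (hat w (m - n)) * ((1 + N / \<Lambda>) * cr n m)"
        by (intro mult_left_mono offdiag_le n 3) auto
      finally have "- ((1 + N / \<Lambda>) * (norm (hat w (m - n)) * cr n m)) \<le> Re (t n m)"
        using abs_Re_le_cmod[of "t n m"] by (simp only: mult.left_commute)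
      then show ?thesis using 3 by simp
    qed
  qed
  have "(\<Sum>n\<in>A. \<Sum>m\<in>A. (if m = n then wL1 * c n * X n else 0) - (if m = - n then (wL1 - \<kappa>) * c n * (X n + X m) / 2 else 0)
     - (1 + N / \<Lambda>) * (norm (hat w (m - n)) * cr n m)) \<le> (\<Sum>n\<in>A. \<Sum>m\<in>A. Re (t n m))"
    by (intro sum_mono key)
  also have "\<dots> = Re S" by (simp add: S_def t_def)
  finally have "(\<Sum>n\<in>A. wL1 * c n * X n) - (\<Sum>n\<in>A. \<Sum>m\<in>A. if m = - n then (wL1 - \<kappa>) * c n * (X n + X m) / 2 else 0)
     - (1 + N / \<Lambda>) * CS \<le> Re S"
    using A by (simp add: sum_subtractf CS_def sum_distrib_left sum.delta)
  moreover have "(\<Sum>n\<in>A. \<Sum>m\<in>A. if m = - n then ((wL1 - \<kappa>) * c n) * (X n + X m) / 2 else 0) \<le> (\<Sum>n\<in>A. ((wL1 - \<kappa>) * c n) * X n)"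
    using k0 c0 c(2) X_nonneg by (intro opposite_pair_sum_le A) auto
  moreover have "(\<Sum>n\<in>A. wL1 * c n * X n) - (\<Sum>n\<in>A. ((wL1 - \<kappa>) * c n) * X n) = \<kappa> * (\<Sum>n\<in>A. c n * X n)"
    by (simp add: sum_distrib_left flip: sum_subtractf) (simp add: algebra_simps)
  ultimately show ?thesis unfolding c_def[symmetric] by linarith
qed

text \<open>Write \<open>n m = (n^2 + m^2) / 2 - (m - n)^2 / 2\<close>. The first part becomes the
  forms of \<open>\<Lambda> |V|^2 - |W|^2\<close> by \<open>mode_energy\<close>, and the form in
  \<open>W\<close> is dropped because \<open>w \<ge> 0\<close> gives it a sign. The second part
  replaces \<open>w\<close> by \<open>w2\<close>. No derivative is left to be observed.\<close>

lemma S_upper: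
  "Re S \<le> Q A w (qw \<gamma>) V + Q A w (\<lambda>x. 1) V + Q A w2 (qw \<gamma>) V / (2 * \<Lambda>) + CS / (2 * \<Lambda>)"
proof -
  define bm wm where "bm n m = ip IX (V n) (V m)" and "wm n m = ip IX (W n) (W m)" for n m
  define rm where "rm n m = ip IX (V n) (Fr m) + ip IX (Fr n) (V m)" for n m
  have term_eq: "of_real (1 + of_int n * of_int m / \<Lambda>) * hat w (m - n) * am n m
    = hat w (m - n) * am n m + hat w (m - n) * bm n m - (1 / of_real \<Lambda>) * (hat w (m - n) * wm n m)
      + (1 / (2 * of_real \<Lambda>)) * (hat w2 (m - n) * am n m) - (1 / (2 * of_real \<Lambda>)) * (hat w (m - n) * rm n m)"
    if n: "n \<in> A" "m \<in> A" for n m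
  proof -
    have alg: "H * a + H / L * ((L * b - w - r / 2) - d / 2 * a)
        = H * a + H * b - (1 / L) * (H * w) + (1 / (2 * L)) * ((- d * H) * a) - (1 / (2 * L)) * (H * r)"
      if "L \<noteq> 0" for H a b w r d L :: complex
      using that by (simp add: field_simps)
    have e: "of_real (((of_int n)\<^sup>2 + (of_int m)\<^sup>2) / 2) * am n m = \<Lambda> * bm n m - wm n m - rm n m / 2"
      unfolding am_def Fr_def bm_def wm_def rm_def by (rule mode_energy[OF \<gamma> sol[OF n(1)] sol[OF n(2)]])
    have nm: "complex_of_real (of_int n * of_int m) = of_real (((of_int n)\<^sup>2 + (of_int m)\<^sup>2) / 2) - (of_int (m - n))\<^sup>2 / 2"
      by (simp add: field_simps power2_eq_square)
    have L: "complex_of_real \<Lambda> \<noteq> 0" using \<Lambda> by simp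
    have "of_real (1 + of_int n * of_int m / \<Lambda>) * hat w (m - n) * am n m
      = hat w (m - n) * am n m + hat w (m - n) / of_real \<Lambda> * (complex_of_real (of_int n * of_int m) * am n m)"
      using L by (simp add: field_simps)
    also have "complex_of_real (of_int n * of_int m) * am n m = (\<Lambda> * bm n m - wm n m - rm n m / 2) - (of_int (m - n))\<^sup>2 / 2 * am n m"
      unfolding nm left_diff_distrib e by simp
    also have "hat w (m - n) * am n m + hat w (m - n) / of_real \<Lambda> * ((\<Lambda> * bm n m - wm n m - rm n m / 2) - (of_int (m - n))\<^sup>2 / 2 * am n m)
      = hat w (m - n) * am n m + hat w (m - n) * bm n m - (1 / of_real \<Lambda>) * (hat w (m - n) * wm n m)
      + (1 / (2 * of_real \<Lambda>)) * (- (of_int (m - n))\<^sup>2 * hat w (m - n) * am n m) - (1 / (2 * of_real \<Lambda>)) * (hat w (m - n) * rm n m)"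
      by (rule alg[OF L])
    finally show ?thesis unfolding hat_w2 .
  qed
  have q1: "(\<Sum>n\<in>A. \<Sum>m\<in>A. hat w (m - n) * am n m) = of_real (Q A w (qw \<gamma>) V)"
    unfolding am_def by (intro quadratic_form A w_cont cont_V continuous_on_qw \<gamma>)
  have q2: "(\<Sum>n\<in>A. \<Sum>m\<in>A. hat w (m - n) * bm n m) = of_real (Q A w (\<lambda>x. 1) V)"
    using quadratic_form[OF A w_cont(1) cont_V continuous_on_const[of _ 1]] by (simp add: bm_def)
  have q3: "(\<Sum>n\<in>A. \<Sum>m\<in>A. hat w (m - n) * wm n m) = of_real (Q A w (\<lambda>x. 1) W)"
    using quadratic_form[OF A w_cont(1) cont_W continuous_on_const[of _ 1]] by (simp add: wm_def)
  have q4: "(\<Sum>n\<in>A. \<Sum>m\<in>A. hat w2 (m - n) * am n m) = of_real (Q A w2 (qw \<gamma>) V)"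
    unfolding am_def by (intro quadratic_form A w_cont cont_V continuous_on_qw \<gamma>)
  define R where "R = (\<Sum>n\<in>A. \<Sum>m\<in>A. hat w (m - n) * rm n m)"
  have "S = of_real (Q A w (qw \<gamma>) V) + of_real (Q A w (\<lambda>x. 1) V) - (1 / of_real \<Lambda>) * of_real (Q A w (\<lambda>x. 1) W)
      + (1 / (2 * of_real \<Lambda>)) * of_real (Q A w2 (qw \<gamma>) V) - (1 / (2 * of_real \<Lambda>)) * R"
    unfolding S_def R_def q1[symmetric] q2[symmetric] q3[symmetric] q4[symmetric] sum_distrib_left
      sum.distrib[symmetric] sum_subtractf[symmetric]
    by (intro sum.cong refl term_eq)
  also have "\<dots> = of_real (Q A w (qw \<gamma>) V + Q A w (\<lambda>x. 1) V - Q A w (\<lambda>x. 1) W / \<Lambda> + Q A w2 (qw \<gamma>) V / (2 * \<Lambda>)) + of_real (- (1 / (2 * \<Lambda>))) * R"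
    by simp
  finally have "Re S = Q A w (qw \<gamma>) V + Q A w (\<lambda>x. 1) V - Q A w (\<lambda>x. 1) W / \<Lambda> + Q A w2 (qw \<gamma>) V / (2 * \<Lambda>) - (1 / (2 * \<Lambda>)) * Re R"
    by (simp only: plus_complex.sel times_complex.sel Re_complex_of_real Im_complex_of_real mult_zero_left diff_zero)
  moreover have "Q A w (\<lambda>x. 1) W / \<Lambda> \<ge> 0" using \<Lambda> Q_w_nonneg by (intro divide_nonneg_nonneg) auto
  moreover have "- (1 / (2 * \<Lambda>)) * Re R \<le> CS / (2 * \<Lambda>)"
  proof -
    have "norm R \<le> (\<Sum>n\<in>A. \<Sum>m\<in>A. norm (hat w (m - n) * rm n m))"
      unfolding R_def by (intro order_trans[OF norm_sum] sum_mono norm_sum)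
    also have "\<dots> \<le> CS" unfolding CS_def norm_mult cr_def rm_def
      by (intro sum_mono mult_left_mono norm_triangle_ineq) auto
    finally have "- Re R \<le> CS" using complex_Re_le_cmod[of "- R"] by simp
    then have "- Re R / (2 * \<Lambda>) \<le> CS / (2 * \<Lambda>)" using \<Lambda> by (intro divide_right_mono) auto
    then show ?thesis by simp
  qed
  ultimately show ?thesis by linarith
qed

text \<open>Young's inequality with one parameter for all pairs, then Schur's test with the summable
  sequence \<open>|hat w k|\<close>.\<close>

lemma CS_le:
  assumes \<epsilon>: "\<epsilon> > 0"
  shows "CS \<le> Mw * (\<epsilon> * (\<Sum>n\<in>A. nsq IX (V n)) + (\<Sum>n\<in>A. nsq IX (Fr n)) / \<epsilon>)"
proof -
  define a where "a n = (\<epsilon> * nsq IX (V n) + nsq IX (Fr n) / \<epsilon>) / 2" for n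
  have "cr n m \<le> a n + a m" if n: "n \<in> A" "m \<in> A" for n m
  proof -
    have "norm (ip IX (V n) (Fr m)) \<le> (\<epsilon> * nsq IX (V n) + nsq IX (Fr m) / \<epsilon>) / 2"
      using n \<epsilon> by (intro norm_ip_le L2_V L2_F)
    moreover have "norm (ip IX (Fr n) (V m)) \<le> (1 / \<epsilon> * nsq IX (Fr n) + nsq IX (V m) / (1 / \<epsilon>)) / 2"
      using n \<epsilon> by (intro norm_ip_le L2_V L2_F) auto
    ultimately have "cr n m \<le> (\<epsilon> * nsq IX (V n) + nsq IX (Fr m) / \<epsilon>) / 2 + (1 / \<epsilon> * nsq IX (Fr n) + nsq IX (V m) / (1 / \<epsilon>)) / 2"
      unfolding cr_def by (rule add_mono)
    also have "\<dots> = a n + a m" by (simp add: a_def field_simps)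
    finally show ?thesis .
  qed
  then have "CS \<le> (\<Sum>n\<in>A. \<Sum>m\<in>A. norm (hat w (m - n)) * (a n + a m))"
    unfolding CS_def by (intro sum_mono mult_left_mono) auto
  also have "\<dots> \<le> Mw * (sum a A + sum a A)"
    using \<epsilon> by (intro cross_sum_le A sum_hat_le) (auto simp: a_def nsq_nonneg)
  also have "sum a A + sum a A = \<epsilon> * (\<Sum>n\<in>A. nsq IX (V n)) + (\<Sum>n\<in>A. nsq IX (Fr n)) / \<epsilon>"
    by (simp add: a_def sum_distrib_left sum_divide_distrib flip: sum.distrib)
  finally show ?thesis .
qed

end

end

context window
begin

text \<open>The constants come before \<open>\<Lambda>\<close>, the cutoff \<open>N\<close> and the
  index set, so that one estimate serves all \<open>h\<close>. The loss from the off-diagonal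
  entries is kept visible as \<open>(1 + N / \<Lambda>)^2\<close>.\<close>

definition observability :: "real \<Rightarrow> real \<Rightarrow> real \<Rightarrow> bool" where
  "observability \<gamma> C \<Lambda>\<^sub>0 \<longleftrightarrow> (\<forall>\<Lambda> N A V W f. \<Lambda> \<ge> \<Lambda>\<^sub>0 \<longrightarrow> N \<ge> 0 \<longrightarrow> finite A \<longrightarrow>
      (\<forall>n\<in>A. \<bar>of_int n\<bar> \<le> N) \<longrightarrow> (\<forall>n\<in>A. sol (V n) (W n) (f n)) \<longrightarrow>
      (\<Sum>n\<in>A. nsq IX (V n)) \<le> C * (Q A (\<lambda>y. 1) (\<lambda>x. 1) V
         + (1 + N / \<Lambda>)\<^sup>2 * (\<Sum>n\<in>A. nsq IX (resid \<gamma> \<Lambda> (of_int n) (V n) (f n)))))"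

lemma finite_mode_observability:
  assumes \<gamma>: "\<gamma> \<ge> 1"
  shows "\<exists>C>0. \<exists>\<Lambda>\<^sub>0\<ge>1. observability \<gamma> C \<Lambda>\<^sub>0"
proof -
  obtain \<kappa> where \<kappa>: "\<kappa> > 0" "\<And>k. k \<noteq> 0 \<Longrightarrow> norm (hat w k) \<le> wL1 - \<kappa>" using hat_uniform by blast
  obtain B0 where B0: "\<And>y. y \<in> {\<alpha>..\<beta>} \<Longrightarrow> norm (w y) \<le> B0" using continuous_bounded_MI[OF w_cont(1)] by blast
  obtain B2 where B2: "\<And>y. y \<in> {\<alpha>..\<beta>} \<Longrightarrow> norm (w2 y) \<le> B2" using continuous_bounded_MI[OF w_cont(3)] by blast
  have Bpos: "B0 \<ge> 0" "B2 \<ge> 0"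
    using B0[of \<alpha>] B2[of \<alpha>] \<alpha>\<beta> norm_ge_zero[of "w \<alpha>"] norm_ge_zero[of "w2 \<alpha>"]
    by (smt (verit) atLeastAtMost_iff)+
  define C1 C2 C3 where "C1 = 6 * (1 + 2 * \<gamma>)" and "C2 = 4 + 4 * \<gamma>" and "C3 = 2 * B0 + B2"
  define D where "D = 2 * (C1 / \<kappa>) * Mw"
  define \<Lambda>\<^sub>0 where "\<Lambda>\<^sub>0 = max 1 (2 * (1 + 2 * \<gamma>) * (4 * \<gamma>\<^sup>2 + 1))"
  define C where "C = 2 * (C1 / \<kappa>) * C3 + (4 * D\<^sup>2 + 2 * C2)"
  have pos: "C1 > 0" "C2 > 0" "C3 \<ge> 0" using \<gamma> Bpos by (simp_all add: C1_def C2_def C3_def)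
  have Mw: "Mw > 0" using wL1_pos w2L1_nonneg by (simp add: Mw_def)
  have D: "D > 0" using pos \<kappa> Mw by (simp add: D_def)
  have C0: "C > 0" using pos \<kappa> by (auto simp: C_def intro!: add_nonneg_pos mult_nonneg_nonneg add_nonneg_pos)
  have "observability \<gamma> C \<Lambda>\<^sub>0"
    unfolding observability_def
  proof (intro allI impI)
    fix \<Lambda> N :: real and A :: "int set" and V W f :: "int \<Rightarrow> real \<Rightarrow> complex"
    assume \<Lambda>: "\<Lambda> \<ge> \<Lambda>\<^sub>0" and N: "N \<ge> 0" and A: "finite A" "\<forall>n\<in>A. \<bar>of_int n\<bar> \<le> N"
      and all_sol: "\<forall>n\<in>A. sol (V n) (W n) (f n)"
    have \<Lambda>1: "\<Lambda> \<ge> 1" "\<Lambda> \<ge> 2 * (1 + 2 * \<gamma>) * (4 * \<gamma>\<^sup>2 + 1)" using \<Lambda> by (auto simp: \<Lambda>\<^sub>0_def)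
    note ctx = \<gamma> \<Lambda>1(1) A all_sol
    have sol: "sol (V n) (W n) (f n)" if "n \<in> A" for n using all_sol that by blast
    let ?F = "\<lambda>n. resid \<gamma> \<Lambda> (of_int n) (V n) (f n)"
    define SN SF SX O1 c where "SN = (\<Sum>n\<in>A. nsq IX (V n))" and "SF = (\<Sum>n\<in>A. nsq IX (?F n))"
      and "SX = (\<Sum>n\<in>A. (1 + (of_int n)\<^sup>2 / \<Lambda>) * wsq (qw \<gamma>) (V n))"
      and "O1 = Q A (\<lambda>y. 1) (\<lambda>x. 1) V" and "c = 1 + N / \<Lambda>"
    define cs where "cs = CS \<gamma> \<Lambda> A V f"
    have c: "c \<ge> 1" using N \<Lambda>1 by (simp add: c_def)
    have SF0: "SF \<ge> 0" unfolding SF_def by (intro sum_nonneg nsq_nonneg)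
    have cs0: "cs \<ge> 0" unfolding cs_def CS_def[OF ctx] cr_def[OF ctx] by (intro sum_nonneg mult_nonneg_nonneg add_nonneg_nonneg norm_ge_zero)
    have contV: "n \<in> A \<Longrightarrow> continuous_on {-1..1} (V n)" for n using sol sol_continuous by blast
    have O0: "O1 \<ge> 0" unfolding O1_def Q_def by (intro integral_nonneg_AE AE_I2) auto
    have prod: "a * b \<le> B" if "0 \<le> a" "a \<le> 1" "\<bar>b\<bar> \<le> B" for a b B :: real
    proof -
      have "a * b \<le> \<bar>a * b\<bar>" by simp
      also have "\<dots> \<le> 1 * B" unfolding abs_mult using that by (intro mult_mono) auto
      finally show ?thesis by simp
    qed
    have Q1: "Q A w (qw \<gamma>) V \<le> B0 * O1" unfolding O1_def
      using \<gamma> by (intro Q_mono A contV w_cont continuous_on_qw Bpos prod qw_nonneg qw_le_1) (use B0 in auto)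
    have Q2: "Q A w (\<lambda>x. 1) V \<le> B0 * O1" unfolding O1_def
      by (intro Q_mono A contV w_cont continuous_intros Bpos prod) (use B0 in auto)
    have Q3: "Q A w2 (qw \<gamma>) V \<le> B2 * O1" unfolding O1_def
      using \<gamma> by (intro Q_mono A contV w_cont continuous_on_qw Bpos prod qw_nonneg qw_le_1) (use B2 in auto)
    have "Q A w2 (qw \<gamma>) V / (2 * \<Lambda>) \<le> B2 * O1 / (2 * \<Lambda>)" using Q3 \<Lambda>1 by (intro divide_right_mono) auto
    also have "\<dots> \<le> B2 * O1 / 1" using \<Lambda>1 Bpos O0 by (intro divide_left_mono) auto
    finally have Q3': "Q A w2 (qw \<gamma>) V / (2 * \<Lambda>) \<le> B2 * O1" by simp
    have "cs / (2 * \<Lambda>) \<le> cs / 1" using \<Lambda>1 cs0 by (intro divide_left_mono) auto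
    also have "\<dots> \<le> c * cs" using c cs0 by (simp add: mult_le_cancel_right1)
    finally have cs1: "cs / (2 * \<Lambda>) \<le> c * cs" .
    have "\<kappa> * SX \<le> Re (S \<gamma> \<Lambda> A V) + c * cs"
      using S_lower[OF ctx \<kappa>(2)] unfolding SX_def X_def[OF ctx] c_def cs_def by blast
    also have "Re (S \<gamma> \<Lambda> A V) \<le> Q A w (qw \<gamma>) V + Q A w (\<lambda>x. 1) V + Q A w2 (qw \<gamma>) V / (2 * \<Lambda>) + cs / (2 * \<Lambda>)"
      unfolding cs_def by (rule S_upper[OF ctx])
    finally have "\<kappa> * SX \<le> C3 * O1 + 2 * (c * cs)"
      using Q1 Q2 Q3' cs1 by (simp add: C3_def algebra_simps)
    then have SX: "SX \<le> (C3 * O1 + 2 * (c * cs)) / \<kappa>" using \<kappa> by (simp add: field_simps)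
    \<comment> \<open>\<open>D c \<epsilon>\<close> will be the coefficient of \<open>SN\<close> on
      the right; this choice makes it \<open>1 / 2\<close>, to be absorbed. The price is
      \<open>D c / \<epsilon> = 2 D^2 c^2\<close>, whence the square of
      \<open>1 + N / \<Lambda>\<close>.\<close>
    define \<epsilon> where "\<epsilon> = 1 / (2 * D * c)"
    have \<epsilon>: "\<epsilon> > 0" using D c by (simp add: \<epsilon>_def)
    have cs: "cs \<le> Mw * (\<epsilon> * SN + SF / \<epsilon>)"
      using CS_le[OF ctx \<epsilon>] unfolding cs_def SN_def SF_def Fr_def[OF ctx] by blast
    have "SN \<le> (\<Sum>n\<in>A. C1 * ((1 + (of_int n)\<^sup>2 / \<Lambda>) * wsq (qw \<gamma>) (V n)) + C2 * nsq IX (?F n))"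
      unfolding SN_def
    proof (intro sum_mono)
      fix n assume n: "n \<in> A"
      have "\<Lambda> * nsq IX (V n) \<le> C1 * (\<Lambda> + (of_int n)\<^sup>2) * wsq (qw \<gamma>) (V n) + C2 * nsq IX (?F n)"
        using mode_lower_bound[OF \<gamma> sol[OF n] \<Lambda>1(2)] by (simp add: C1_def C2_def)
      then have "nsq IX (V n) \<le> (C1 * (\<Lambda> + (of_int n)\<^sup>2) * wsq (qw \<gamma>) (V n) + C2 * nsq IX (?F n)) / \<Lambda>"
        using \<Lambda>1 by (simp add: field_simps)
      also have "\<dots> = C1 * ((1 + (of_int n)\<^sup>2 / \<Lambda>) * wsq (qw \<gamma>) (V n)) + C2 * nsq IX (?F n) / \<Lambda>"
        using \<Lambda>1 by (simp add: field_simps)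
      also have "C2 * nsq IX (?F n) / \<Lambda> \<le> C2 * nsq IX (?F n) / 1"
        using \<Lambda>1 pos by (intro divide_left_mono mult_nonneg_nonneg nsq_nonneg) auto
      finally show "nsq IX (V n) \<le> C1 * ((1 + (of_int n)\<^sup>2 / \<Lambda>) * wsq (qw \<gamma>) (V n)) + C2 * nsq IX (?F n)" by simp
    qed
    also have "\<dots> = C1 * SX + C2 * SF" by (simp add: sum.distrib SX_def SF_def flip: sum_distrib_left)
    also have "C1 * SX + C2 * SF \<le> C1 * ((C3 * O1 + 2 * (c * (Mw * (\<epsilon> * SN + SF / \<epsilon>)))) / \<kappa>) + C2 * SF"
    proof (rule add_right_mono)
      have "c * cs \<le> c * (Mw * (\<epsilon> * SN + SF / \<epsilon>))" using cs c by (intro mult_left_mono) auto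
      then have "(C3 * O1 + 2 * (c * cs)) / \<kappa> \<le> (C3 * O1 + 2 * (c * (Mw * (\<epsilon> * SN + SF / \<epsilon>)))) / \<kappa>"
        using \<kappa> by (intro divide_right_mono) auto
      then show "C1 * SX \<le> C1 * ((C3 * O1 + 2 * (c * (Mw * (\<epsilon> * SN + SF / \<epsilon>)))) / \<kappa>)"
        using SX pos by (intro mult_left_mono) auto
    qed
    also have "C1 * ((C3 * O1 + 2 * (c * (Mw * (\<epsilon> * SN + SF / \<epsilon>)))) / \<kappa>)
        = (C1 / \<kappa>) * C3 * O1 + (D * c * \<epsilon>) * SN + D * c * (SF / \<epsilon>)"
      by (simp add: D_def add_divide_distrib algebra_simps)
    also have "D * c * \<epsilon> = 1 / 2" using D c by (simp add: \<epsilon>_def)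
    also have "D * c * (SF / \<epsilon>) = 2 * D\<^sup>2 * c\<^sup>2 * SF" using D c by (simp add: \<epsilon>_def power2_eq_square)
    finally have "SN \<le> (C1 / \<kappa>) * C3 * O1 + 1 / 2 * SN + 2 * D\<^sup>2 * c\<^sup>2 * SF + C2 * SF" .
    moreover have "s \<le> 2 * p + 4 * D\<^sup>2 * c\<^sup>2 * SF + 2 * C2 * SF"
      if "s \<le> p + 1 / 2 * s + 2 * D\<^sup>2 * c\<^sup>2 * SF + C2 * SF" for s p using that by simp
    ultimately have "SN \<le> 2 * ((C1 / \<kappa>) * C3 * O1) + 4 * D\<^sup>2 * c\<^sup>2 * SF + 2 * C2 * SF" by blast
    also have "2 * C2 * SF \<le> 2 * C2 * (c\<^sup>2 * SF)"
    proof -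
      have "1 \<le> c\<^sup>2" using c by (simp add: one_le_power)
      then have "1 * SF \<le> c\<^sup>2 * SF" using SF0 by (intro mult_right_mono)
      then show ?thesis using pos by simp
    qed
    also have "2 * ((C1 / \<kappa>) * C3 * O1) + 4 * D\<^sup>2 * c\<^sup>2 * SF + 2 * C2 * (c\<^sup>2 * SF)
        = (2 * (C1 / \<kappa>) * C3) * O1 + (4 * D\<^sup>2 + 2 * C2) * (c\<^sup>2 * SF)" by (simp add: algebra_simps)
    also have "\<dots> \<le> C * O1 + C * (c\<^sup>2 * SF)"
      using pos \<kappa> O0 SF0 by (intro add_mono mult_right_mono) (auto simp: C_def)
    finally have "SN \<le> C * (O1 + c\<^sup>2 * SF)" by (simp add: distrib_left)
    then show "(\<Sum>n\<in>A. nsq IX (V n)) \<le> C * (Q A (\<lambda>y. 1) (\<lambda>x. 1) V + (1 + N / \<Lambda>)\<^sup>2 * (\<Sum>n\<in>A. nsq IX (?F n)))"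
      by (simp only: SN_def SF_def O1_def c_def)
  qed
  moreover have "\<Lambda>\<^sub>0 \<ge> 1" by (simp add: \<Lambda>\<^sub>0_def)
  ultimately show ?thesis using C0 by blast
qed

end

section \<open>Parseval's identity\<close>

inductive trig_poly :: "(real \<Rightarrow> complex) \<Rightarrow> bool" where
  em: "trig_poly (em n)"
| cmult: "trig_poly p \<Longrightarrow> trig_poly (\<lambda>y. c * p y)"
| add: "trig_poly p \<Longrightarrow> trig_poly q \<Longrightarrow> trig_poly (\<lambda>y. p y + q y)"

lemma trig_poly_const: "trig_poly (\<lambda>y. c)"
  using trig_poly.cmult[OF trig_poly.em[of 0], of c] by simp

lemma trig_poly_em_mult: "trig_poly p \<Longrightarrow> trig_poly (\<lambda>y. em n y * p y)"
proof (induction rule: trig_poly.induct)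
  case (em m)
  then show ?case using trig_poly.em[of "n + m"] by (simp add: em_add[abs_def])
next
  case (cmult p c)
  then show ?case using trig_poly.cmult[OF cmult.IH, of c] by (simp add: mult.left_commute)
next
  case (add p q)
  then show ?case using trig_poly.add[OF add.IH] by (simp add: distrib_left)
qed

lemma trig_poly_mult: "trig_poly p \<Longrightarrow> trig_poly q \<Longrightarrow> trig_poly (\<lambda>y. p y * q y)"
proof (induction rule: trig_poly.induct)
  case (cmult p c)
  then show ?case using trig_poly.cmult[of "\<lambda>y. p y * q y" c] by (simp add: mult.assoc)
next
  case (add p r)
  then show ?case using trig_poly.add[of "\<lambda>y. p y * q y" "\<lambda>y. r y * q y"] by (simp add: distrib_right)
qed (simp add: trig_poly_em_mult)

text \<open>One coefficient family serves all large \<open>M\<close>, since \<open>parseval\<close>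
  compares with the symmetric partial sums of every large order.\<close>

lemma trig_poly_finite_sum:
  "trig_poly p \<Longrightarrow> \<exists>N c. \<forall>M\<ge>N. p = (\<lambda>y. \<Sum>n\<in>{- int M..int M}. c n * em n y)"
proof (induction rule: trig_poly.induct)
  case (em n)
  have "em n = (\<lambda>y. \<Sum>k\<in>{- int M..int M}. (if k = n then 1 else 0) * em k y)" if "M \<ge> nat \<bar>n\<bar>" for M
  proof
    fix y
    have "(\<Sum>k\<in>{- int M..int M}. (if k = n then 1 else 0) * em k y) = (\<Sum>k\<in>{- int M..int M}. if k = n then em k y else 0)"
      by (intro sum.cong) auto
    then show "em n y = (\<Sum>k\<in>{- int M..int M}. (if k = n then 1 else 0) * em k y)"
      using that by (auto simp: sum.delta)
  qed
  then show ?case by (intro exI[of _ "nat \<bar>n\<bar>"] exI[of _ "\<lambda>k. if k = n then 1 else 0"]) blast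
next
  case (cmult p c)
  then obtain N a where "\<forall>M\<ge>N. p = (\<lambda>y. \<Sum>n\<in>{- int M..int M}. a n * em n y)" by blast
  then have "\<forall>M\<ge>N. (\<lambda>y. c * p y) = (\<lambda>y. \<Sum>n\<in>{- int M..int M}. (c * a n) * em n y)"
    by (simp add: sum_distrib_left mult.assoc)
  then show ?case by (intro exI)
next
  case (add p q)
  then obtain N a N' a' where "\<forall>M\<ge>N. p = (\<lambda>y. \<Sum>n\<in>{- int M..int M}. a n * em n y)"
    "\<forall>M\<ge>N'. q = (\<lambda>y. \<Sum>n\<in>{- int M..int M}. a' n * em n y)" by blast
  note pq = this
  have "(\<lambda>y. p y + q y) = (\<lambda>y. \<Sum>n\<in>{- int M..int M}. (a n + a' n) * em n y)" if "M \<ge> max N N'" for M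
    using that fun_cong[OF pq(1)[rule_format, of M]] fun_cong[OF pq(2)[rule_format, of M]]
    by (intro ext) (simp add: distrib_right sum.distrib)
  then have "\<forall>M\<ge>max N N'. (\<lambda>y. p y + q y) = (\<lambda>y. \<Sum>n\<in>{- int M..int M}. (a n + a' n) * em n y)" by blast
  then show ?case by (intro exI)
qed

lemma trig_poly_continuous: "trig_poly p \<Longrightarrow> continuous_on A p"
  by (induction rule: trig_poly.induct) (auto intro!: continuous_intros)

lemma L2_trig_poly: "trig_poly p \<Longrightarrow> L2 IY p"
  by (intro L2_continuous trig_poly_continuous)

text \<open>Membership in the \<open>L2\<close> closure of the trigonometric polynomials.
  Completeness of the exponentials says that this is all of \<open>L2\<close>; the class is enlarged
  by limits until that is reached.\<close>

definition dens :: "(real \<Rightarrow> complex) \<Rightarrow> bool" where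
  "dens f \<longleftrightarrow> L2 IY f \<and> (\<forall>\<epsilon>>0. \<exists>p. trig_poly p \<and> nsq IY (\<lambda>y. f y - p y) < \<epsilon>)"

lemma dens_L2: "dens f \<Longrightarrow> L2 IY f" by (simp add: dens_def)

lemma dens_limit:
  assumes f: "L2 IY f" and "\<And>\<epsilon>. \<epsilon> > 0 \<Longrightarrow> \<exists>g. dens g \<and> nsq IY (\<lambda>y. f y - g y) < \<epsilon>"
  shows "dens f"
  unfolding dens_def
proof (intro conjI allI impI f)
  fix \<epsilon> :: real assume \<epsilon>: "\<epsilon> > 0"
  obtain g where g: "dens g" "nsq IY (\<lambda>y. f y - g y) < \<epsilon> / 4" using assms(2)[of "\<epsilon> / 4"] \<epsilon> by auto
  obtain p where p: "trig_poly p" "nsq IY (\<lambda>y. g y - p y) < \<epsilon> / 4"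
    using g(1) \<epsilon> unfolding dens_def by (meson divide_pos_pos zero_less_numeral)
  have "nsq IY (\<lambda>y. (f y - g y) + (g y - p y)) \<le> 2 * nsq IY (\<lambda>y. f y - g y) + 2 * nsq IY (\<lambda>y. g y - p y)"
    by (intro nsq_add_le L2_diff f dens_L2 g L2_trig_poly p)
  also have "\<dots> < \<epsilon>" using g p by simp
  finally show "\<exists>p. trig_poly p \<and> nsq IY (\<lambda>y. f y - p y) < \<epsilon>" using p by auto
qed

lemma dens_trig_poly: "trig_poly p \<Longrightarrow> dens p"
  unfolding dens_def by (auto intro!: L2_trig_poly exI[of _ p] simp: nsq_def)

lemma dens_add: assumes "dens f" "dens g" shows "dens (\<lambda>y. f y + g y)"
  unfolding dens_def
proof (intro conjI allI impI L2_add dens_L2 assms)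
  fix \<epsilon> :: real assume \<epsilon>: "\<epsilon> > 0"
  obtain p where p: "trig_poly p" "nsq IY (\<lambda>y. f y - p y) < \<epsilon> / 4"
    using assms(1) \<epsilon> unfolding dens_def by (meson divide_pos_pos zero_less_numeral)
  obtain q where q: "trig_poly q" "nsq IY (\<lambda>y. g y - q y) < \<epsilon> / 4"
    using assms(2) \<epsilon> unfolding dens_def by (meson divide_pos_pos zero_less_numeral)
  have "nsq IY (\<lambda>y. (f y - p y) + (g y - q y)) \<le> 2 * nsq IY (\<lambda>y. f y - p y) + 2 * nsq IY (\<lambda>y. g y - q y)"
    by (intro nsq_add_le L2_diff dens_L2 assms L2_trig_poly p q)
  also have "\<dots> < \<epsilon>" using p q by simp
  finally have "nsq IY (\<lambda>y. (f y + g y) - (p y + q y)) < \<epsilon>" by (simp add: algebra_simps)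
  then show "\<exists>p. trig_poly p \<and> nsq IY (\<lambda>y. f y + g y - p y) < \<epsilon>" using trig_poly.add[OF p(1) q(1)] by blast
qed

lemma nsq_cmult: "nsq M (\<lambda>x. c * f x) = (norm c)\<^sup>2 * nsq M f"
  unfolding nsq_def by (simp add: norm_mult power_mult_distrib)

lemma dens_cmult: assumes "dens f" shows "dens (\<lambda>y. c * f y)"
  unfolding dens_def
proof (intro conjI allI impI L2_cmult dens_L2 assms)
  fix \<epsilon> :: real assume \<epsilon>: "\<epsilon> > 0"
  define d where "d = \<epsilon> / ((norm c)\<^sup>2 + 1)"
  have "d > 0" using \<epsilon> by (auto simp: d_def intro!: divide_pos_pos add_nonneg_pos)
  then obtain p where p: "trig_poly p" "nsq IY (\<lambda>y. f y - p y) < d"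
    using assms unfolding dens_def by blast
  have "nsq IY (\<lambda>y. c * (f y - p y)) \<le> (norm c)\<^sup>2 * d"
    unfolding nsq_cmult using p by (intro mult_left_mono) auto
  also have "\<dots> < ((norm c)\<^sup>2 + 1) * d" using \<open>d > 0\<close> by (simp add: distrib_right)
  also have "\<dots> = \<epsilon>" by (simp add: d_def add_nonneg_eq_0_iff)
  finally have "nsq IY (\<lambda>y. c * f y - c * p y) < \<epsilon>" by (simp add: right_diff_distrib)
  then show "\<exists>p. trig_poly p \<and> nsq IY (\<lambda>y. c * f y - p y) < \<epsilon>" using trig_poly.cmult[OF p(1)] by blast
qed

lemma dens_cong:
  assumes "dens f" "L2 IY g" "AE y in IY. f y = g y" shows "dens g"
proof (rule dens_limit[OF assms(2)])
  fix \<epsilon> :: real assume \<epsilon>: "\<epsilon> > 0"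
  have "nsq IY (\<lambda>y. g y - f y) = 0" unfolding nsq_def
    using assms(3) by (intro integral_eq_zero_AE) auto
  then show "\<exists>f. dens f \<and> nsq IY (\<lambda>y. g y - f y) < \<epsilon>" using \<epsilon> assms(1) by auto
qed

lemma nsq_dominated:
  assumes f: "f \<in> borel_measurable M" and u: "\<And>k. u k \<in> borel_measurable M"
    and g: "integrable M (\<lambda>x. (g x)\<^sup>2)"
    and le: "\<And>k x. x \<in> space M \<Longrightarrow> norm (u k x) \<le> g x"
    and lim: "\<And>x. x \<in> space M \<Longrightarrow> (\<lambda>k. u k x) \<longlonglongrightarrow> f x"
  shows "(\<lambda>k. nsq M (\<lambda>x. f x - u k x)) \<longlonglongrightarrow> 0"
proof -
  note [measurable] = f u
  have lef: "norm (f x) \<le> g x" if "x \<in> space M" for x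
    using lim[OF that] le[OF that] by (intro Lim_bounded[OF tendsto_norm[OF lim[OF that]]]) auto
  have "(\<lambda>k. \<integral>x. (norm (f x - u k x))\<^sup>2 \<partial>M) \<longlonglongrightarrow> (\<integral>x. 0 \<partial>M)"
  proof (rule integral_dominated_convergence[where w = "\<lambda>x. 4 * (g x)\<^sup>2"])
    show "integrable M (\<lambda>x. 4 * (g x)\<^sup>2)" using g by simp
    show "AE x in M. (\<lambda>k. (norm (f x - u k x))\<^sup>2) \<longlonglongrightarrow> 0"
    proof (intro AE_I2)
      fix x assume "x \<in> space M"
      have "(\<lambda>k. (norm (f x - u k x))\<^sup>2) \<longlonglongrightarrow> (norm (f x - f x))\<^sup>2"
        using lim[OF \<open>x \<in> space M\<close>] by (intro tendsto_intros)
      then show "(\<lambda>k. (norm (f x - u k x))\<^sup>2) \<longlonglongrightarrow> 0" by simp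
    qed
    show "AE x in M. norm ((norm (f x - u k x))\<^sup>2) \<le> 4 * (g x)\<^sup>2" for k
    proof (intro AE_I2)
      fix x assume x: "x \<in> space M"
      have "norm (f x - u k x) \<le> 2 * g x"
        using norm_triangle_ineq4[of "f x" "u k x"] lef[OF x] le[OF x, of k] by linarith
      then have "(norm (f x - u k x))\<^sup>2 \<le> (2 * g x)\<^sup>2" by (intro power_mono) auto
      then show "norm ((norm (f x - u k x))\<^sup>2) \<le> 4 * (g x)\<^sup>2" by (simp add: power_mult_distrib)
    qed
  qed measurable
  then show ?thesis by (simp add: nsq_def)
qed

lemma dens_dominated:
  assumes u: "\<And>k. dens (u k)" and f: "f \<in> borel_measurable IY"
    and g: "integrable IY (\<lambda>x. (g x)\<^sup>2)"
    and le: "\<And>k x. x \<in> {0..2*pi} \<Longrightarrow> norm (u k x) \<le> g x"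
    and lim: "\<And>x. x \<in> {0..2*pi} \<Longrightarrow> (\<lambda>k. u k x) \<longlonglongrightarrow> f x"
  shows "dens f"
proof (rule dens_limit)
  have um: "u k \<in> borel_measurable IY" for k using dens_L2[OF u[of k]] by (simp add: L2_def)
  have "norm (f x) \<le> g x" if "x \<in> {0..2*pi}" for x
    using le[OF that] by (intro Lim_bounded[OF tendsto_norm[OF lim[OF that]]]) auto
  then have "(norm (f x))\<^sup>2 \<le> (g x)\<^sup>2" if "x \<in> {0..2*pi}" for x using that by (intro power_mono) auto
  then show "L2 IY f" unfolding L2_def using f
    by (intro conjI Bochner_Integration.integrable_bound[OF g]) (auto intro!: AE_I2)
  fix \<epsilon> :: real assume "\<epsilon> > 0"
  have "(\<lambda>k. nsq IY (\<lambda>x. f x - u k x)) \<longlonglongrightarrow> 0"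
    by (rule nsq_dominated[OF f um g]) (use le lim in auto)
  then have "\<forall>\<^sub>F k in sequentially. nsq IY (\<lambda>x. f x - u k x) < \<epsilon>"
    using \<open>\<epsilon> > 0\<close> by (rule order_tendstoD)
  then obtain k where "nsq IY (\<lambda>x. f x - u k x) < \<epsilon>" by (auto simp: eventually_sequentially)
  then show "\<exists>g. dens g \<and> nsq IY (\<lambda>y. f y - g y) < \<epsilon>" using u by blast
qed

lemma trig_poly_cos: "trig_poly (\<lambda>y. of_real (cos (y - t)))"
proof -
  have "of_real (cos (y - t)) = (cis (- t) / 2) * em 1 y + (cis t / 2) * em (- 1) y" for y
  proof -
    have "complex_of_real (cos (y - t)) = (cis (y - t) + cis (- (y - t))) / 2"
      by (simp only: cis_cnj[symmetric] complex_add_cnj cis.sel) simp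
    also have "cis (y - t) = cis (- t) * em 1 y" by (simp add: em_def cis_mult)
    also have "cis (- (y - t)) = cis t * em (- 1) y" by (simp add: em_def cis_mult)
    finally show ?thesis by (simp add: add_divide_distrib)
  qed
  then have eq: "(\<lambda>y. of_real (cos (y - t))) = (\<lambda>y. (cis (- t) / 2) * em 1 y + (cis t / 2) * em (- 1) y)" by (rule ext)
  show ?thesis unfolding eq by (intro trig_poly.intros)
qed

lemma trig_poly_polynomial_cos:
  "real_polynomial_function (g :: real \<Rightarrow> real) \<Longrightarrow> trig_poly (\<lambda>y. of_real (g (cos (y - t))))"
proof (induction rule: real_polynomial_function.induct)
  case (linear f)
  then have "f x = f 1 * x" for x
    using linear_cmul[OF bounded_linear.linear, of f x 1] by (simp add: mult.commute)
  then have "(\<lambda>y. complex_of_real (f (cos (y - t)))) = (\<lambda>y. of_real (f 1) * of_real (cos (y - t)))"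
    by (metis of_real_mult)
  then show ?case using trig_poly.cmult[OF trig_poly_cos] by simp
next
  case (const c) then show ?case by (rule trig_poly_const)
next
  case (add f g) then show ?case using trig_poly.add[OF add.IH] by simp
next
  case (mult f g) then show ?case using trig_poly_mult[OF mult.IH] by simp
qed

lemma measure_MI: "a \<le> b \<Longrightarrow> measure (MI a b) {a..b} = b - a"
  unfolding MI_def by (subst measure_restrict_space) auto

text \<open>Weierstrass approximation on \<open>[-1, 1]\<close>, composed with
  \<open>cos (y - t)\<close>: a polynomial in this cosine is a trigonometric polynomial. Such
  functions are symmetric about \<open>t\<close>, which is enough for arcs centred there.\<close>

lemma dens_continuous_cos:
  fixes \<phi> :: "real \<Rightarrow> real"
  assumes \<phi>: "continuous_on UNIV \<phi>"
  shows "dens (\<lambda>y. of_real (\<phi> (cos (y - t))))"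
proof (rule dens_limit)
  have "continuous_on {0..2*pi} (\<lambda>y. \<phi> (cos (y - t)))"
    by (intro continuous_on_compose2[OF \<phi>] continuous_intros) auto
  then show L: "L2 IY (\<lambda>y. of_real (\<phi> (cos (y - t))))" by (intro L2_continuous continuous_intros)
  fix \<epsilon> :: real assume \<epsilon>: "\<epsilon> > 0"
  \<comment> \<open>A uniform error \<open>e\<close> costs
    \<open>e^2 * 2 pi = \<epsilon> / 2\<close> in the squared norm.\<close>
  define e where "e = sqrt (\<epsilon> / (4 * pi))"
  have e: "e > 0" using \<epsilon> by (simp add: e_def)
  have "continuous_on {-1..1} \<phi>" using \<phi> continuous_on_subset by blast
  from Stone_Weierstrass_real_polynomial_function[OF _ this e] obtain g where
    g: "real_polynomial_function g" "\<And>x. x \<in> {-1..1} \<Longrightarrow> \<bar>\<phi> x - g x\<bar> < e" by auto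
  note tp = trig_poly_polynomial_cos[OF g(1), of t]
  have "nsq IY (\<lambda>y. of_real (\<phi> (cos (y - t))) - of_real (g (cos (y - t)))) \<le> nsq IY (\<lambda>y. of_real e)"
  proof (rule nsq_mono)
    show "L2 IY (\<lambda>y. of_real e)" by (intro L2_continuous continuous_intros)
    show "(\<lambda>y. complex_of_real (\<phi> (cos (y - t))) - of_real (g (cos (y - t)))) \<in> borel_measurable IY"
      using L2_diff[OF L L2_trig_poly[OF tp]] by (simp add: L2_def)
    show "norm (complex_of_real (\<phi> (cos (y - t))) - of_real (g (cos (y - t)))) \<le> norm (complex_of_real e)" for y
      using g(2)[of "cos (y - t)"] e by (simp flip: of_real_diff)
  qed
  also have "\<dots> = e\<^sup>2 * (2 * pi)"
    unfolding nsq_def by (simp add: measure_MI)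
  also have "\<dots> < \<epsilon>" using \<epsilon> by (simp add: e_def field_simps)
  finally show "\<exists>g. dens g \<and> nsq IY (\<lambda>y. of_real (\<phi> (cos (y - t))) - g y) < \<epsilon>"
    using dens_trig_poly[OF tp] by blast
qed

text \<open>An arc of the circle is cut out by a half plane, so its indicator is a function of \<open>cos (y - t)\<close>.\<close>

lemma dens_arc: "dens (\<lambda>y. of_real (if cos (y - t) > s then 1 else 0))"
\<comment> \<open>Continuous ramps of slope \<open>k\<close> in the cosine, clipped to
  \<open>[0, 1]\<close>, converge pointwise to the indicator.\<close>
proof (rule dens_dominated[where u = "\<lambda>k y. of_real (min 1 (max 0 (real k * (cos (y - t) - s))))" and g = "\<lambda>y. 1"])
  show "dens (\<lambda>y. of_real (min 1 (max 0 (real k * (cos (y - t) - s)))))" for k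
    by (rule dens_continuous_cos[where \<phi> = "\<lambda>c. min 1 (max 0 (real k * (c - s)))"]) (intro continuous_intros)
  show "(\<lambda>k. complex_of_real (min 1 (max 0 (real k * (cos (y - t) - s))))) \<longlonglongrightarrow> of_real (if cos (y - t) > s then 1 else 0)" for y
  proof (intro tendsto_of_real)
    show "(\<lambda>k. min 1 (max 0 (real k * (cos (y - t) - s)))) \<longlonglongrightarrow> (if cos (y - t) > s then 1 else 0)"
    proof (cases "cos (y - t) > s")
      case True
      obtain K :: nat where K: "1 / (cos (y - t) - s) \<le> real K" using real_arch_simple by blast
      have "min 1 (max 0 (real k * (cos (y - t) - s))) = 1" if "k \<ge> K" for k
      proof -
        have "1 / (cos (y - t) - s) \<le> real k" using K that by simp
        then show ?thesis using True by (simp add: field_simps)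
      qed
      then have "\<forall>\<^sub>F k in sequentially. 1 = min 1 (max 0 (real k * (cos (y - t) - s)))"
        by (auto simp: eventually_sequentially)
      then show ?thesis using True by (simp add: tendsto_eventually eventually_mono)
    next
      case False
      then have "real k * (cos (y - t) - s) \<le> 0" for k by (intro mult_nonneg_nonpos) auto
      then have "max 0 (real k * (cos (y - t) - s)) = 0" for k by (rule max_absorb1)
      then show ?thesis using False by simp
    qed
  qed
  show "(\<lambda>y. complex_of_real (if cos (y - t) > s then 1 else 0)) \<in> borel_measurable IY" by measurable
qed (auto simp: MI.integrable_const)

lemma dens_interval: "dens (indicator {c<..<d})"
proof (cases "max c 0 < min d (2 * pi)")
  case True
  define a b where "a = max c 0" and "b = min d (2 * pi)"
  have ab: "0 \<le> a" "a < b" "b \<le> 2 * pi" using True by (auto simp: a_def b_def)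
  define t r where "t = (a + b) / 2" and "r = (b - a) / 2"
  have tr: "0 < r" "r \<le> pi" "r \<le> t" "t + r \<le> 2 * pi" "a = t - r" "b = t + r"
    using ab by (auto simp: t_def r_def field_simps)
  \<comment> \<open>\<open>y - t\<close> can leave \<open>[- pi, pi]\<close>, beyond which the
    cosine no longer decreases with the modulus; there the argument is reflected using the
    period.\<close>
  have iff: "cos (y - t) > cos r \<longleftrightarrow> a < y \<and> y < b" if y: "0 \<le> y" "y \<le> 2 * pi" for y
  proof -
    have key: "cos v > cos r \<longleftrightarrow> v < r" if "0 \<le> v" "v \<le> pi" for v
      using tr that by (intro cos_mono_less_eq) auto
    define u where "u = y - t"
    consider "\<bar>u\<bar> \<le> pi" | "u > pi" | "u < - pi" by linarith
    then show ?thesis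
    proof cases
      case 1
      then show ?thesis using key[of "\<bar>u\<bar>"] tr by (auto simp: u_def)
    next
      case 2
      have "cos u = cos (2 * pi - u)" by (simp add: cos_diff)
      then show ?thesis using key[of "2 * pi - u"] 2 y tr by (auto simp: u_def)
    next
      case 3
      have "cos u = cos (2 * pi + u)" by (simp add: cos_add)
      then show ?thesis using key[of "2 * pi + u"] 3 y tr by (auto simp: u_def)
    qed
  qed
  \<comment> \<open>Clipping to \<open>[0, 2 pi]\<close> may lose the end points 0 and
    \<open>2 pi\<close>, which are null.\<close>
  have ne: "AE y in IY. y \<noteq> 0" "AE y in IY. y \<noteq> 2 * pi" by (rule AE_MI_neq)+
  have sp: "AE y in IY. y \<in> {0..2*pi}" using AE_space[of IY] by simp
  show ?thesis
  proof (rule dens_cong[OF dens_arc[of "cos r" t]])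
    show "L2 IY (indicator {c<..<d})" by (intro MI.L2_bounded[where B = 1]) (auto simp: indicator_def)
    show "AE y in IY. complex_of_real (if cos (y - t) > cos r then 1 else 0) = indicator {c<..<d} y"
      using ne sp by eventually_elim (use iff in \<open>auto simp: indicator_def a_def b_def\<close>)
  qed
next
  case False
  have "dens (\<lambda>y. 0)" by (intro dens_trig_poly trig_poly_const)
  then show ?thesis
  proof (rule dens_cong)
    have ne: "AE y in IY. y \<noteq> 0" "AE y in IY. y \<noteq> 2 * pi" by (rule AE_MI_neq)+
    have sp: "AE y in IY. y \<in> {0..2*pi}" using AE_space[of IY] by simp
    show "AE y in IY. 0 = indicator {c<..<d} y"
      using ne sp by eventually_elim (use False in \<open>auto simp: indicator_def max_def min_def split: if_splits\<close>)
    show "L2 IY (indicator {c<..<d})" by (intro MI.L2_bounded[where B = 1]) (auto simp: indicator_def)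
  qed
qed

lemma L2_indicator: "A \<in> sets IY \<Longrightarrow> L2 IY (indicator A)"
  by (intro MI.L2_bounded[where B = 1]) (auto simp: indicator_def)

lemma sets_borel_intervals: "sets borel = sigma_sets UNIV (range (\<lambda>(a, b). {a<..<b :: real}))"
proof -
  have bx: "(\<lambda>(a, b). box a b) = (\<lambda>(a, b). {a<..<b :: real})" by (rule ext) (auto simp: box_real)
  show ?thesis unfolding borel_eq_box bx by simp
qed

lemma Int_stable_intervals: "Int_stable (range (\<lambda>(a, b). {a<..<b :: real}))"
proof (rule Int_stableI)
  fix A B assume "A \<in> range (\<lambda>(a, b). {a<..<b :: real})" "B \<in> range (\<lambda>(a, b). {a<..<b :: real})"
  then obtain a b c d where "A = {a<..<b}" "B = {c<..<d}" by auto
  then have "A \<inter> B = (\<lambda>(a, b). {a<..<b}) (max a c, min b d)" by auto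
  then show "A \<inter> B \<in> range (\<lambda>(a, b). {a<..<b :: real})" by (metis rangeI)
qed

text \<open>Dynkin argument: the property holds for the intersection-stable family of open intervals
  and passes to complements and countable disjoint unions.\<close>

lemma dens_borel_indicator:
  assumes "A \<in> sets borel"
  shows "dens (indicator A)"
proof -
  let ?G = "range (\<lambda>(a, b). {a<..<b :: real})"
  have L2B: "L2 IY (indicator B)" if "B \<in> sigma_sets UNIV ?G" for B :: "real set"
    using that unfolding sets_borel_intervals[symmetric]
    by (intro MI.L2_bounded[where B = 1] borel_measurable_MI) (auto simp: indicator_def)
  note Int_stable_intervals
  moreover have "?G \<subseteq> Pow UNIV" by simp
  moreover have "A \<in> sigma_sets UNIV ?G" using assms by (simp only: sets_borel_intervals)
  ultimately show ?thesis
  proof (induction A rule: sigma_sets_induct_disjoint)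
    case (basic A)
    then show ?case by (auto intro: dens_interval)
  next
    case empty
    show ?case using dens_trig_poly[OF trig_poly_const[of 0]] by (simp add: indicator_def[abs_def])
  next
    case (compl A)
    have "dens (\<lambda>y. 1 + (- 1) * indicator A y)"
      by (intro dens_add dens_cmult dens_trig_poly trig_poly_const compl)
    moreover have "(\<lambda>y. 1 + (- 1) * indicator A y) = (indicator (UNIV - A) :: real \<Rightarrow> complex)"
      by (rule ext) (simp add: indicator_def)
    ultimately show ?case by simp
  next
    case (union A)
    have part: "dens (\<lambda>y. \<Sum>i<k. indicator (A i) y)" for k
    proof (induction k)
      case 0
      then show ?case using dens_trig_poly[OF trig_poly_const[of 0]] by simp
    next
      case (Suc k)
      then show ?case using dens_add[OF Suc union(3)[of k]] by simp
    qed
    have sums: "(\<Sum>i<k. indicator (A i) y) = (indicator (\<Union>i<k. A i) y :: complex)" for k y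
    proof -
      have "disjoint_family_on A {..<k}" using union(1) by (auto simp: disjoint_family_on_def)
      moreover have "complex_of_real (indicator B y) = indicator B y" for B by (simp add: indicator_def)
      ultimately show ?thesis
        using arg_cong[OF indicator_UN_disjoint[of "{..<k}" A y], of complex_of_real] by simp
    qed
    show ?case
    proof (rule dens_dominated[OF part, where g = "\<lambda>y. 1"])
      have "(\<Union>i. A i) \<in> sigma_sets UNIV ?G" using union(2) by (intro sigma_sets.Union) auto
      then show "(indicator (\<Union>i. A i) :: real \<Rightarrow> complex) \<in> borel_measurable IY" by (rule L2_measurable[OF L2B])
      show "norm (\<Sum>i<k. indicator (A i) y :: complex) \<le> 1" for k y
        unfolding sums by (simp add: indicator_def)
      show "(\<lambda>k. \<Sum>i<k. indicator (A i) y :: complex) \<longlonglongrightarrow> indicator (\<Union>i. A i) y" for y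
        unfolding sums by (rule LIMSEQ_indicator_UN)
    qed (simp add: MI.integrable_const)
  qed
qed

lemma dens_indicator: "A \<in> sets IY \<Longrightarrow> dens (indicator A)"
proof -
  assume A: "A \<in> sets IY"
  then obtain B where B: "B \<in> sets borel" "A = {0..2*pi} \<inter> B"
    unfolding sets_MI sets_restrict_space by auto
  have "AE y in IY. y \<in> {0..2*pi}" using AE_space[of IY] by simp
  then have "AE y in IY. (indicator B y :: complex) = indicator A y"
    by eventually_elim (simp add: B indicator_def)
  then show ?thesis using dens_cong[OF dens_borel_indicator[OF B(1)] L2_indicator[OF A]] by blast
qed

lemma integrable_sq_le:
  fixes u v :: "'a \<Rightarrow> real"
  assumes "integrable M (\<lambda>x. (v x)\<^sup>2)" "u \<in> borel_measurable M" "\<And>x. x \<in> space M \<Longrightarrow> 0 \<le> u x" "\<And>x. x \<in> space M \<Longrightarrow> u x \<le> v x"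
  shows "integrable M (\<lambda>x. (u x)\<^sup>2)"
  using assms(2-) by (intro Bochner_Integration.integrable_bound[OF assms(1)] AE_I2) (auto intro!: power_mono)

lemma dens_nonneg:
  fixes f :: "real \<Rightarrow> real"
  assumes "f \<in> borel_measurable IY" "\<And>y. f y \<ge> 0"
  shows "integrable IY (\<lambda>y. (f y)\<^sup>2) \<Longrightarrow> dens (\<lambda>y. of_real (f y))"
  using assms
proof (induction rule: borel_measurable_induct_real)
  case (set A)
  have "(\<lambda>y. complex_of_real (indicator A y)) = indicator A" by (rule ext) (simp add: indicator_def)
  then show ?case using dens_indicator[OF set(1)] by simp
next
  case (mult u c)
  show ?case
  proof (cases "c = 0")
    case True
    then show ?thesis using dens_trig_poly[OF trig_poly_const[of 0]] by simp
  next
    case False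
    then have "integrable IY (\<lambda>y. (u y)\<^sup>2)" using mult.prems by (simp add: power_mult_distrib)
    then show ?thesis using dens_cmult[OF mult.IH, of "of_real c"] by simp
  qed
next
  case (add u v)
  have "integrable IY (\<lambda>y. (u y)\<^sup>2)" "integrable IY (\<lambda>y. (v y)\<^sup>2)"
    by (rule integrable_sq_le[OF add.prems]; use add.hyps in auto)+
  then show ?case using dens_add[OF add.IH(2,1)] by simp
next
  case (seq U)
  have le: "U k y \<le> f y" if "y \<in> {0..2*pi}" for k y
  proof (rule incseq_le)
    show "incseq (\<lambda>k. U k y)" using seq.hyps(3) by (auto simp: incseq_def le_fun_def)
  qed (use seq.hyps(4) that in auto)
  show ?case
  proof (rule dens_dominated[where u = "\<lambda>k y. of_real (U k y)" and g = f])
    show "dens (\<lambda>y. of_real (U k y))" for k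
      by (rule seq.IH, rule integrable_sq_le[OF seq.prems]) (use seq.hyps le in auto)
    show "(\<lambda>y. complex_of_real (f y)) \<in> borel_measurable IY"
      using assms(1) by measurable
    show "(\<lambda>k. complex_of_real (U k y)) \<longlonglongrightarrow> of_real (f y)" if "y \<in> {0..2*pi}" for y
      using seq.hyps(4) that by (intro tendsto_of_real) auto
  qed (use seq.prems le seq.hyps(2) in auto)
qed

lemma dens_real:
  fixes f :: "real \<Rightarrow> real"
  assumes [measurable]: "f \<in> borel_measurable IY" and i: "integrable IY (\<lambda>y. (f y)\<^sup>2)"
  shows "dens (\<lambda>y. of_real (f y))"
proof -
  have "dens (\<lambda>y. of_real (max 0 (f y)))"
    by (rule dens_nonneg, measurable) (auto intro!: Bochner_Integration.integrable_bound[OF i] AE_I2 simp: max_def)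
  moreover have "dens (\<lambda>y. of_real (max 0 (- f y)))"
    by (rule dens_nonneg, measurable) (auto intro!: Bochner_Integration.integrable_bound[OF i] AE_I2 simp: max_def)
  ultimately have "dens (\<lambda>y. of_real (max 0 (f y)) + (- 1) * of_real (max 0 (- f y)))"
    by (intro dens_add dens_cmult)
  moreover have "(\<lambda>y. of_real (max 0 (f y)) + (- 1) * of_real (max 0 (- f y))) = (\<lambda>y. complex_of_real (f y))"
    by (rule ext) (simp add: max_def)
  ultimately show ?thesis by simp
qed

lemma L2_imp_dens: assumes f: "L2 IY f" shows "dens f"
proof -
  have [measurable]: "f \<in> borel_measurable IY" using f by (simp add: L2_def)
  have i: "integrable IY (\<lambda>y. (norm (f y))\<^sup>2)" using f by (simp add: L2_def)
  have "dens (\<lambda>y. of_real (Re (f y)))" "dens (\<lambda>y. of_real (Im (f y)))"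
    by (rule dens_real, measurable, auto intro!: Bochner_Integration.integrable_bound[OF i] AE_I2 simp: cmod_def)+
  then have "dens (\<lambda>y. of_real (Re (f y)) + \<i> * of_real (Im (f y)))" by (intro dens_add dens_cmult)
  then show ?thesis by (simp flip: complex_eq)
qed

section \<open>Fourier coefficients, Bessel and Parseval\<close>

definition fc :: "int \<Rightarrow> (real \<Rightarrow> complex) \<Rightarrow> complex" where
  "fc n f = (\<integral>y. f y * em (- n) y \<partial>IY) / (2 * pi)"

lemma L2_em: "L2 IY (em n)"
  by (intro L2_continuous continuous_intros)

lemma fc_eq_ip: "2 * pi * fc n f = ip IY f (em n)"
  by (simp add: fc_def ip_def cnj_em)

lemma integral_em: "(\<integral>y. em n y \<partial>IY) = (if n = 0 then 2 * pi else 0)"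
proof (cases "n = 0")
  case True
  then show ?thesis by (simp add: measure_MI scaleR_conv_of_real)
next
  case False
  have "integral\<^sup>L IY (em n) = em n (2 * pi) / (\<i> * of_int n) - em n 0 / (\<i> * of_int n)"
  proof (rule integral_MI_FTC)
    fix x
    show "((\<lambda>y. em n y / (\<i> * of_int n)) has_vector_derivative em n x) (at x within {0..2*pi})"
      using has_vector_derivative_divide[OF has_vector_derivative_em[of n x "{0..2*pi}"], of "\<i> * of_int n"] False by simp
  qed (auto intro: continuous_intros)
  also have "em n (2 * pi) = 1"
    using cis_multiple_2pi[of "of_int n"] by (simp add: em_def mult_ac)
  finally show ?thesis using False by (simp add: em_def)
qed

lemma ip_em: "ip IY (em n) (em m) = (if n = m then 2 * pi else 0)"
  using integral_em[of "n - m"] by (simp add: ip_def cnj_em flip: em_add)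

lemma nsq_expand:
  assumes "L2 M f" "L2 M g"
  shows "nsq M (\<lambda>x. f x - g x) = nsq M f + nsq M g - 2 * Re (ip M f g)"
proof -
  have i: "integrable M (\<lambda>x. Re (f x * cnj (g x)))" "integrable M (\<lambda>x. (norm (f x))\<^sup>2)" "integrable M (\<lambda>x. (norm (g x))\<^sup>2)"
    using integrable_Re[OF ip_integrable[OF assms]] assms by (auto simp: L2_def simp del: times_complex.sel)
  have "nsq M (\<lambda>x. f x - g x) = (\<integral>x. (norm (f x))\<^sup>2 + (norm (g x))\<^sup>2 - 2 * Re (f x * cnj (g x)) \<partial>M)"
    unfolding nsq_def by (intro Bochner_Integration.integral_cong refl) (simp add: cmod_power2 power2_diff algebra_simps)
  also have "\<dots> = nsq M f + nsq M g - 2 * (\<integral>x. Re (f x * cnj (g x)) \<partial>M)"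
    using i by (simp add: nsq_def del: times_complex.sel)
  also have "(\<integral>x. Re (f x * cnj (g x)) \<partial>M) = Re (ip M f g)"
    unfolding ip_def by (rule integral_Re[OF ip_integrable[OF assms]])
  finally show ?thesis .
qed

lemma ip_sum_right:
  assumes "finite A" "L2 M f" "\<And>n. n \<in> A \<Longrightarrow> L2 M (g n)"
  shows "ip M f (\<lambda>x. \<Sum>n\<in>A. g n x) = (\<Sum>n\<in>A. ip M f (g n))"
  unfolding ip_def using assms by (simp add: sum_distrib_left ip_integrable)

lemma ip_sum_left:
  assumes "finite A" "L2 M f" "\<And>n. n \<in> A \<Longrightarrow> L2 M (g n)"
  shows "ip M (\<lambda>x. \<Sum>n\<in>A. g n x) f = (\<Sum>n\<in>A. ip M (g n) f)"
  unfolding ip_def using assms by (simp add: sum_distrib_right ip_integrable)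

text \<open>Pythagoras with arbitrary coefficients. Taking \<open>c n = fc n f\<close> gives Bessel;
  other choices show that the Fourier sum is the best approximation, which turns density into
  Parseval.\<close>

lemma nsq_diff_trig_sum:
  assumes f: "L2 IY f" and A: "finite A"
  shows "nsq IY (\<lambda>y. f y - (\<Sum>n\<in>A. c n * em n y))
    = nsq IY f - 2 * pi * (\<Sum>n\<in>A. (norm (fc n f))\<^sup>2) + 2 * pi * (\<Sum>n\<in>A. (norm (fc n f - c n))\<^sup>2)"
proof -
  let ?p = "\<lambda>y. \<Sum>n\<in>A. c n * em n y"
  have L: "L2 IY (\<lambda>y. c n * em n y)" for n by (intro L2_cmult L2_em)
  have Lp: "L2 IY ?p" by (intro L2_sum L)
  have "ip IY ?p ?p = (\<Sum>n\<in>A. \<Sum>m\<in>A. c n * cnj (c m) * ip IY (em n) (em m))"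
    by (simp add: ip_sum_right[OF A Lp] ip_sum_left[OF A L2_em L] L ip_cmult_left ip_cmult_right sum_distrib_left)
      (subst sum.swap, simp add: mult_ac)
  also have "\<dots> = (\<Sum>n\<in>A. 2 * pi * (c n * cnj (c n)))"
    using A by (intro sum.cong refl) (simp add: ip_em if_distrib sum.delta cong: if_cong)
  finally have "complex_of_real (nsq IY ?p) = of_real (\<Sum>n\<in>A. 2 * pi * (norm (c n))\<^sup>2)"
    by (simp only: ip_self of_real_sum of_real_mult complex_norm_square)
  then have n1: "nsq IY ?p = (\<Sum>n\<in>A. 2 * pi * (norm (c n))\<^sup>2)" by (simp only: of_real_eq_iff)
  have n2: "ip IY f ?p = (\<Sum>n\<in>A. cnj (c n) * (2 * pi * fc n f))"
    by (simp add: ip_sum_right[OF A f L] ip_cmult_right fc_eq_ip[symmetric])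
  have "nsq IY (\<lambda>y. f y - ?p y) = nsq IY f + (\<Sum>n\<in>A. 2 * pi * (norm (c n))\<^sup>2 - 2 * Re (cnj (c n) * (2 * pi * fc n f)))"
    unfolding nsq_expand[OF f Lp] n1 n2 by (simp add: sum_subtractf sum_distrib_left del: times_complex.sel)
  also have "\<dots> = nsq IY f + (\<Sum>n\<in>A. 2 * pi * (norm (fc n f - c n))\<^sup>2 - 2 * pi * (norm (fc n f))\<^sup>2)"
    by (intro arg_cong2[where f = "(+)"] refl sum.cong) (simp add: cmod_power2 power2_diff algebra_simps)
  finally show ?thesis by (simp add: sum_subtractf sum_distrib_left)
qed

lemma bessel: "L2 IY f \<Longrightarrow> finite A \<Longrightarrow> 2 * pi * (\<Sum>n\<in>A. (norm (fc n f))\<^sup>2) \<le> nsq IY f"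
  using nsq_diff_trig_sum[of f A "\<lambda>n. fc n f"] nsq_nonneg[of IY "\<lambda>y. f y - (\<Sum>n\<in>A. fc n f * em n y)"] by simp

lemma parseval:
  assumes f: "L2 IY f"
  shows "(\<lambda>N. 2 * pi * (\<Sum>n\<in>{- int N..int N}. (norm (fc n f))\<^sup>2)) \<longlonglongrightarrow> nsq IY f"
proof (rule LIMSEQ_I)
  fix \<epsilon> :: real assume "\<epsilon> > 0"
  then obtain p where p: "trig_poly p" "nsq IY (\<lambda>y. f y - p y) < \<epsilon>"
    using L2_imp_dens[OF f] unfolding dens_def by blast
  obtain N c where c: "\<And>M. M \<ge> N \<Longrightarrow> p = (\<lambda>y. \<Sum>n\<in>{- int M..int M}. c n * em n y)"
    using trig_poly_finite_sum[OF p(1)] by blast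
  have "norm (2 * pi * (\<Sum>n\<in>{- int M..int M}. (norm (fc n f))\<^sup>2) - nsq IY f) < \<epsilon>" if "M \<ge> N" for M
  proof -
    have "nsq IY (\<lambda>y. f y - (\<Sum>n\<in>{- int M..int M}. c n * em n y)) < \<epsilon>" using p(2) fun_cong[OF c[OF that]] by simp
    moreover have "2 * pi * (\<Sum>n\<in>{- int M..int M}. (norm (fc n f - c n))\<^sup>2) \<ge> 0"
      by (intro mult_nonneg_nonneg sum_nonneg) auto
    ultimately have "nsq IY f - 2 * pi * (\<Sum>n\<in>{- int M..int M}. (norm (fc n f))\<^sup>2) < \<epsilon>"
      using nsq_diff_trig_sum[OF f, of "{- int M..int M}" c] by simp
    then show ?thesis using bessel[OF f, of "{- int M..int M}"] by simp
  qed
  then show "\<exists>N. \<forall>M\<ge>N. norm (2 * pi * (\<Sum>n\<in>{- int M..int M}. (norm (fc n f))\<^sup>2) - nsq IY f) < \<epsilon>" by blast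
qed

section \<open>Weak derivatives in one variable\<close>

text \<open>The derivative is asked for existentially, so that closure under sums, products and
  affine changes follows by induction without computing \<open>deriv\<close>.\<close>

fun ndiff :: "nat \<Rightarrow> (real \<Rightarrow> real) \<Rightarrow> bool" where
  "ndiff 0 f = True"
| "ndiff (Suc n) f = (\<exists>f'. (\<forall>x. (f has_real_derivative f' x) (at x)) \<and> ndiff n f')"

definition smooth :: "(real \<Rightarrow> real) \<Rightarrow> bool" where
  "smooth f \<longleftrightarrow> (\<forall>n. ndiff n f)"

lemma ndiff_Suc: "ndiff (Suc n) f \<Longrightarrow> ndiff n f"
  by (induction n arbitrary: f) auto

lemma ndiff_const: "ndiff n (\<lambda>x. c)"
  by (induction n arbitrary: c) (auto intro!: exI[of _ "\<lambda>x. 0"])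

lemma ndiff_add: "ndiff n f \<Longrightarrow> ndiff n g \<Longrightarrow> ndiff n (\<lambda>x. f x + g x)"
proof (induction n arbitrary: f g)
  case (Suc n)
  then obtain f' g' where "\<forall>x. (f has_real_derivative f' x) (at x)" "ndiff n f'"
    "\<forall>x. (g has_real_derivative g' x) (at x)" "ndiff n g'" by auto
  then show ?case using Suc.IH by (auto intro!: exI[of _ "\<lambda>x. f' x + g' x"] DERIV_add)
qed simp

lemma ndiff_mult: "ndiff n f \<Longrightarrow> ndiff n g \<Longrightarrow> ndiff n (\<lambda>x. f x * g x)"
proof (induction n arbitrary: f g)
  case (Suc n)
  then obtain f' g' where *: "\<forall>x. (f has_real_derivative f' x) (at x)" "ndiff n f'"
    "\<forall>x. (g has_real_derivative g' x) (at x)" "ndiff n g'" by auto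
  have "ndiff n (\<lambda>x. f' x * g x + g' x * f x)"
    using Suc.IH[OF *(2) ndiff_Suc[OF Suc.prems(2)]] Suc.IH[OF *(4) ndiff_Suc[OF Suc.prems(1)]] by (rule ndiff_add)
  moreover have "\<forall>x. ((\<lambda>x. f x * g x) has_real_derivative f' x * g x + g' x * f x) (at x)"
    using * by (auto intro!: DERIV_mult)
  ultimately show ?case by auto
qed simp

lemma ndiff_affine: "ndiff n f \<Longrightarrow> ndiff n (\<lambda>x. f (a * x + b))"
proof (induction n arbitrary: f)
  case (Suc n)
  then obtain f' where *: "\<forall>x. (f has_real_derivative f' x) (at x)" "ndiff n f'" by auto
  have "ndiff n (\<lambda>x. a * f' (a * x + b))"
    by (intro ndiff_mult ndiff_const Suc.IH *)
  moreover have "\<forall>x. ((\<lambda>x. f (a * x + b)) has_real_derivative a * f' (a * x + b)) (at x)"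
  proof
    fix x
    have "((\<lambda>x. a * x + b) has_real_derivative a) (at x)" by (auto intro!: derivative_eq_intros)
    from DERIV_chain2[OF *(1)[rule_format] this] show "((\<lambda>x. f (a * x + b)) has_real_derivative a * f' (a * x + b)) (at x)"
      by (simp add: mult.commute)
  qed
  ultimately show ?case by auto
qed simp

lemma smooth_add: "smooth f \<Longrightarrow> smooth g \<Longrightarrow> smooth (\<lambda>x. f x + g x)"
  and smooth_mult: "smooth f \<Longrightarrow> smooth g \<Longrightarrow> smooth (\<lambda>x. f x * g x)"
  and smooth_const: "smooth (\<lambda>x. c)"
  and smooth_affine: "smooth f \<Longrightarrow> smooth (\<lambda>x. f (a * x + b))"
  by (auto simp: smooth_def ndiff_add ndiff_mult ndiff_const ndiff_affine)

lemma smooth_deriv: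
  assumes "smooth f"
  shows "(f has_real_derivative deriv f x) (at x)" "smooth (deriv f)"
proof -
  have d: "\<exists>f'. (\<forall>x. (f has_real_derivative f' x) (at x)) \<and> ndiff n f'" for n
    using assms[unfolded smooth_def, rule_format, of "Suc n"] by simp
  have eq: "f' = deriv f" if "\<forall>x. (f has_real_derivative f' x) (at x)" for f'
    using that by (auto intro!: ext DERIV_imp_deriv[symmetric])
  show "(f has_real_derivative deriv f x) (at x)" using d[of 0] eq by auto
  show "smooth (deriv f)" unfolding smooth_def using d eq by metis
qed

lemma smooth_antideriv:
  assumes "\<And>x. (F has_real_derivative f x) (at x)" "smooth f"
  shows "smooth F"
  unfolding smooth_def
proof
  fix n show "ndiff n F"
    using assms by (cases n) (auto simp: smooth_def)
qed

lemma smooth_continuous: "smooth f \<Longrightarrow> continuous_on A f"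
  using smooth_deriv(1) by (intro DERIV_continuous_on) (auto intro: has_field_derivative_at_within)

text \<open>\<open>flat 0\<close> is the standard smooth function that vanishes to infinite order at
  0. The extra powers make the span of the family closed under differentiation, as an induction on
  the order needs.\<close>

definition flat :: "nat \<Rightarrow> real \<Rightarrow> real" where
  "flat k t = (if t > 0 then (1 / t) ^ k * exp (- (1 / t)) else 0)"

lemma flat_tendsto_0: "(flat k \<longlongrightarrow> 0) (at 0)"
proof -
  have "((\<lambda>s::real. s ^ k * exp (- s)) \<longlongrightarrow> 0) at_top"
    using tendsto_power_div_exp_0[of k] by (simp add: exp_minus field_simps)
  then have "((\<lambda>t::real. inverse t ^ k * exp (- inverse t)) \<longlongrightarrow> 0) (at_right 0)"
    by (rule filterlim_compose[OF _ filterlim_inverse_at_top_right])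
  then have "(flat k \<longlongrightarrow> 0) (at_right 0)"
    by (rule Lim_transform_eventually)
      (auto simp: flat_def eventually_at_filter inverse_eq_divide)
  moreover have "(flat k \<longlongrightarrow> 0) (at_left 0)"
    by (rule tendsto_eventually) (auto simp: flat_def eventually_at_filter)
  ultimately show ?thesis by (rule filterlim_split_at_real[rotated])
qed

lemma flat_deriv: "(flat k has_real_derivative flat (k + 2) t - real k * flat (k + 1) t) (at t)"
proof (cases t "0::real" rule: linorder_cases)
  case less
  have "((\<lambda>t. 0) has_real_derivative 0) (at t)" by simp
  then have "(flat k has_real_derivative 0) (at t)"
    by (rule has_field_derivative_transform_within_open[where S = "{..<0}"]) (use less in \<open>auto simp: flat_def\<close>)
  then show ?thesis using less by (simp add: flat_def)
next
  case equal
  \<comment> \<open>Off 0 itself, the difference quotient of \<open>flat k\<close> at 0 is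
    \<open>flat (k + 1)\<close>.\<close>
  have "((\<lambda>h. (flat k (0 + h) - flat k 0) / h) \<longlongrightarrow> 0) (at 0)"
    by (rule Lim_transform_eventually[OF flat_tendsto_0[of "k + 1"]])
      (auto simp: flat_def eventually_at_filter)
  then show ?thesis using equal by (simp add: DERIV_def flat_def)
next
  case greater
  have "((\<lambda>t. (1 / t) ^ k * exp (- (1 / t))) has_real_derivative flat (k + 2) t - real k * flat (k + 1) t) (at t)"
  proof -
    have du: "((\<lambda>t. 1 / t) has_real_derivative - ((1 / t) ^ 2)) (at t)"
      using greater by (auto intro!: derivative_eq_intros simp: field_simps power2_eq_square)
    have "((\<lambda>t. (1 / t) ^ k) has_real_derivative - (real k * (1 / t) ^ (k + 1))) (at t)"
    proof (cases k)
      case (Suc m)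
      then show ?thesis using DERIV_power[OF du, of k] by (simp add: power2_eq_square algebra_simps)
    qed simp
    moreover have "((\<lambda>t. exp (- (1 / t))) has_real_derivative exp (- (1 / t)) * (1 / t) ^ 2) (at t)"
      using DERIV_chain2[OF DERIV_exp DERIV_minus[OF du]] by simp
    ultimately have "((\<lambda>t. (1 / t) ^ k * exp (- (1 / t))) has_real_derivative
        - (real k * (1 / t) ^ (k + 1)) * exp (- (1 / t)) + (exp (- (1 / t)) * (1 / t) ^ 2) * (1 / t) ^ k) (at t)"
      by (rule DERIV_mult)
    then show ?thesis using greater by (simp add: flat_def power_add algebra_simps power2_eq_square)
  qed
  then show ?thesis
    by (rule has_field_derivative_transform_within_open[where S = "{0<..}"]) (use greater in \<open>auto simp: flat_def\<close>)
qed

lemma smooth_flat: "smooth (flat k)"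
  unfolding smooth_def
proof
  fix n show "ndiff n (flat k)"
  proof (induction n arbitrary: k)
    case (Suc n)
    have "ndiff n (\<lambda>t. flat (k + 2) t + (- real k) * flat (k + 1) t)"
      by (intro ndiff_add ndiff_mult ndiff_const Suc)
    then have "ndiff n (\<lambda>t. flat (k + 2) t - real k * flat (k + 1) t)" by simp
    then show ?case unfolding ndiff.simps(2)
      by (intro exI[of _ "\<lambda>t. flat (k + 2) t - real k * flat (k + 1) t"] conjI allI flat_deriv)
  qed simp
qed

definition test1 :: "(real \<Rightarrow> real) \<Rightarrow> bool" where
  "test1 \<psi> \<longleftrightarrow> smooth \<psi> \<and> (\<exists>\<delta>>0. \<forall>x. 1 - \<delta> \<le> \<bar>x\<bar> \<longrightarrow> \<psi> x = 0)"

text \<open>As \<open>flat 0 (j t)\<close> tends to 1 for \<open>t > 0\<close>, these converge to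
  the indicator of the open interval; growing \<open>j\<close> sharpens the edges without enlarging
  the support.\<close>

definition bump :: "real \<Rightarrow> real \<Rightarrow> nat \<Rightarrow> real \<Rightarrow> real" where
  "bump c d j x = flat 0 (real j * (x - c)) * flat 0 (real j * (d - x))"

lemma test1_bump:
  assumes "- 1 < c" "d < 1" shows "test1 (bump c d j)"
  unfolding test1_def
proof
  have "smooth (\<lambda>x. flat 0 (real j * x + - (real j * c)) * flat 0 (- real j * x + real j * d))"
    by (intro smooth_mult smooth_affine smooth_flat)
  then show "smooth (bump c d j)" by (simp add: bump_def[abs_def] algebra_simps)
  define \<delta> where "\<delta> = min (1 - d) (c + 1)"
  have "bump c d j x = 0" if "1 - \<delta> \<le> \<bar>x\<bar>" for x
  proof -
    have "x \<ge> d \<or> x \<le> c" using that by (auto simp: \<delta>_def abs_if min_def split: if_splits)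
    then show ?thesis by (auto simp: bump_def flat_def zero_less_mult_iff)
  qed
  moreover have "\<delta> > 0" using assms by (simp add: \<delta>_def)
  ultimately show "\<exists>\<delta>>0. \<forall>x. 1 - \<delta> \<le> \<bar>x\<bar> \<longrightarrow> bump c d j x = 0" by blast
qed

lemma flat_0_bounds: "0 \<le> flat 0 t" "flat 0 t \<le> 1"
  by (auto simp: flat_def)

lemma bump_bounds: "0 \<le> bump c d j x" "bump c d j x \<le> 1"
  unfolding bump_def by (auto intro!: mult_nonneg_nonneg mult_le_one flat_0_bounds)

lemma flat_0_limit: "(\<lambda>j. flat 0 (real j * t)) \<longlonglongrightarrow> (if t > 0 then 1 else 0)"
proof (cases "t > 0")
  case True
  have "(\<lambda>j. exp (- (inverse (real (Suc j)) * (1 / t)))) \<longlonglongrightarrow> exp (- (0 * (1 / t)))"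
    by (intro tendsto_intros LIMSEQ_inverse_real_of_nat)
  then have "(\<lambda>j. flat 0 (real (Suc j) * t)) \<longlonglongrightarrow> 1"
    using True by (simp add: flat_def divide_inverse mult.commute zero_less_mult_iff)
  then show ?thesis using True by (simp only: filterlim_sequentially_Suc[of "\<lambda>j. flat 0 (real j * t)"] if_True)
next
  case False
  then have "flat 0 (real j * t) = 0" for j by (auto simp: flat_def zero_less_mult_iff)
  then show ?thesis using False by simp
qed

lemma bump_limit: "(\<lambda>j. bump c d j x) \<longlonglongrightarrow> indicator {c<..<d} x"
proof -
  have "(\<lambda>j. bump c d j x) \<longlonglongrightarrow> (if x - c > 0 then 1 else 0) * (if d - x > 0 then 1 else 0)"
    unfolding bump_def by (intro tendsto_mult flat_0_limit)
  then show ?thesis by (simp add: indicator_def split: if_splits)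
qed

lemma integral_indicator_limit:
  fixes r :: "'a \<Rightarrow> complex"
  assumes r: "integrable M r" and u: "\<And>j. u j \<in> borel_measurable M"
    and B: "\<And>j x. x \<in> space M \<Longrightarrow> \<bar>u j x\<bar> \<le> 1"
    and lim: "\<And>x. x \<in> space M \<Longrightarrow> (\<lambda>j. u j x) \<longlonglongrightarrow> v x" and v: "v \<in> borel_measurable M"
    and z: "\<And>j. (\<integral>x. r x * of_real (u j x) \<partial>M) = 0"
  shows "(\<integral>x. r x * of_real (v x) \<partial>M) = 0"
proof -
  note [measurable] = borel_measurable_integrable[OF r] u v
  have "(\<lambda>j. \<integral>x. r x * of_real (u j x) \<partial>M) \<longlonglongrightarrow> (\<integral>x. r x * of_real (v x) \<partial>M)"
  proof (rule integral_dominated_convergence[where w = "\<lambda>x. norm (r x)"])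
    show "integrable M (\<lambda>x. norm (r x))" using r by simp
    show "AE x in M. (\<lambda>j. r x * of_real (u j x)) \<longlonglongrightarrow> r x * of_real (v x)"
      by (intro AE_I2 tendsto_intros lim)
    show "AE x in M. norm (r x * of_real (u j x)) \<le> norm (r x)" for j
      by (intro AE_I2) (simp add: norm_mult mult_left_le B)
  qed measurable
  then have "(\<lambda>j. 0) \<longlonglongrightarrow> (\<integral>x. r x * of_real (v x) \<partial>M)" by (simp only: z)
  from LIMSEQ_unique[OF this tendsto_const] show ?thesis .
qed

text \<open>Fundamental lemma of the calculus of variations: bumps reach interval indicators, a
  Dynkin argument reaches Borel sets, and a function with zero integral over all of these vanishes
  almost everywhere.\<close>

lemma zero_if_orthogonal_to_tests:
  fixes r :: "real \<Rightarrow> complex"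
  assumes r: "integrable IX r" and z: "\<And>\<psi>. test1 \<psi> \<Longrightarrow> (\<integral>x. r x * of_real (\<psi> x) \<partial>IX) = 0"
  shows "AE x in IX. r x = 0"
proof -
  note [measurable] = borel_measurable_integrable[OF r]
  have int1: "(\<integral>x. r x * of_real (indicator {c<..<d} x) \<partial>IX) = 0" if cd: "- 1 < c" "d < 1" for c d
  proof (rule integral_indicator_limit[OF r, where u = "bump c d"])
    show "bump c d j \<in> borel_measurable IX" for j
      using test1_bump[OF cd, of j] by (intro continuous_measurable_MI smooth_continuous) (simp add: test1_def)
    show "(\<integral>x. r x * of_real (bump c d j x) \<partial>IX) = 0" for j by (rule z[OF test1_bump[OF cd]])
  qed (auto simp: bump_bounds bump_limit)
  have int2: "(\<integral>x. r x * of_real (indicator {c<..<d} x) \<partial>IX) = 0" for c d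
  proof -
    have "(\<integral>x. r x * of_real (indicator {max (-1) c<..<min 1 d} x) \<partial>IX) = 0"
    proof (rule integral_indicator_limit[OF r])
      let ?u = "\<lambda>j x. indicator {max (-1) c + inverse (real (Suc j))<..<min 1 d - inverse (real (Suc j))} x :: real"
      show "?u j \<in> borel_measurable IX" for j by (rule borel_measurable_MI) simp
      have "- 1 < max (-1) c + inverse (real (Suc j))" "min 1 d - inverse (real (Suc j)) < 1" for j
      proof -
        have "inverse (real (Suc j)) > 0" by simp
        then show "- 1 < max (-1) c + inverse (real (Suc j))" "min 1 d - inverse (real (Suc j)) < 1"
          using max.cobounded1[of "-1" c] min.cobounded1[of 1 d] by linarith+
      qed
      then show "(\<integral>x. r x * of_real (?u j x) \<partial>IX) = 0" for j by (rule int1)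
      fix x
      show "(\<lambda>j. ?u j x) \<longlonglongrightarrow> indicator {max (-1) c<..<min 1 d} x"
      proof (cases "max (-1) c < x \<and> x < min 1 d")
        case True
        have l: "(\<lambda>j. max (-1) c + inverse (real (Suc j))) \<longlonglongrightarrow> max (-1) c + 0" "(\<lambda>j. min 1 d - inverse (real (Suc j))) \<longlonglongrightarrow> min 1 d - 0"
          by (intro tendsto_intros LIMSEQ_inverse_real_of_nat)+
        have "\<forall>\<^sub>F j in sequentially. max (-1) c + inverse (real (Suc j)) < x"
          using True by (intro order_tendstoD(2)[OF l(1)]) simp
        moreover have "\<forall>\<^sub>F j in sequentially. x < min 1 d - inverse (real (Suc j))"
          using True by (intro order_tendstoD(1)[OF l(2)]) simp
        ultimately have "\<forall>\<^sub>F j in sequentially. ?u j x = indicator {max (-1) c<..<min 1 d} x"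
          by eventually_elim (use True in \<open>auto simp: indicator_def\<close>)
        then show ?thesis by (rule tendsto_eventually)
      next
        case False
        have p: "inverse (real (Suc j)) > 0" for j by simp
        have "x \<notin> {max (-1) c + inverse (real (Suc j))<..<min 1 d - inverse (real (Suc j))}" for j
          using False p[of j] unfolding greaterThanLessThan_iff by argo
        then have "?u j x = 0" for j by (rule indicator_simps(2))
        then have l: "(\<lambda>j. ?u j x) = (\<lambda>j. 0)" by (rule ext)
        have r: "indicator {max (-1) c<..<min 1 d} x = (0::real)"
          using False by (intro indicator_simps(2)) (simp only: greaterThanLessThan_iff not_False_eq_True)
        show ?thesis unfolding l r by (rule tendsto_const)
      qed
    qed (auto simp: indicator_def)
    also have "(\<integral>x. r x * of_real (indicator {max (-1) c<..<min 1 d} x) \<partial>IX) = (\<integral>x. r x * of_real (indicator {c<..<d} x) \<partial>IX)"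
    proof (rule integral_cong_AE)
      have ne: "AE y in IX. y \<noteq> - 1" "AE y in IX. y \<noteq> 1" by (rule AE_MI_neq)+
      have sp: "AE y in IX. y \<in> {-1..1}" using AE_space[of IX] by simp
      show "AE x in IX. r x * of_real (indicator {max (-1) c<..<min 1 d} x) = r x * of_real (indicator {c<..<d} x)"
        using ne sp by eventually_elim (auto simp: indicator_def)
    qed measurable
    finally show ?thesis .
  qed
  have all: "(\<integral>x. r x * of_real (indicator A x) \<partial>IX) = 0" if A: "A \<in> sets borel" for A
  proof -
    note Int_stable_intervals
    moreover have "range (\<lambda>(a, b). {a<..<b :: real}) \<subseteq> Pow UNIV" by simp
    moreover have "A \<in> sigma_sets UNIV (range (\<lambda>(a, b). {a<..<b :: real}))" using A by (simp only: sets_borel_intervals)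
    ultimately show ?thesis
    proof (induction A rule: sigma_sets_induct_disjoint)
      case (basic A)
      then show ?case using int2 by auto
    next
      case (compl A)
      have A: "A \<in> sets borel" using compl by (simp only: sets_borel_intervals)
      \<comment> \<open>\<open>{-2<..<2}\<close> covers the whole space, so the constant 1 is an
        interval indicator there; complements follow by subtraction.\<close>
      have "(\<integral>x. r x \<partial>IX) = (\<integral>x. r x * of_real (indicator {-2<..<2} x) \<partial>IX)"
        by (intro Bochner_Integration.integral_cong) auto
      then have "(\<integral>x. r x \<partial>IX) = 0" using int2 by simp
      moreover have "(\<integral>x. r x * of_real (indicator (UNIV - A) x) \<partial>IX) = (\<integral>x. r x - r x * of_real (indicator A x) \<partial>IX)"
        by (intro Bochner_Integration.integral_cong) (auto simp: indicator_def)
      moreover have "integrable IX (\<lambda>x. r x * of_real (indicator A x))"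
        using A by (intro Bochner_Integration.integrable_bound[OF r] AE_I2) (auto simp: norm_mult indicator_def)
      ultimately show ?case using r compl by simp
    next
      case (union A)
      have A: "A i \<in> sets borel" for i using union(2) unfolding sets_borel_intervals by auto
      show ?case
      proof (rule integral_indicator_limit[OF r])
        show "(\<lambda>j. indicator (\<Union>i<j. A i) x :: real) \<longlonglongrightarrow> indicator (\<Union>i. A i) x" for x
          by (rule LIMSEQ_indicator_UN)
        show "(\<integral>x. r x * of_real (indicator (\<Union>i<j. A i) x) \<partial>IX) = 0" for j
        proof -
          have "disjoint_family_on A {..<j}" using union(1) by (auto simp: disjoint_family_on_def)
          then have "(indicator (\<Union>i<j. A i) x :: real) = (\<Sum>i<j. indicator (A i) x)" for x
            using indicator_UN_disjoint[of "{..<j}" A x] by simp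
          then have "(\<integral>x. r x * of_real (indicator (\<Union>i<j. A i) x) \<partial>IX) = (\<integral>x. (\<Sum>i<j. r x * of_real (indicator (A i) x)) \<partial>IX)"
            by (simp add: sum_distrib_left)
          also have "\<dots> = (\<Sum>i<j. \<integral>x. r x * of_real (indicator (A i) x) \<partial>IX)"
            using A by (intro Bochner_Integration.integral_sum Bochner_Integration.integrable_bound[OF r] AE_I2)
              (auto simp: norm_mult indicator_def)
          also have "\<dots> = 0" using union(3) by simp
          finally show ?thesis .
        qed
        show "(\<lambda>x. indicator (\<Union>i<j. A i) x :: real) \<in> borel_measurable IX" for j
          using A by (intro borel_measurable_MI borel_measurable_indicator) auto
        show "(indicator (\<Union>i. A i) :: real \<Rightarrow> real) \<in> borel_measurable IX"
          using A by (intro borel_measurable_MI borel_measurable_indicator) auto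
      qed (auto simp: indicator_def)
    qed auto
  qed
  show ?thesis
  proof (rule MI.density_zero[OF r])
    fix A assume "A \<in> sets IX"
    then obtain B where B: "B \<in> sets borel" "A = {-1..1} \<inter> B" unfolding sets_MI sets_restrict_space by auto
    have "set_lebesgue_integral IX A r = (\<integral>x. r x * of_real (indicator B x) \<partial>IX)"
      unfolding set_lebesgue_integral_def
      by (intro Bochner_Integration.integral_cong refl) (auto simp: B indicator_def)
    then show "set_lebesgue_integral IX A r = 0" using all B by simp
  qed
qed

lemma test1_D:
  assumes "test1 \<psi>"
  shows "smooth \<psi>" "continuous_on A \<psi>" "(\<psi> has_real_derivative deriv \<psi> x) (at x)"
    "\<bar>x\<bar> \<ge> 1 \<Longrightarrow> \<psi> x = 0"
  using assms by (auto simp: test1_def intro: smooth_continuous smooth_deriv)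

lemma test1_deriv: assumes "test1 \<psi>" shows "test1 (deriv \<psi>)"
proof -
  obtain \<delta> where \<delta>: "\<delta> > 0" "\<And>x. 1 - \<delta> \<le> \<bar>x\<bar> \<Longrightarrow> \<psi> x = 0" using assms by (auto simp: test1_def)
  \<comment> \<open>Half the margin leaves an open neighbourhood on which \<open>\<psi>\<close> is
    zero, so the derivative is zero too.\<close>
  have "deriv \<psi> x = 0" if "1 - \<delta> / 2 \<le> \<bar>x\<bar>" for x
  proof -
    have "((\<lambda>x. 0) has_real_derivative 0) (at x)" by simp
    then have "(\<psi> has_real_derivative 0) (at x)"
    proof (rule has_field_derivative_transform_within_open[where S = "{y. 1 - \<delta> < \<bar>y\<bar>}"])
      show "open {y::real. 1 - \<delta> < \<bar>y\<bar>}" by (intro open_Collect_less continuous_intros)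
    qed (use \<delta> that in auto)
    then show ?thesis by (rule DERIV_imp_deriv)
  qed
  then show ?thesis using assms \<delta>(1) unfolding test1_def
    by (auto intro!: smooth_deriv exI[of _ "\<delta> / 2"])
qed

lemma test1_add: assumes "test1 f" "test1 g" shows "test1 (\<lambda>x. f x + g x)"
proof -
  obtain d where d: "d > 0" "\<And>x. 1 - d \<le> \<bar>x\<bar> \<Longrightarrow> f x = 0" using assms(1) by (auto simp: test1_def)
  obtain e where e: "e > 0" "\<And>x. 1 - e \<le> \<bar>x\<bar> \<Longrightarrow> g x = 0" using assms(2) by (auto simp: test1_def)
  have "\<forall>x. 1 - min d e \<le> \<bar>x\<bar> \<longrightarrow> f x + g x = 0" using d e by (auto simp: min_def)
  then show ?thesis using assms d e unfolding test1_def
    by (auto intro!: smooth_add exI[of _ "min d e"])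
qed

lemma test1_cmult: "test1 f \<Longrightarrow> test1 (\<lambda>x. c * f x)"
  unfolding test1_def by (auto intro!: smooth_mult smooth_const)

lemma AC_test1: "test1 \<psi> \<Longrightarrow> AC (\<lambda>x. of_real (\<psi> x)) (\<lambda>x. of_real (deriv \<psi> x))"
  by (intro AC_of_real test1_D) (auto intro: test1_D test1_deriv)

section \<open>Primitives and the du Bois-Reymond lemmas\<close>

definition J :: "(real \<Rightarrow> complex) \<Rightarrow> real \<Rightarrow> complex" where
  "J f x = integral\<^sup>L (MI (-1) x) f"

lemma AC_J: "integrable IX f \<Longrightarrow> AC (J f) f"
  using AC_integral[of f 0] by (simp add: J_def[abs_def])

lemma J_neg1 [simp]: "J f (-1) = 0" by (simp add: J_def)

lemma integrable_J: "integrable IX f \<Longrightarrow> integrable IX (J f)"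
  by (rule integrable_continuous_MI[OF AC_continuous[OF AC_J]])

lemma integral_mult_test1_deriv:
  assumes F: "AC F f" and \<psi>: "test1 \<psi>"
  shows "(\<integral>x. F x * of_real (deriv \<psi> x) \<partial>IX) = - (\<integral>x. f x * of_real (\<psi> x) \<partial>IX)"
proof -
  note ac = AC_mult[OF F AC_test1[OF \<psi>]]
  have i1: "integrable IX (\<lambda>x. f x * of_real (\<psi> x))"
    using integrable_continuous_mult_MI[OF _ AC_D(1)[OF F], of "\<lambda>x. of_real (\<psi> x)"] test1_D(2)[OF \<psi>]
    by (simp add: mult.commute continuous_intros)
  have i2: "integrable IX (\<lambda>x. F x * of_real (deriv \<psi> x))"
    using AC_continuous[OF F] test1_D(2)[OF test1_deriv[OF \<psi>]] by (intro integrable_continuous_MI continuous_intros)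
  have "(\<integral>x. f x * of_real (\<psi> x) \<partial>IX) + (\<integral>x. F x * of_real (deriv \<psi> x) \<partial>IX) = 0"
    using AC_boundary[OF ac] i1 i2 test1_D(4)[OF \<psi>] by simp
  then show ?thesis by (simp add: add_eq_0_iff)
qed

text \<open>The primitive from -1 vanishes near -1 by the support of \<open>\<psi>\<close>, and near
  1 because the mean is zero.\<close>

lemma test1_antideriv:
  assumes \<psi>: "test1 \<psi>" and zero: "(\<integral>x. \<psi> x \<partial>IX) = 0"
  obtains \<Psi> where "test1 \<Psi>" "deriv \<Psi> = \<psi>"
proof -
  obtain \<delta>0 where \<delta>0: "\<delta>0 > 0" "\<And>x. 1 - \<delta>0 \<le> \<bar>x\<bar> \<Longrightarrow> \<psi> x = 0" using \<psi> by (auto simp: test1_def)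
  define \<delta> where "\<delta> = min \<delta>0 1"
  have \<delta>: "\<delta> > 0" "\<delta> \<le> 1" "\<And>x. 1 - \<delta> \<le> \<bar>x\<bar> \<Longrightarrow> \<psi> x = 0" using \<delta>0 by (auto simp: \<delta>_def)
  note c = test1_D(2)[OF \<psi>]
  define \<Psi> where "\<Psi> x = integral {-1..x} \<psi>" for x
  have left: "\<Psi> x = 0" if "x \<le> - 1 + \<delta>" for x
  proof -
    have "integral {-1..x} \<psi> = integral {-1..x} (\<lambda>x. 0)"
      using that \<delta> by (intro integral_cong \<delta>(3)) auto
    then show ?thesis by (simp add: \<Psi>_def)
  qed
  have d: "(\<Psi> has_real_derivative \<psi> x) (at x)" for x
  proof (cases "x < - 1 + \<delta>")
    case True
    have "((\<lambda>x. 0) has_real_derivative 0) (at x)" by simp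
    then have "(\<Psi> has_real_derivative 0) (at x)"
      by (rule has_field_derivative_transform_within_open[where S = "{..<- 1 + \<delta>}"]) (use left True in auto)
    moreover have "\<psi> x = 0" using True \<delta> by (intro \<delta>(3)) auto
    ultimately show ?thesis by simp
  next
    case False
    then have x: "x \<in> {-1<..<x + 1}" using \<delta> by auto
    have "(\<Psi> has_real_derivative \<psi> x) (at x within {-1..x + 1})"
      unfolding \<Psi>_def using x by (intro integral_has_real_derivative c) auto
    then show ?thesis using x at_within_interior[of x "{-1..x + 1}"] by (simp add: interior_atLeastAtMost_real)
  qed
  have "integral {-1..1} \<psi> = 0"
    using zero integral_MI_HK(1)[OF integrable_continuous_MI[OF c]] by metis
  then have one: "\<Psi> 1 = 0" by (simp add: \<Psi>_def)
  have right: "\<Psi> x = 0" if x: "1 - \<delta> \<le> x" for x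
  proof -
    have i: "\<psi> integrable_on {-1..b}" for b by (intro integrable_continuous_interval c)
    show ?thesis
    proof (cases "x \<le> 1")
      case True
      have "integral {-1..x} \<psi> + integral {x..1} \<psi> = integral {-1..1} \<psi>"
        using True x \<delta> by (intro Henstock_Kurzweil_Integration.integral_combine i) auto
      moreover have "integral {x..1} \<psi> = integral {x..1} (\<lambda>x. 0)"
        using x by (intro integral_cong \<delta>(3)) auto
      ultimately show ?thesis using one by (simp add: \<Psi>_def)
    next
      case False
      have "integral {-1..1} \<psi> + integral {1..x} \<psi> = integral {-1..x} \<psi>"
        using False by (intro Henstock_Kurzweil_Integration.integral_combine i) auto
      moreover have "integral {1..x} \<psi> = integral {1..x} (\<lambda>x. 0)"
        using x \<delta> by (intro integral_cong \<delta>(3)) auto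
      ultimately show ?thesis using one by (simp add: \<Psi>_def)
    qed
  qed
  have "smooth \<Psi>" by (rule smooth_antideriv[OF d]) (rule test1_D(1)[OF \<psi>])
  moreover have "\<Psi> x = 0" if "1 - \<delta> \<le> \<bar>x\<bar>" for x
    using left[of x] right[of x] that by (cases "x \<ge> 0") auto
  ultimately have "test1 \<Psi>" unfolding test1_def using \<delta>(1) by blast
  moreover have "deriv \<Psi> = \<psi>" using d by (auto intro: DERIV_imp_deriv)
  ultimately show ?thesis by (rule that)
qed

lemma normalized_test1: obtains b where "test1 b" "(\<integral>x. b x \<partial>IX) = 1"
proof -
  define b where "b = bump (- 1 / 2) (1 / 2) 1"
  have t: "test1 b" unfolding b_def by (rule test1_bump) auto
  have c: "continuous_on {-1..1} b" by (rule test1_D(2)[OF t])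
  have "integral {-1..1} b \<noteq> 0"
  proof
    assume "integral {-1..1} b = 0"
    then have "\<forall>x\<in>{-1..1}. b x = 0"
      using integral_eq_0_iff[OF c] by (simp add: b_def bump_bounds)
    then have "b 0 = 0" by simp
    then show False by (simp add: b_def bump_def flat_def)
  qed
  then have m: "(\<integral>x. b x \<partial>IX) \<noteq> 0" using integral_MI_HK(1)[OF integrable_continuous_MI[OF c]] by simp
  define m where "m = (\<integral>x. b x \<partial>IX)"
  have "(\<integral>x. (1 / m) * b x \<partial>IX) = 1" using m by (simp add: m_def)
  then show ?thesis using that[OF test1_cmult[OF t, of "1 / m"]] by simp
qed

lemma integrable_mult_test1:
  assumes "integrable IX q" "test1 \<psi>" shows "integrable IX (\<lambda>x. q x * complex_of_real (\<psi> x))"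
  using integrable_continuous_mult_MI[OF _ assms(1), of "\<lambda>x. of_real (\<psi> x)"] test1_D(2)[OF assms(2)]
  by (simp add: mult.commute continuous_intros)

lemma integral_test1_of_real: "(\<integral>x. complex_of_real (\<psi> x) \<partial>IX) = of_real (\<integral>x. \<psi> x \<partial>IX)"
  by (rule integral_complex_of_real)

text \<open>A test function minus its mean times a fixed normalised \<open>b\<close> has mean zero,
  so \<open>q\<close> acts on every test function like the constant \<open>c\<close>, its pairing
  with \<open>b\<close>.\<close>

lemma du_bois_reymond_1:
  fixes q :: "real \<Rightarrow> complex"
  assumes q: "integrable IX q"
    and z: "\<And>\<psi>. test1 \<psi> \<Longrightarrow> (\<integral>x. \<psi> x \<partial>IX) = 0 \<Longrightarrow> (\<integral>x. q x * of_real (\<psi> x) \<partial>IX) = 0"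
  obtains c where "AE x in IX. q x = c"
proof -
  obtain b where b: "test1 b" "(\<integral>x. b x \<partial>IX) = 1" by (rule normalized_test1)
  define c where "c = (\<integral>x. q x * of_real (b x) \<partial>IX)"
  have "AE x in IX. q x - c = 0"
  proof (rule zero_if_orthogonal_to_tests)
    show "integrable IX (\<lambda>x. q x - c)" using q by (simp add: MI.integrable_const)
    fix \<psi> assume \<psi>: "test1 \<psi>"
    define m where "m = (\<integral>x. \<psi> x \<partial>IX)"
    have t: "test1 (\<lambda>x. \<psi> x + (- m) * b x)" by (intro test1_add test1_cmult \<psi> b)
    have i: "integrable IX \<psi>" "integrable IX b"
      by (intro integrable_continuous_MI test1_D(2) \<psi> b)+
    have iq: "integrable IX (\<lambda>x. q x * of_real (\<psi> x))" "integrable IX (\<lambda>x. q x * of_real (b x))"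
      "integrable IX (\<lambda>x. c * of_real (\<psi> x))"
      using i by (auto intro: integrable_mult_test1 q \<psi> b)
    have "(\<integral>x. \<psi> x + (- m) * b x \<partial>IX) = 0" using i b by (simp add: m_def)
    from z[OF t this] have "(\<integral>x. q x * of_real (\<psi> x) + (- of_real m) * (q x * of_real (b x)) \<partial>IX) = 0"
      by (simp add: algebra_simps)
    then have "(\<integral>x. q x * of_real (\<psi> x) \<partial>IX) = of_real m * c" using iq by (simp add: c_def)
    moreover have "(\<integral>x. c * of_real (\<psi> x) \<partial>IX) = c * of_real m"
      by (simp add: m_def integral_test1_of_real)
    moreover have "(\<integral>x. (q x - c) * of_real (\<psi> x) \<partial>IX) = (\<integral>x. q x * of_real (\<psi> x) \<partial>IX) - (\<integral>x. c * of_real (\<psi> x) \<partial>IX)"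
      using iq by (simp add: left_diff_distrib)
    ultimately show "(\<integral>x. (q x - c) * of_real (\<psi> x) \<partial>IX) = 0" by (simp only: mult.commute diff_self)
  qed
  then show ?thesis using that[of c] by simp
qed

lemma AC_ident: "AC (\<lambda>x. of_real x) (\<lambda>x. 1)"
  using AC_of_real[of "\<lambda>x. x" "\<lambda>x. 1"] by simp

text \<open>Reduction to the first-order case for \<open>q - d x\<close>. A mean-zero
  \<open>\<psi>\<close> is the derivative of some \<open>\<Psi>\<close>, and \<open>\<Psi>\<close>
  corrected by a multiple of \<open>b\<close> is a derivative again. The slope \<open>d\<close> is
  chosen so that the leftover pairing of \<open>q\<close> with the derivative of \<open>b\<close>
  cancels against that of \<open>d x\<close>.\<close>

lemma du_bois_reymond_2:
  fixes q :: "real \<Rightarrow> complex"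
  assumes q: "integrable IX q"
    and z: "\<And>\<psi>. test1 \<psi> \<Longrightarrow> (\<integral>x. q x * of_real (deriv (deriv \<psi>) x) \<partial>IX) = 0"
  obtains c d where "AE x in IX. q x = c + d * of_real x"
proof -
  obtain b where b: "test1 b" "(\<integral>x. b x \<partial>IX) = 1" by (rule normalized_test1)
  define d where "d = - (\<integral>x. q x * of_real (deriv b x) \<partial>IX)"
  have cont: "integrable IX (\<lambda>x. d * complex_of_real x)" by (intro integrable_continuous_MI continuous_intros)
  obtain c where c: "AE x in IX. q x - d * of_real x = c"
  proof (rule du_bois_reymond_1)
    show "integrable IX (\<lambda>x. q x - d * of_real x)" using q cont by simp
    fix \<psi> assume \<psi>: "test1 \<psi>" "(\<integral>x. \<psi> x \<partial>IX) = 0"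
    obtain \<Psi> where \<Psi>: "test1 \<Psi>" "deriv \<Psi> = \<psi>" using test1_antideriv[OF \<psi>] .
    define m where "m = (\<integral>x. \<Psi> x \<partial>IX)"
    have i: "integrable IX \<Psi>" "integrable IX b"
      by (intro integrable_continuous_MI test1_D(2) \<Psi> b)+
    have t: "test1 (\<lambda>x. \<Psi> x + (- m) * b x)" by (intro test1_add test1_cmult \<Psi> b)
    have "(\<integral>x. \<Psi> x + (- m) * b x \<partial>IX) = 0" using i b by (simp add: m_def)
    from test1_antideriv[OF t this] obtain \<Phi> where \<Phi>: "test1 \<Phi>" "deriv \<Phi> = (\<lambda>x. \<Psi> x + (- m) * b x)" .
    have "deriv (deriv \<Phi>) x = \<psi> x + (- m) * deriv b x" for x
      unfolding \<Phi>(2) \<Psi>(2)[symmetric]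
      by (intro DERIV_imp_deriv DERIV_add DERIV_cmult test1_D(3) \<Psi> b)
    then have "(\<integral>x. q x * of_real (\<psi> x + (- m) * deriv b x) \<partial>IX) = 0" using z[OF \<Phi>(1)] by simp
    then have "(\<integral>x. q x * of_real (\<psi> x) + (- of_real m) * (q x * of_real (deriv b x)) \<partial>IX) = 0"
      by (simp add: algebra_simps)
    moreover have iq: "integrable IX (\<lambda>x. q x * of_real (\<psi> x))" "integrable IX (\<lambda>x. q x * of_real (deriv b x))"
      by (intro integrable_mult_test1 q \<psi> test1_deriv b)+
    ultimately have e1: "(\<integral>x. q x * of_real (\<psi> x) \<partial>IX) = - (of_real m * d)" by (simp add: d_def)
    have "(\<integral>x. of_real x * of_real (deriv \<Psi> x) \<partial>IX) = - (\<integral>x. 1 * complex_of_real (\<Psi> x) \<partial>IX)"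
      by (rule integral_mult_test1_deriv[OF AC_ident \<Psi>(1)])
    then have e2: "(\<integral>x. of_real x * complex_of_real (\<psi> x) \<partial>IX) = - of_real m"
      by (simp add: \<Psi> m_def integral_test1_of_real)
    have "(\<integral>x. (q x - d * of_real x) * of_real (\<psi> x) \<partial>IX)
        = (\<integral>x. q x * of_real (\<psi> x) \<partial>IX) - (\<integral>x. d * (of_real x * of_real (\<psi> x)) \<partial>IX)"
      using iq integrable_mult_test1[OF cont \<psi>(1)] by (simp add: left_diff_distrib mult.assoc)
    then show "(\<integral>x. (q x - d * of_real x) * of_real (\<psi> x) \<partial>IX) = 0" using e1 e2 by simp
  qed
  have "AE x in IX. q x = c + d * of_real x" using c by eventually_elim (simp add: algebra_simps)
  then show ?thesis by (rule that)
qed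

text \<open>\<open>J (J f)\<close> has weak second derivative \<open>f\<close>, so the difference is
  affine. This gives a continuous representative, for which boundary values make sense.\<close>

lemma weak_second_derivative:
  fixes u f :: "real \<Rightarrow> complex"
  assumes u: "integrable IX u" and f: "integrable IX f"
    and w: "\<And>\<psi>. test1 \<psi> \<Longrightarrow> (\<integral>x. u x * of_real (deriv (deriv \<psi>) x) \<partial>IX) = (\<integral>x. f x * of_real (\<psi> x) \<partial>IX)"
  obtains c d where "AE x in IX. u x = c + d * of_real x + J (J f) x"
proof -
  obtain c d where cd: "AE x in IX. u x - J (J f) x = c + d * of_real x"
  proof (rule du_bois_reymond_2)
    have iJ: "integrable IX (J (J f))" by (intro integrable_J f)
    show "integrable IX (\<lambda>x. u x - J (J f) x)" using u iJ by simp
    fix \<psi> assume \<psi>: "test1 \<psi>"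
    have "(\<integral>x. J (J f) x * of_real (deriv (deriv \<psi>) x) \<partial>IX) = (\<integral>x. f x * of_real (\<psi> x) \<partial>IX)"
      using integral_mult_test1_deriv[OF AC_J[OF integrable_J[OF f]] test1_deriv[OF \<psi>]]
        integral_mult_test1_deriv[OF AC_J[OF f] \<psi>] by simp
    moreover have "integrable IX (\<lambda>x. u x * of_real (deriv (deriv \<psi>) x))" "integrable IX (\<lambda>x. J (J f) x * of_real (deriv (deriv \<psi>) x))"
      by (intro integrable_mult_test1 u iJ test1_deriv \<psi>)+
    ultimately show "(\<integral>x. (u x - J (J f) x) * of_real (deriv (deriv \<psi>) x) \<partial>IX) = 0"
      using w[OF \<psi>] by (simp add: left_diff_distrib)
  qed
  have "AE x in IX. u x = c + d * of_real x + J (J f) x" using cd by eventually_elim (simp add: algebra_simps)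
  then show ?thesis by (rule that)
qed

section \<open>Fourier modes of the domain of the operator\<close>

lemma ndiff_trig: "ndiff n (\<lambda>x. c * cos x + d * sin x)"
proof (induction n arbitrary: c d)
  case (Suc n)
  have "((\<lambda>x. c * cos x + d * sin x) has_real_derivative d * cos x + (- c) * sin x) (at x)" for x
    by (auto intro!: derivative_eq_intros)
  then show ?case unfolding ndiff.simps(2)
    by (intro exI[of _ "\<lambda>x. d * cos x + (- c) * sin x"] conjI allI Suc)
qed simp

lemma smooth_cos: "smooth (\<lambda>y. cos (a * y))" and smooth_sin: "smooth (\<lambda>y. sin (a * y))"
  using smooth_affine[of cos a 0] smooth_affine[of sin a 0] ndiff_trig[of _ 1 0] ndiff_trig[of _ 0 1]
  by (simp_all add: smooth_def)

lemma px_tensor: "smooth s \<Longrightarrow> px (\<lambda>(x, y). s x * t y) = (\<lambda>(x, y). deriv s x * t y)"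
  by (auto simp: px_def fun_eq_iff intro!: DERIV_imp_deriv derivative_eq_intros smooth_deriv(1))

lemma py_tensor: "smooth t \<Longrightarrow> py (\<lambda>(x, y). s x * t y) = (\<lambda>(x, y). s x * deriv t y)"
  by (auto simp: py_def fun_eq_iff intro!: DERIV_imp_deriv derivative_eq_intros smooth_deriv(1))

text \<open>Partial derivatives keep tensor products in tensor form, which reduces the smoothness
  demanded by \<open>test_fun\<close> to one variable at a time.\<close>

lemma iter_pd_tensor:
  assumes "smooth s" "smooth t"
  shows "\<exists>s' t'. smooth s' \<and> smooth t' \<and> iter_pd ds (\<lambda>(x, y). s x * t y) = (\<lambda>(x, y). s' x * t' y)"
proof (induction ds)
  case Nil
  then show ?case using assms by auto
next
  case (Cons b ds)
  then obtain s' t' where "smooth s'" "smooth t'" "iter_pd ds (\<lambda>(x, y). s x * t y) = (\<lambda>(x, y). s' x * t' y)" by blast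
  then show ?case
    by (cases b) (auto simp: px_tensor py_tensor intro: smooth_deriv)
qed

lemma tensor_differentiable:
  assumes "smooth s" "smooth t"
  shows "(\<lambda>(x, y). s x * t y) differentiable (at p)"
proof -
  have s: "(s has_derivative (\<lambda>h. deriv s x * h)) (at x)" and t: "(t has_derivative (\<lambda>h. deriv t x * h)) (at x)" for x
    using smooth_deriv(1)[OF assms(1), of x] smooth_deriv(1)[OF assms(2), of x] by (simp_all add: has_field_derivative_def)
  have "((\<lambda>p. s (fst p)) has_derivative (\<lambda>h. deriv s (fst p) * fst h)) (at p)"
    by (rule has_derivative_compose[OF _ s]) (auto intro!: derivative_intros)
  moreover have "((\<lambda>p. t (snd p)) has_derivative (\<lambda>h. deriv t (snd p) * snd h)) (at p)"
    by (rule has_derivative_compose[OF _ t]) (auto intro!: derivative_intros)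
  ultimately have "(\<lambda>p. s (fst p) * t (snd p)) differentiable (at p)"
    by (intro differentiable_mult) (auto simp: differentiable_def)
  then show ?thesis by (simp add: case_prod_beta')
qed

lemma test_fun_tensor:
  assumes "test1 s" "smooth t" "\<And>y. t (y + 2 * pi) = t y"
  shows "test_fun (\<lambda>(x, y). s x * t y)"
  unfolding test_fun_def
proof (intro conjI allI)
  have s: "smooth s" using assms(1) by (rule test1_D)
  fix ds p
  obtain s' t' where "smooth s'" "smooth t'" "iter_pd ds (\<lambda>(x, y). s x * t y) = (\<lambda>(x, y). s' x * t' y)"
    using iter_pd_tensor[OF s assms(2)] by blast
  then show "iter_pd ds (\<lambda>(x, y). s x * t y) differentiable (at p)"
    using tensor_differentiable by simp
next
  show "\<exists>\<delta>>0. \<forall>x y. 1 - \<delta> \<le> \<bar>x\<bar> \<longrightarrow> (case (x, y) of (x, y) \<Rightarrow> s x * t y) = 0"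
    using assms(1) unfolding test1_def by auto
qed (use assms(3) in simp)

lemma cos_periodic_int: "cos (of_int n * (y + 2 * pi)) = cos (of_int n * y)"
  and sin_periodic_int: "sin (of_int n * (y + 2 * pi)) = sin (of_int n * y)"
proof -
  have "of_int n * (y + 2 * pi) = of_int n * y + of_int n * (2 * pi)" by (simp add: algebra_simps)
  moreover have "cos (of_int n * (2 * pi)) = 1" "sin (of_int n * (2 * pi)) = 0"
    using cos_int_2pin[of n] sin_int_2pin[of n] by (simp_all add: mult_ac)
  ultimately show "cos (of_int n * (y + 2 * pi)) = cos (of_int n * y)" "sin (of_int n * (y + 2 * pi)) = sin (of_int n * y)"
    by (simp_all only: cos_add sin_add mult_1_right mult_zero_right diff_zero add_0_right)
qed

lemma deriv2_cos: "deriv (deriv (\<lambda>y. cos (a * y))) y = - a\<^sup>2 * cos (a * y)"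
proof -
  have 1: "deriv (\<lambda>y. cos (a * y)) = (\<lambda>y. - a * sin (a * y))"
    by (auto intro!: ext DERIV_imp_deriv derivative_eq_intros)
  show ?thesis unfolding 1 by (auto intro!: DERIV_imp_deriv derivative_eq_intros simp: power2_eq_square)
qed

lemma deriv2_sin: "deriv (deriv (\<lambda>y. sin (a * y))) y = - a\<^sup>2 * sin (a * y)"
proof -
  have 1: "deriv (\<lambda>y. sin (a * y)) = (\<lambda>y. a * cos (a * y))"
    by (auto intro!: ext DERIV_imp_deriv derivative_eq_intros)
  show ?thesis unfolding 1 by (auto intro!: DERIV_imp_deriv derivative_eq_intros simp: power2_eq_square)
qed

section \<open>Transfer from Lebesgue measure on the cylinder to a product measure\<close>

text \<open>Differs from \<open>Mset\<close> by a null set; it is the space underlying the product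
  of the two closed intervals.\<close>

definition Box :: "(real \<times> real) set" where "Box = {-1..1} \<times> {0..2*pi}"
abbreviation "PM \<equiv> IX \<Otimes>\<^sub>M IY"

lemma Box_borel [measurable]: "Box \<in> sets borel" and Mset_borel [measurable]: "Mset \<in> sets borel"
  unfolding Box_def Mset_def by (auto simp: borel_prod[symmetric])

lemma Mset_subset_Box: "Mset \<subseteq> Box" by (auto simp: Mset_def Box_def)

lemma space_PM: "space PM = Box" by (simp add: space_pair_measure Box_def)

lemma PM_eq: "PM = restrict_space lborel Box"
proof (rule pair_measure_eqI)
  show "sigma_finite_measure IX" "sigma_finite_measure IY" by unfold_locales
  show "sets PM = sets (restrict_space lborel Box)"
  proof
    show "sets PM \<subseteq> sets (restrict_space lborel Box)"
      unfolding sets_pair_measure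
    proof (rule sets.sigma_sets_subset')
      show "{a \<times> b |a b. a \<in> sets IX \<and> b \<in> sets IY} \<subseteq> sets (restrict_space lborel Box)"
      proof clarify
        fix A B assume "A \<in> sets IX" "B \<in> sets IY"
        then have AB: "A \<in> sets borel" "A \<subseteq> {-1..1}" "B \<in> sets borel" "B \<subseteq> {0..2*pi}"
          by (auto simp: sets_MI sets_restrict_space)
        then have "A \<times> B \<in> sets (borel \<Otimes>\<^sub>M borel)" by (intro pair_measureI) auto
        then have "A \<times> B \<in> sets borel" by (simp only: borel_prod)
        then show "A \<times> B \<in> sets (restrict_space lborel Box)"
          using AB by (auto simp: sets_restrict_space borel_prod Box_def intro!: image_eqI[of _ _ "A \<times> B"])
      qed
      show "space IX \<times> space IY \<in> sets (restrict_space lborel Box)"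
        using sets.top[of "restrict_space lborel Box"] by (simp add: space_restrict_space Box_def)
    qed
    show "sets (restrict_space lborel Box) \<subseteq> sets PM"
    proof
      fix A assume "A \<in> sets (restrict_space lborel Box)"
      then obtain C where "C \<in> sets borel" "A = Box \<inter> C"
        by (auto simp: sets_restrict_space)
      then have C: "C \<in> sets (borel \<Otimes>\<^sub>M borel)" "A = Box \<inter> C" by (simp_all only: borel_prod)
      have "(\<lambda>p. (fst p, snd p)) \<in> measurable PM (borel \<Otimes>\<^sub>M borel)" by measurable
      from measurable_sets[OF this C(1)] show "A \<in> sets PM" using C(2) by (simp add: space_PM vimage_def Int_def conj_commute)
    qed
  qed
  fix A B assume A: "A \<in> sets IX" and B: "B \<in> sets IY"
  then have AB: "A \<in> sets borel" "A \<subseteq> {-1..1}" "B \<in> sets borel" "B \<subseteq> {0..2*pi}"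
    by (auto simp: sets_MI sets_restrict_space)
  have "emeasure (restrict_space lborel Box) (A \<times> B) = emeasure (lborel \<Otimes>\<^sub>M lborel) (A \<times> B)"
    using AB Box_borel by (subst emeasure_restrict_space) (auto simp: Box_def lborel_prod)
  also have "\<dots> = emeasure lborel A * emeasure lborel B"
    using AB by (intro lborel.emeasure_pair_measure_Times) auto
  also have "\<dots> = emeasure IX A * emeasure IY B"
    unfolding MI_def using AB by (simp add: emeasure_restrict_space)
  finally show "emeasure IX A * emeasure IY B = emeasure (restrict_space lborel Box) (A \<times> B)" by simp
qed

text \<open>Fubini is used on Borel products, while the statement speaks of Lebesgue measurable
  functions. A Borel version extended by zero changes neither norms nor weak formulations, and all
  its sections are measurable.\<close>

lemma borel_representative:
  fixes f :: "real \<times> real \<Rightarrow> complex"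
  assumes f: "f \<in> borel_measurable (lebesgue_on Mset)"
  obtains u where "u \<in> borel_measurable borel" "\<And>p. p \<notin> Mset \<Longrightarrow> u p = 0" "AE p in lebesgue_on Mset. u p = f p"
proof -
  have M: "Mset \<inter> space lebesgue \<in> sets (lebesgue :: (real \<times> real) measure)" by simp
  have f0: "(\<lambda>p. indicator Mset p *\<^sub>R f p) \<in> borel_measurable lebesgue"
    using f by (subst (asm) borel_measurable_restrict_space_iff[OF M])
  have re_im: "(\<lambda>p. Re (indicator Mset p *\<^sub>R f p)) \<in> borel_measurable lebesgue"
    "(\<lambda>p. Im (indicator Mset p *\<^sub>R f p)) \<in> borel_measurable lebesgue"
    by (intro measurable_compose[OF f0] borel_measurable_Re borel_measurable_Im measurable_ident)+
  obtain a b where ab: "a \<in> borel_measurable lborel" "AE p in lborel. Re (indicator Mset p *\<^sub>R f p) = a p"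
    "b \<in> borel_measurable lborel" "AE p in lborel. Im (indicator Mset p *\<^sub>R f p) = b p"
    using completion_ex_borel_measurable_real[OF re_im(1)] completion_ex_borel_measurable_real[OF re_im(2)] by blast
  have [measurable]: "a \<in> borel_measurable borel" "b \<in> borel_measurable borel" using ab by simp_all
  define u where "u p = indicator Mset p *\<^sub>R Complex (a p) (b p)" for p
  show ?thesis
  proof (rule that[of u])
    have "(\<lambda>p. complex_of_real (a p) + \<i> * complex_of_real (b p)) \<in> borel_measurable borel" by measurable
    then have "(\<lambda>p. Complex (a p) (b p)) \<in> borel_measurable borel" by (simp add: Complex_eq)
    then show "u \<in> borel_measurable borel" unfolding u_def[abs_def] by (intro borel_measurable_scaleR) simp_all
    show "\<And>p. p \<notin> Mset \<Longrightarrow> u p = 0" by (simp add: u_def)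
    have "AE p in lborel. p \<in> Mset \<longrightarrow> u p = f p"
      using ab(2,4) by eventually_elim (auto simp: u_def complex_eq_iff)
    then show "AE p in lebesgue_on Mset. u p = f p"
      by (subst AE_restrict_space_iff[OF M]) (rule AE_completion)
  qed
qed

lemma bridge:
  fixes F :: "real \<times> real \<Rightarrow> 'b::{banach, second_countable_topology}"
  assumes F: "F \<in> borel_measurable borel" and z: "\<And>p. p \<notin> Mset \<Longrightarrow> F p = 0"
  shows "integrable (lebesgue_on Mset) F \<longleftrightarrow> integrable PM F"
    and "integral\<^sup>L (lebesgue_on Mset) F = integral\<^sup>L PM F"
proof -
  have M: "Mset \<inter> space lebesgue \<in> sets (lebesgue :: (real \<times> real) measure)" by simp
  have B: "Box \<inter> space lborel \<in> sets (lborel :: (real \<times> real) measure)" by simp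
  have eq: "(\<lambda>p. indicator Mset p *\<^sub>R F p) = F" "(\<lambda>p. indicator Box p *\<^sub>R F p) = F"
    using z Mset_subset_Box by (auto simp: fun_eq_iff indicator_def)
  show "integrable (lebesgue_on Mset) F \<longleftrightarrow> integrable PM F"
    unfolding PM_eq integrable_restrict_space[OF M] integrable_restrict_space[OF B] eq
    using F by (intro integrable_completion) simp
  show "integral\<^sup>L (lebesgue_on Mset) F = integral\<^sup>L PM F"
    unfolding PM_eq integral_restrict_space[OF M] integral_restrict_space[OF B] eq
    using F by (intro integral_completion) simp
qed

lemma borel_measurable_PM [measurable (raw)]: "f \<in> borel_measurable borel \<Longrightarrow> f \<in> borel_measurable PM"
  unfolding PM_eq by (intro measurable_restrict_space1) simp

lemma borel_measurable_lebesgue_on: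
  "f \<in> borel_measurable borel \<Longrightarrow> f \<in> borel_measurable (lebesgue_on S)"
  for f :: "real \<times> real \<Rightarrow> 'b::topological_space"
  by (intro measurable_restrict_space1 measurable_completion) simp

lemma L2_on_representative:
  assumes "L2_on Mset f"
  obtains u where "u \<in> borel_measurable borel" "\<And>p. p \<notin> Mset \<Longrightarrow> u p = 0" "AE p in lebesgue_on Mset. u p = f p" "L2 PM u"
proof -
  have fm: "f \<in> borel_measurable (lebesgue_on Mset)" using assms by (simp add: L2_on_def)
  obtain u where u: "u \<in> borel_measurable borel" "\<And>p. p \<notin> Mset \<Longrightarrow> u p = 0" "AE p in lebesgue_on Mset. u p = f p"
    using borel_representative[OF fm] by blast
  have [measurable]: "u \<in> borel_measurable (lebesgue_on Mset)" "f \<in> borel_measurable (lebesgue_on Mset)"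
    using borel_measurable_lebesgue_on[OF u(1)] fm by auto
  have "integrable (lebesgue_on Mset) (\<lambda>p. (norm (f p))\<^sup>2)" using assms by (simp add: L2_on_def)
  then have "integrable (lebesgue_on Mset) (\<lambda>p. (norm (u p))\<^sup>2)"
    using u(3) by (subst integrable_cong_AE[where g = "\<lambda>p. (norm (f p))\<^sup>2"]) auto
  moreover have "(\<lambda>p. (norm (u p))\<^sup>2) \<in> borel_measurable borel" using u(1) by measurable
  ultimately have "integrable PM (\<lambda>p. (norm (u p))\<^sup>2)"
    using bridge(1)[of "\<lambda>p. (norm (u p))\<^sup>2"] u(2) by simp
  then have "L2 PM u" using u(1) by (simp add: L2_def borel_measurable_PM)
  with u show ?thesis using that by blast
qed

lemma L2norm_bridge:
  fixes u f :: "real \<times> real \<Rightarrow> complex"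
  assumes "u \<in> borel_measurable borel" "\<And>p. p \<notin> Mset \<Longrightarrow> u p = 0" "AE p in lebesgue_on Mset. u p = f p"
    and [measurable]: "f \<in> borel_measurable (lebesgue_on Mset)"
  shows "(L2norm Mset f)\<^sup>2 = nsq PM u"
proof -
  have [measurable]: "u \<in> borel_measurable (lebesgue_on Mset)"
    using borel_measurable_lebesgue_on[OF assms(1)] .
  have b: "(\<lambda>p. (norm (u p))\<^sup>2) \<in> borel_measurable borel" using assms(1) by measurable
  have "integral\<^sup>L (lebesgue_on Mset) (\<lambda>p. (norm (f p))\<^sup>2) = integral\<^sup>L (lebesgue_on Mset) (\<lambda>p. (norm (u p))\<^sup>2)"
    using assms(3) by (intro integral_cong_AE) auto
  also have "\<dots> = nsq PM u" unfolding nsq_def using b assms(2) by (intro bridge) auto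
  finally show ?thesis unfolding L2norm_def using nsq_nonneg[of PM u] by simp
qed

lemma integral_test_bridge:
  fixes u f :: "real \<times> real \<Rightarrow> complex"
  assumes "u \<in> borel_measurable borel" "\<And>p. p \<notin> Mset \<Longrightarrow> u p = 0" "AE p in lebesgue_on Mset. u p = f p"
    and [measurable]: "f \<in> borel_measurable (lebesgue_on Mset)" and \<phi>: "\<phi> \<in> borel_measurable borel"
  shows "(LINT p | lebesgue_on Mset. f p * of_real (\<phi> p)) = (LINT p | PM. u p * of_real (\<phi> p))"
proof -
  have [measurable]: "u \<in> borel_measurable (lebesgue_on Mset)" "\<phi> \<in> borel_measurable (lebesgue_on Mset)"
    using borel_measurable_lebesgue_on[OF assms(1)] borel_measurable_lebesgue_on[OF \<phi>] by auto
  have b: "(\<lambda>p. u p * complex_of_real (\<phi> p)) \<in> borel_measurable borel" using assms(1) \<phi> by measurable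
  have "(LINT p | lebesgue_on Mset. f p * of_real (\<phi> p)) = (LINT p | lebesgue_on Mset. u p * of_real (\<phi> p))"
    using assms(3) by (intro integral_cong_AE) auto
  also have "\<dots> = (LINT p | PM. u p * of_real (\<phi> p))" using b assms(2) by (intro bridge) auto
  finally show ?thesis .
qed

lemma tensor_measurable: "smooth s \<Longrightarrow> smooth t \<Longrightarrow> (\<lambda>(x, y). s x * t y) \<in> borel_measurable borel"
  using tensor_differentiable[of s t]
  by (intro borel_measurable_continuous_onI continuous_at_imp_continuous_on ballI differentiable_imp_continuous_within)

lemma em_cos_sin: "em (- n) y = of_real (cos (of_int n * y)) - \<i> * of_real (sin (of_int n * y))"
  by (simp add: em_def complex_eq_iff)

lemma continuous_bounded_mult_integrable_PM:
  assumes "L2 PM u" "continuous_on Box c"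
  shows "integrable PM (\<lambda>p. u p * complex_of_real (c p))"
proof -
  have "compact Box" unfolding Box_def by (intro compact_Times) auto
  then have "bounded (c ` Box)" using assms(2) compact_continuous_image compact_imp_bounded by blast
  then obtain B where B: "\<And>p. p \<in> Box \<Longrightarrow> norm (c p) \<le> B" by (auto simp: bounded_iff)
  have "c \<in> borel_measurable PM" unfolding PM_eq
    using borel_measurable_continuous_on_restrict[OF assms(2)] measurable_cong_sets[OF sets_restrict_space_cong[of borel lborel Box] refl] by auto
  then have m: "(\<lambda>p. complex_of_real (c p)) \<in> borel_measurable PM" by measurable
  interpret P: finite_measure PM by (rule finite_measure_pair_measure) (rule finite_measure_MI)+
  have "integrable PM (\<lambda>p. complex_of_real (c p) * u p)"
    using L2_bounded_mult[OF assms(1) m, of B] B by (intro P.L2_imp_integrable) (auto simp: space_PM)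
  then show ?thesis by (simp add: mult.commute)
qed

lemma continuous_on_tensor: "continuous_on UNIV s \<Longrightarrow> continuous_on UNIV t \<Longrightarrow> continuous_on A (\<lambda>(x, y). s x * t y :: real)"
proof -
  assume s: "continuous_on UNIV s" and t: "continuous_on UNIV t"
  have "continuous_on A (\<lambda>p. s (fst p))"
    by (rule continuous_on_compose2[OF s]) (auto intro: continuous_intros)
  moreover have "continuous_on A (\<lambda>p. t (snd p))"
    by (rule continuous_on_compose2[OF t]) (auto intro: continuous_intros)
  ultimately
  show ?thesis unfolding case_prod_beta' by (rule continuous_on_mult)
qed

text \<open>Test functions are real, so the exponential has to be assembled from a cosine and a
  sine.\<close>

lemma integral_tensor_em:
  assumes u: "L2 PM u" and s: "continuous_on UNIV s"
  shows "(LINT p | PM. u p * (of_real (s (fst p)) * em (- n) (snd p)))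
    = (LINT p | PM. u p * of_real (case p of (x, y) \<Rightarrow> s x * cos (of_int n * y)))
      - \<i> * (LINT p | PM. u p * of_real (case p of (x, y) \<Rightarrow> s x * sin (of_int n * y)))"
proof -
  have i: "integrable PM (\<lambda>p. u p * of_real (case p of (x, y) \<Rightarrow> s x * cos (of_int n * y)))"
    "integrable PM (\<lambda>p. u p * of_real (case p of (x, y) \<Rightarrow> s x * sin (of_int n * y)))"
    by (intro continuous_bounded_mult_integrable_PM u continuous_on_tensor s continuous_intros)+
  have "(LINT p | PM. u p * (of_real (s (fst p)) * em (- n) (snd p)))
    = (LINT p | PM. u p * of_real (case p of (x, y) \<Rightarrow> s x * cos (of_int n * y)) - \<i> * (u p * of_real (case p of (x, y) \<Rightarrow> s x * sin (of_int n * y))))"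
  proof (intro Bochner_Integration.integral_cong refl)
    have alg: "a * (b * (c - \<i> * d)) = a * (b * c) - \<i> * (a * (b * d))" for a b c d :: complex
      by (simp add: algebra_simps)
    fix p
    show "u p * (of_real (s (fst p)) * em (- n) (snd p))
      = u p * of_real (case p of (x, y) \<Rightarrow> s x * cos (of_int n * y)) - \<i> * (u p * of_real (case p of (x, y) \<Rightarrow> s x * sin (of_int n * y)))"
      unfolding case_prod_beta' em_cos_sin of_real_mult by (rule alg)
  qed
  then show ?thesis using i by simp
qed

section \<open>Fourier modes of functions on the cylinder\<close>

text \<open>Where a slice is not integrable the integral defaults to 0; facts on slices are
  therefore stated for almost every \<open>x\<close>.\<close>

definition md :: "(real \<times> real \<Rightarrow> complex) \<Rightarrow> int \<Rightarrow> real \<Rightarrow> complex" where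
  "md u n x = fc n (\<lambda>y. u (x, y))"

lemma slice_measurable:
  "u \<in> borel_measurable (M1 \<Otimes>\<^sub>M M2) \<Longrightarrow> x \<in> space M1 \<Longrightarrow> (\<lambda>y. u (x, y)) \<in> borel_measurable M2"
  by (rule measurable_Pair2)

lemma AE_slice_L2:
  assumes u: "L2 PM u" shows "AE x in IX. L2 IY (\<lambda>y. u (x, y))"
proof -
  have "AE x in IX. integrable IY (\<lambda>y. (norm (u (x, y)))\<^sup>2)"
    using MI2.AE_integrable_fst'[OF L2_integrable_sq[OF u]] by simp
  moreover have "AE x in IX. x \<in> space IX" by (rule AE_space)
  ultimately show ?thesis
    by eventually_elim (use u in \<open>auto simp: L2_def intro: slice_measurable\<close>)
qed

lemma nsq_slices:
  assumes u: "L2 PM u"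
  shows "integrable IX (\<lambda>x. nsq IY (\<lambda>y. u (x, y)))" "(\<integral>x. nsq IY (\<lambda>y. u (x, y)) \<partial>IX) = nsq PM u"
  using MI2.integrable_fst'[OF L2_integrable_sq[OF u]] MI2.integral_fst'[OF L2_integrable_sq[OF u]]
  by (simp_all add: nsq_def)

lemma md_measurable:
  assumes u: "u \<in> borel_measurable PM" shows "md u n \<in> borel_measurable IX"
proof -
  have "(\<lambda>p. u p * em (- n) (snd p)) \<in> borel_measurable PM"
    using u measurable_compose[OF borel_measurable_snd_MI measurable_em] by (intro borel_measurable_times)
  then have "(\<lambda>x. \<integral>y. u (x, y) * em (- n) y \<partial>IY) \<in> borel_measurable IX"
    by (intro MI.borel_measurable_lebesgue_integral) (simp add: case_prod_beta')
  then show ?thesis unfolding md_def[abs_def] fc_def by simp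
qed

lemma md_sq_le: "L2 IY (\<lambda>y. u (x, y)) \<Longrightarrow> finite A \<Longrightarrow> 2 * pi * (\<Sum>n\<in>A. (norm (md u n x))\<^sup>2) \<le> nsq IY (\<lambda>y. u (x, y))"
  unfolding md_def by (rule bessel)

lemma L2_md: assumes u: "L2 PM u" shows "L2 IX (md u n)"
  unfolding L2_def
proof
  have um: "u \<in> borel_measurable PM" using u by (simp add: L2_def)
  show m: "md u n \<in> borel_measurable IX" by (rule md_measurable[OF um])
  show "integrable IX (\<lambda>x. (norm (md u n x))\<^sup>2)"
  proof (rule Bochner_Integration.integrable_bound)
    show "integrable IX (\<lambda>x. nsq IY (\<lambda>y. u (x, y)) / (2 * pi))"
      by (intro integrable_divide nsq_slices u)
    show "(\<lambda>x. (norm (md u n x))\<^sup>2) \<in> borel_measurable IX" using m by measurable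
    show "AE x in IX. norm ((norm (md u n x))\<^sup>2) \<le> norm (nsq IY (\<lambda>y. u (x, y)) / (2 * pi))"
      using AE_slice_L2[OF u]
    proof eventually_elim
      case (elim x)
      then show ?case using md_sq_le[of u x "{n}"] nsq_nonneg[of IY "\<lambda>y. u (x, y)"] by (simp add: field_simps)
    qed
  qed
qed

lemma sum_nsq_md:
  assumes u: "L2 PM u"
  shows "2 * pi * (\<Sum>n\<in>A. nsq IX (md u n)) = (\<integral>x. 2 * pi * (\<Sum>n\<in>A. (norm (md u n x))\<^sup>2) \<partial>IX)"
proof -
  have i: "integrable IX (\<lambda>x. (norm (md u n x))\<^sup>2)" for n by (rule L2_integrable_sq[OF L2_md[OF u]])
  have "(\<integral>x. (\<Sum>n\<in>A. (norm (md u n x))\<^sup>2) \<partial>IX) = (\<Sum>n\<in>A. nsq IX (md u n))"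
    unfolding nsq_def by (rule Bochner_Integration.integral_sum) (rule i)
  then show ?thesis by (simp only: integral_mult_right_zero)
qed

lemma integrable_sum_md:
  "L2 PM u \<Longrightarrow> integrable IX (\<lambda>x. 2 * pi * (\<Sum>n\<in>A. (norm (md u n x))\<^sup>2))"
  by (intro integrable_mult_right Bochner_Integration.integrable_sum L2_integrable_sq L2_md)

lemma bessel_PM:
  assumes u: "L2 PM u" and A: "finite A"
  shows "2 * pi * (\<Sum>n\<in>A. nsq IX (md u n)) \<le> nsq PM u"
  unfolding sum_nsq_md[OF u] nsq_slices(2)[OF u, symmetric]
proof (rule integral_mono_AE)
  show "AE x in IX. 2 * pi * (\<Sum>n\<in>A. (norm (md u n x))\<^sup>2) \<le> nsq IY (\<lambda>y. u (x, y))"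
    using AE_slice_L2[OF u] by eventually_elim (rule md_sq_le[OF _ A])
qed (intro integrable_sum_md nsq_slices u)+

text \<open>Parseval on almost every slice, integrated in \<open>x\<close>; by Bessel the slice
  norms dominate the partial sums.\<close>

lemma parseval_PM:
  assumes u: "L2 PM u"
  shows "(\<lambda>N. 2 * pi * (\<Sum>n\<in>{- int N..int N}. nsq IX (md u n))) \<longlonglongrightarrow> nsq PM u"
  unfolding sum_nsq_md[OF u] nsq_slices(2)[OF u, symmetric]
proof (rule integral_dominated_convergence[where w = "\<lambda>x. nsq IY (\<lambda>y. u (x, y))"])
  show "integrable IX (\<lambda>x. nsq IY (\<lambda>y. u (x, y)))" by (rule nsq_slices[OF u])
  then show "(\<lambda>x. nsq IY (\<lambda>y. u (x, y))) \<in> borel_measurable IX" by (rule borel_measurable_integrable)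
  show "(\<lambda>x. 2 * pi * (\<Sum>n\<in>{- int N..int N}. (norm (md u n x))\<^sup>2)) \<in> borel_measurable IX" for N
    by (rule borel_measurable_integrable[OF integrable_sum_md[OF u]])
  show "AE x in IX. (\<lambda>N. 2 * pi * (\<Sum>n\<in>{- int N..int N}. (norm (md u n x))\<^sup>2)) \<longlonglongrightarrow> nsq IY (\<lambda>y. u (x, y))"
    using AE_slice_L2[OF u] unfolding md_def by eventually_elim (rule parseval)
  show "AE x in IX. norm (2 * pi * (\<Sum>n\<in>{- int N..int N}. (norm (md u n x))\<^sup>2)) \<le> nsq IY (\<lambda>y. u (x, y))" for N
    using AE_slice_L2[OF u]
  proof eventually_elim
    case (elim x)
    have "2 * pi * (\<Sum>n\<in>{- int N..int N}. (norm (md u n x))\<^sup>2) \<ge> 0" by (intro mult_nonneg_nonneg sum_nonneg) auto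
    then show ?case using md_sq_le[OF elim, of "{- int N..int N}"] by simp
  qed
qed

lemma L2_fst:
  assumes c: "L2 IX c" shows "L2 PM (\<lambda>p. c (fst p) * em n (snd p))"
  unfolding L2_def
proof
  have cm [measurable]: "c \<in> borel_measurable IX" using c by (simp add: L2_def)
  have m: "(\<lambda>p. c (fst p)) \<in> borel_measurable PM" by (rule measurable_compose[OF measurable_fst cm])
  have e: "(\<lambda>p. em n (snd p)) \<in> borel_measurable PM"
    by (rule measurable_compose[OF borel_measurable_snd_MI measurable_em])
  show "(\<lambda>p. c (fst p) * em n (snd p)) \<in> borel_measurable PM" using m e by (rule borel_measurable_times)
  have "integrable PM (\<lambda>p. (norm (c (fst p)))\<^sup>2)"
  proof (rule MI2.Fubini_integrable)
    show "(\<lambda>p. (norm (c (fst p)))\<^sup>2) \<in> borel_measurable PM" using m by measurable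
    show "integrable IX (\<lambda>x. \<integral>y. norm ((norm (c (fst (x, y))))\<^sup>2) \<partial>IY)"
      using L2_integrable_sq[OF c] by simp
  qed simp
  then show "integrable PM (\<lambda>p. (norm (c (fst p) * em n (snd p)))\<^sup>2)" by (simp add: norm_mult)
qed

lemma nsq_diff_projection:
  assumes u: "L2 PM u" and A: "finite A"
  shows "nsq PM (\<lambda>p. u p - (\<Sum>n\<in>A. md u n (fst p) * em n (snd p))) = nsq PM u - 2 * pi * (\<Sum>n\<in>A. nsq IX (md u n))"
proof -
  have L: "L2 PM (\<lambda>p. u p - (\<Sum>n\<in>A. md u n (fst p) * em n (snd p)))"
    by (intro L2_diff u L2_sum L2_fst L2_md)
  have "nsq PM (\<lambda>p. u p - (\<Sum>n\<in>A. md u n (fst p) * em n (snd p)))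
      = (\<integral>x. nsq IY (\<lambda>y. u (x, y) - (\<Sum>n\<in>A. md u n x * em n y)) \<partial>IX)"
    using nsq_slices(2)[OF L] by simp
  also have "\<dots> = (\<integral>x. nsq IY (\<lambda>y. u (x, y)) - 2 * pi * (\<Sum>n\<in>A. (norm (md u n x))\<^sup>2) \<partial>IX)"
  proof (rule integral_cong_AE)
    show "(\<lambda>x. nsq IY (\<lambda>y. u (x, y) - (\<Sum>n\<in>A. md u n x * em n y))) \<in> borel_measurable IX"
      using borel_measurable_integrable[OF nsq_slices(1)[OF L]] by simp
    show "(\<lambda>x. nsq IY (\<lambda>y. u (x, y)) - 2 * pi * (\<Sum>n\<in>A. (norm (md u n x))\<^sup>2)) \<in> borel_measurable IX"
      by (intro borel_measurable_diff borel_measurable_integrable nsq_slices integrable_sum_md u)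
    show "AE x in IX. nsq IY (\<lambda>y. u (x, y) - (\<Sum>n\<in>A. md u n x * em n y)) = nsq IY (\<lambda>y. u (x, y)) - 2 * pi * (\<Sum>n\<in>A. (norm (md u n x))\<^sup>2)"
      using AE_slice_L2[OF u]
    proof eventually_elim
      case (elim x)
      then show ?case using nsq_diff_trig_sum[OF elim A, of "\<lambda>n. md u n x"] by (simp add: md_def)
    qed
  qed
  also have "\<dots> = nsq PM u - 2 * pi * (\<Sum>n\<in>A. nsq IX (md u n))"
    unfolding sum_nsq_md[OF u] nsq_slices(2)[OF u, symmetric]
    by (intro Bochner_Integration.integral_diff nsq_slices integrable_sum_md u)
  finally show ?thesis .
qed

lemma integral_PM_em:
  assumes i: "integrable PM (\<lambda>p. u p * (s (fst p) * em (- n) (snd p)))"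
  shows "(LINT p | PM. u p * (s (fst p) * em (- n) (snd p))) = 2 * pi * (\<integral>x. md u n x * s x \<partial>IX)"
proof -
  have "(LINT p | PM. u p * (s (fst p) * em (- n) (snd p))) = (\<integral>x. (\<integral>y. u (x, y) * (s x * em (- n) y) \<partial>IY) \<partial>IX)"
    using MI2.integral_fst'[OF i] by simp
  also have "\<dots> = (\<integral>x. 2 * pi * (md u n x * s x) \<partial>IX)"
  proof (intro Bochner_Integration.integral_cong refl)
    fix x
    have "(\<integral>y. u (x, y) * (s x * em (- n) y) \<partial>IY) = (\<integral>y. s x * (u (x, y) * em (- n) y) \<partial>IY)"
      by (simp add: mult.left_commute)
    also have "\<dots> = s x * (\<integral>y. u (x, y) * em (- n) y \<partial>IY)" by simp
    finally show "(\<integral>y. u (x, y) * (s x * em (- n) y) \<partial>IY) = 2 * pi * (md u n x * s x)"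
      by (simp add: md_def fc_def)
  qed
  finally show ?thesis by simp
qed

lemma fc_add: "L2 IY f \<Longrightarrow> L2 IY g \<Longrightarrow> fc n (\<lambda>y. f y + g y) = fc n f + fc n g"
proof -
  assume f: "L2 IY f" and g: "L2 IY g"
  have "integrable IY (\<lambda>y. f y * em (- n) y)" "integrable IY (\<lambda>y. g y * em (- n) y)"
    by (intro L2_mult_integrable f g L2_em)+
  then show ?thesis by (simp add: fc_def distrib_right add_divide_distrib)
qed

lemma fc_cmult: "fc n (\<lambda>y. c * f y) = c * fc n f"
  by (simp add: fc_def mult.assoc)

lemma fc_diff: "L2 IY f \<Longrightarrow> L2 IY g \<Longrightarrow> fc n (\<lambda>y. f y - g y) = fc n f - fc n g"
  using fc_add[of f "\<lambda>y. - 1 * g y" n] L2_cmult[of IY g "- 1"] fc_cmult[of n "- 1" g] by simp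

lemma fc_cong_AE:
  assumes "AE y in IY. f y = g y" "f \<in> borel_measurable IY" "g \<in> borel_measurable IY"
  shows "fc n f = fc n g"
proof -
  note [measurable] = assms(2,3)
  have "(\<integral>y. f y * em (- n) y \<partial>IY) = (\<integral>y. g y * em (- n) y \<partial>IY)"
    using assms(1) by (intro integral_cong_AE) auto
  then show ?thesis by (simp add: fc_def)
qed

lemma fc_zero_imp_AE_zero:
  assumes f: "L2 IY f" and z: "\<And>n. fc n f = 0"
  shows "AE y in IY. f y = 0"
proof -
  have "nsq IY f = 0" using parseval[OF f] by (simp add: z LIMSEQ_const_iff)
  then have "AE y in IY. (norm (f y))\<^sup>2 = 0"
    unfolding nsq_def using L2_integrable_sq[OF f] by (subst (asm) integral_nonneg_eq_0_iff_AE) auto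
  then show ?thesis by eventually_elim simp
qed

lemma md_add_AE:
  assumes u: "L2 PM u" and v: "L2 PM v"
  shows "AE x in IX. md (\<lambda>p. u p + v p) n x = md u n x + md v n x"
  using AE_slice_L2[OF u] AE_slice_L2[OF v] by eventually_elim (simp add: md_def fc_add)

lemma md_cmult: "md (\<lambda>p. c * u p) n x = c * md u n x"
  by (simp add: md_def fc_cmult)

section \<open>The weak equations, mode by mode\<close>

definition rep :: "(real \<times> real \<Rightarrow> complex) \<Rightarrow> (real \<times> real \<Rightarrow> complex) \<Rightarrow> bool" where
  "rep u f \<longleftrightarrow> u \<in> borel_measurable borel \<and> (\<forall>p. p \<notin> Mset \<longrightarrow> u p = 0) \<and>
     (AE p in lebesgue_on Mset. u p = f p) \<and> f \<in> borel_measurable (lebesgue_on Mset) \<and> L2 PM u"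

lemma rep_exists: "L2_on Mset f \<Longrightarrow> \<exists>u. rep u f"
proof -
  assume f: "L2_on Mset f"
  obtain u where "u \<in> borel_measurable borel" "\<And>p. p \<notin> Mset \<Longrightarrow> u p = 0" "AE p in lebesgue_on Mset. u p = f p" "L2 PM u"
    using L2_on_representative[OF f] by blast
  then show ?thesis using f unfolding rep_def L2_on_def by (intro exI[of _ u]) blast
qed

lemma rep_D:
  assumes "rep u f"
  shows "u \<in> borel_measurable borel" "\<And>p. p \<notin> Mset \<Longrightarrow> u p = 0" "AE p in lebesgue_on Mset. u p = f p"
    "f \<in> borel_measurable (lebesgue_on Mset)" "L2 PM u"
  using assms by (auto simp: rep_def)

lemma integrable_PM_em:
  assumes u: "L2 PM u" and s: "continuous_on {-1..1} s"
  shows "integrable PM (\<lambda>p. u p * (s (fst p) * em (- n) (snd p)))"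
  by (intro L2_mult_integrable u L2_fst L2_continuous s)

lemma rep_test:
  assumes "rep u f" "\<phi> \<in> borel_measurable borel"
  shows "(LINT p | lebesgue_on Mset. f p * of_real (\<phi> p)) = (LINT p | PM. u p * of_real (\<phi> p))"
  by (rule integral_test_bridge) (use rep_D[OF assms(1)] assms(2) in auto)

lemma integral_test_em:
  assumes u: "rep u f" and s: "continuous_on UNIV s"
    and mc: "(\<lambda>(x, y). s x * cos (of_int n * y)) \<in> borel_measurable borel"
    and ms: "(\<lambda>(x, y). s x * sin (of_int n * y)) \<in> borel_measurable borel"
  shows "(LINT p | lebesgue_on Mset. f p * of_real (case p of (x, y) \<Rightarrow> s x * cos (of_int n * y)))
      - \<i> * (LINT p | lebesgue_on Mset. f p * of_real (case p of (x, y) \<Rightarrow> s x * sin (of_int n * y)))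
    = 2 * pi * (\<integral>x. md u n x * of_real (s x) \<partial>IX)"
proof -
  have c: "continuous_on {-1..1} (\<lambda>x. complex_of_real (s x))"
    by (intro continuous_intros continuous_on_subset[OF s]) auto
  have "2 * pi * (\<integral>x. md u n x * of_real (s x) \<partial>IX) = (LINT p | PM. u p * (of_real (s (fst p)) * em (- n) (snd p)))"
    by (rule integral_PM_em[OF integrable_PM_em[OF rep_D(5)[OF u] c], symmetric])
  then show ?thesis
    unfolding integral_tensor_em[OF rep_D(5)[OF u] s]
    by (simp only: rep_test[OF u mc] rep_test[OF u ms])
qed

lemma test_fun_cos_sin:
  assumes "test1 \<psi>"
  shows "test_fun (\<lambda>(x, y). \<psi> x * cos (of_int n * y))" "test_fun (\<lambda>(x, y). \<psi> x * sin (of_int n * y))"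
  by (intro test_fun_tensor assms smooth_cos smooth_sin cos_periodic_int sin_periodic_int)+

lemma weak_dxx_modes:
  assumes w: "weak_dxx v f" and u: "rep u v" and F: "rep F f" and \<psi>: "test1 \<psi>"
  shows "(\<integral>x. md u n x * of_real (deriv (deriv \<psi>) x) \<partial>IX) = (\<integral>x. md F n x * of_real (\<psi> x) \<partial>IX)"
proof -
  note s = test1_D(1)[OF \<psi>]
  have s2: "smooth (deriv (deriv \<psi>))" by (intro smooth_deriv s)
  have px2: "px (px (\<lambda>(x, y). \<psi> x * t y)) = (\<lambda>(x, y). deriv (deriv \<psi>) x * t y)" for t
    using px_tensor[OF s, of t] px_tensor[OF smooth_deriv(2)[OF s], of t] by simp
  have "2 * pi * (\<integral>x. md u n x * of_real (deriv (deriv \<psi>) x) \<partial>IX) = 2 * pi * (\<integral>x. md F n x * of_real (\<psi> x) \<partial>IX)"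
    unfolding integral_test_em[OF u smooth_continuous[OF s2] tensor_measurable[OF s2 smooth_cos] tensor_measurable[OF s2 smooth_sin], symmetric]
      integral_test_em[OF F smooth_continuous[OF s] tensor_measurable[OF s smooth_cos] tensor_measurable[OF s smooth_sin], symmetric]
    using w[unfolded weak_dxx_def, rule_format, OF test_fun_cos_sin(1)[OF \<psi>, of n]]
      w[unfolded weak_dxx_def, rule_format, OF test_fun_cos_sin(2)[OF \<psi>, of n]]
    by (simp only: px2)
  then show ?thesis by simp
qed

text \<open>On \<open>\<psi> x\<close> times a cosine or sine the second \<open>y\<close>-derivative
  acts as \<open>- n^2\<close>, while \<open>q\<close> stays a mere factor. The modes of
  \<open>g\<close> are thus determined algebraically and \<open>q\<close> is never
  differentiated.\<close>

lemma weak_xdyy_modes: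
  assumes \<gamma>: "\<gamma> \<ge> 1" and w: "weak_xdyy \<gamma> v g" and u: "rep u v" and G: "rep G g"
  shows "AE x in IX. md G n x = - of_real ((of_int n)\<^sup>2 * qw \<gamma> x) * md u n x"
proof -
  have L: "L2 IX (md G n)" "L2 IX (md u n)" by (intro L2_md rep_D(5)[OF G] rep_D(5)[OF u])+
  have cq: "continuous_on A (\<lambda>x. complex_of_real ((of_int n)\<^sup>2 * qw \<gamma> x))" for A
    by (intro continuous_intros continuous_on_qw \<gamma>)
  have L': "L2 IX (\<lambda>x. of_real ((of_int n)\<^sup>2 * qw \<gamma> x) * md u n x)" by (intro L2_continuous_mult cq L)
  have "AE x in IX. md G n x + of_real ((of_int n)\<^sup>2 * qw \<gamma> x) * md u n x = 0"
  proof (rule zero_if_orthogonal_to_tests)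
    show "integrable IX (\<lambda>x. md G n x + of_real ((of_int n)\<^sup>2 * qw \<gamma> x) * md u n x)"
      by (intro MI.L2_imp_integrable L2_add L L')
    fix \<psi> assume \<psi>: "test1 \<psi>"
    note s = test1_D(1)[OF \<psi>]
    let ?s = "\<lambda>x. qw \<gamma> x * (- (of_int n)\<^sup>2 * \<psi> x)"
    have cs: "continuous_on UNIV ?s"
      by (intro continuous_intros continuous_on_qw \<gamma> smooth_continuous s)
    have pc: "\<bar>fst p\<bar> powr (2 * \<gamma>) * py (py (\<lambda>(x, y). \<psi> x * cos (of_int n * y))) p = (case p of (x, y) \<Rightarrow> ?s x * cos (of_int n * y))" for p
      unfolding py_tensor[OF smooth_cos] py_tensor[OF smooth_deriv(2)[OF smooth_cos]] deriv2_cos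
      by (simp add: qw_def case_prod_beta')
    have ps: "\<bar>fst p\<bar> powr (2 * \<gamma>) * py (py (\<lambda>(x, y). \<psi> x * sin (of_int n * y))) p = (case p of (x, y) \<Rightarrow> ?s x * sin (of_int n * y))" for p
      unfolding py_tensor[OF smooth_sin] py_tensor[OF smooth_deriv(2)[OF smooth_sin]] deriv2_sin
      by (simp add: qw_def case_prod_beta')
    have mt: "(\<lambda>(x, y). ?s x * t y) \<in> borel_measurable borel" if "continuous_on UNIV t" for t
      by (intro borel_measurable_continuous_onI continuous_on_tensor cs that)
    have eq: "2 * pi * (\<integral>x. md u n x * of_real (?s x) \<partial>IX) = 2 * pi * (\<integral>x. md G n x * of_real (\<psi> x) \<partial>IX)"
      unfolding integral_test_em[OF u cs mt[OF smooth_continuous[OF smooth_cos]] mt[OF smooth_continuous[OF smooth_sin]], symmetric]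
        integral_test_em[OF G smooth_continuous[OF s] tensor_measurable[OF s smooth_cos] tensor_measurable[OF s smooth_sin], symmetric]
      using w[unfolded weak_xdyy_def, rule_format, OF test_fun_cos_sin(1)[OF \<psi>, of n]]
        w[unfolded weak_xdyy_def, rule_format, OF test_fun_cos_sin(2)[OF \<psi>, of n]]
      by (simp only: pc ps)
    have pi0: "complex_of_real (2 * pi) \<noteq> 0" by simp
    have "(\<integral>x. md G n x * of_real (\<psi> x) \<partial>IX) = (\<integral>x. md u n x * of_real (?s x) \<partial>IX)"
      by (rule mult_left_cancel[OF pi0, THEN iffD1, OF eq[symmetric]])
    also have "\<dots> = (\<integral>x. - (of_real ((of_int n)\<^sup>2 * qw \<gamma> x) * md u n x * of_real (\<psi> x)) \<partial>IX)"
      by (intro Bochner_Integration.integral_cong refl) (simp add: mult_ac)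
    also have "\<dots> = - (\<integral>x. of_real ((of_int n)\<^sup>2 * qw \<gamma> x) * md u n x * of_real (\<psi> x) \<partial>IX)" by simp
    finally have "(\<integral>x. md G n x * of_real (\<psi> x) \<partial>IX) + (\<integral>x. of_real ((of_int n)\<^sup>2 * qw \<gamma> x) * md u n x * of_real (\<psi> x) \<partial>IX) = 0"
      by simp
    moreover have "integrable IX (\<lambda>x. md G n x * of_real (\<psi> x))"
      "integrable IX (\<lambda>x. of_real ((of_int n)\<^sup>2 * qw \<gamma> x) * md u n x * of_real (\<psi> x))"
      by (intro integrable_mult_test1 MI.L2_imp_integrable L L' \<psi>)+
    ultimately show "(\<integral>x. (md G n x + of_real ((of_int n)\<^sup>2 * qw \<gamma> x) * md u n x) * of_real (\<psi> x) \<partial>IX) = 0"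
      by (simp add: distrib_right)
  qed
  then show ?thesis by eventually_elim (simp add: eq_neg_iff_add_eq_0)
qed

text \<open>The kernel form makes the double primitive jointly measurable in \<open>(x, y)\<close>.\<close>

lemma JJ_kernel:
  assumes f: "integrable IX f" and x: "x \<in> {-1..1}"
  shows "J (J f) x = (\<integral>s. of_real (max 0 (x - s)) * f s \<partial>IX)"
proof -
  have fx: "integrable (MI (-1) x) f" by (rule integrable_MI_sub[OF f x])
  have one: "integral\<^sup>L (MI (-1) t) (\<lambda>x. 1) = complex_of_real (t + 1)" if "t \<ge> - 1" for t
    using that by (simp add: measure_MI scaleR_conv_of_real)
  have iJ: "integrable (MI (-1) x) (J f)" by (rule integrable_MI_sub[OF integrable_J[OF f] x])
  have c: "continuous_on A (\<lambda>s. complex_of_real (s + 1))" for A by (intro continuous_intros)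
  have i1: "integrable (MI (-1) x) (\<lambda>s. of_real (s + 1) * f s)"
    by (rule integrable_continuous_mult_MI[OF c fx])
  \<comment> \<open>Integration by parts against the constant 1, whose primitive is
    \<open>t + 1\<close>, leads to Cauchy's formula for a repeated primitive.\<close>
  have "integral\<^sup>L (MI (-1) x) f * of_real (x + 1) = (\<integral>t. f t * integral\<^sup>L (MI (-1) t) (\<lambda>x. 1) + integral\<^sup>L (MI (-1) t) f * 1 \<partial>MI (-1) x)"
  proof -
    have "integrable (MI (-1) x) (\<lambda>x. 1 :: complex)" by (rule MI.integrable_const)
    from integral_by_parts_indefinite[OF fx this] show ?thesis
      using one[of x] x by (simp only: atLeastAtMost_iff)
  qed
  also have "\<dots> = (\<integral>t. of_real (t + 1) * f t + J f t \<partial>MI (-1) x)"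
  proof (intro Bochner_Integration.integral_cong refl)
    fix t assume "t \<in> space (MI (-1) x)"
    then have "t \<ge> - 1" by simp
    then show "f t * integral\<^sup>L (MI (-1) t) (\<lambda>x. 1) + integral\<^sup>L (MI (-1) t) f * 1 = of_real (t + 1) * f t + J f t"
      by (simp only: one J_def mult_1_right mult.commute[of "f t"])
  qed
  also have "\<dots> = (\<integral>t. of_real (t + 1) * f t \<partial>MI (-1) x) + J (J f) x"
    using i1 iJ by (simp add: J_def[of "J f"] del: of_real_add)
  finally have "J (J f) x = of_real (x + 1) * integral\<^sup>L (MI (-1) x) f - (\<integral>t. of_real (t + 1) * f t \<partial>MI (-1) x)"
    by (simp add: mult.commute del: of_real_add)
  also have "\<dots> = (\<integral>t. of_real (x + 1) * f t - of_real (t + 1) * f t \<partial>MI (-1) x)"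
    using fx i1 by (simp del: of_real_add)
  also have "\<dots> = (\<integral>t. of_real (x - t) * f t \<partial>MI (-1) x)"
    by (intro Bochner_Integration.integral_cong refl) (simp add: algebra_simps)
  also have "\<dots> = (\<integral>t. (if t \<le> x then of_real (x - t) * f t else 0) \<partial>IX)"
    by (rule integral_MI_sub[OF x, symmetric])
  also have "\<dots> = (\<integral>s. of_real (max 0 (x - s)) * f s \<partial>IX)"
    by (intro Bochner_Integration.integral_cong refl) (auto simp: max_def)
  finally show ?thesis .
qed

section \<open>The double primitive on the cylinder and the boundary values of the modes\<close>

lemma borel_prod_measurable:
  "F \<in> borel_measurable borel \<Longrightarrow> F \<in> borel_measurable (borel \<Otimes>\<^sub>M borel)"
  for F :: "real \<times> real \<Rightarrow> complex"
  by (simp only: borel_prod)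

lemma section_measurable:
  fixes F :: "real \<times> real \<Rightarrow> complex"
  assumes "F \<in> borel_measurable borel"
  shows "(\<lambda>s. F (s, y)) \<in> borel_measurable borel"
proof -
  have "(\<lambda>s. (s, y)) \<in> measurable borel (borel \<Otimes>\<^sub>M borel)" by measurable
  from measurable_compose[OF this borel_prod_measurable[OF assms]] show ?thesis .
qed

definition TT :: "(real \<times> real \<Rightarrow> complex) \<Rightarrow> real \<times> real \<Rightarrow> complex" where
  "TT F p = (\<integral>s. of_real (max 0 (fst p - s)) * F (s, snd p) \<partial>IX)"

lemma TT_measurable:
  assumes F: "F \<in> borel_measurable borel" shows "TT F \<in> borel_measurable PM"
  unfolding TT_def[abs_def]
proof (rule MI.borel_measurable_lebesgue_integral)
  have 1: "(\<lambda>q. snd q) \<in> borel_measurable (PM \<Otimes>\<^sub>M IX)" by (rule borel_measurable_snd_MI)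
  have 2: "(\<lambda>q. fst (fst q)) \<in> borel_measurable (PM \<Otimes>\<^sub>M IX)"
    by (rule measurable_compose[OF measurable_fst borel_measurable_fst_MI])
  have 3: "(\<lambda>q. snd (fst q)) \<in> borel_measurable (PM \<Otimes>\<^sub>M IX)"
    by (rule measurable_compose[OF measurable_fst borel_measurable_snd_MI])
  have "(\<lambda>q. (snd q, snd (fst q))) \<in> measurable (PM \<Otimes>\<^sub>M IX) (borel \<Otimes>\<^sub>M borel)"
    using 1 3 by (rule measurable_Pair)
  from measurable_compose[OF this borel_prod_measurable[OF F]]
  have "(\<lambda>q. F (snd q, snd (fst q))) \<in> borel_measurable (PM \<Otimes>\<^sub>M IX)" .
  then show "case_prod (\<lambda>p s. complex_of_real (max 0 (fst p - s)) * F (s, snd p)) \<in> borel_measurable (PM \<Otimes>\<^sub>M IX)"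
    unfolding case_prod_beta' using 1 2 by measurable
qed

lemma md_TT:
  assumes F: "L2 PM F" and x: "x \<in> {-1..1}"
  shows "md (TT F) n x = J (J (md F n)) x"
proof -
  have c: "continuous_on {-1..1} (\<lambda>s. complex_of_real (max 0 (x - s)))" by (intro continuous_intros)
  have i: "integrable PM (\<lambda>p. F p * (of_real (max 0 (x - fst p)) * em (- n) (snd p)))"
    by (rule integrable_PM_em[OF F c])
  have "2 * pi * md (TT F) n x = (\<integral>y. (\<integral>s. of_real (max 0 (x - s)) * F (s, y) \<partial>IX) * em (- n) y \<partial>IY)"
    by (simp add: md_def fc_def TT_def)
  also have "\<dots> = (\<integral>y. (\<integral>s. F (s, y) * (of_real (max 0 (x - s)) * em (- n) y) \<partial>IX) \<partial>IY)"
  proof (intro Bochner_Integration.integral_cong refl)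
    fix y
    have "(\<integral>s. F (s, y) * (of_real (max 0 (x - s)) * em (- n) y) \<partial>IX) = (\<integral>s. (of_real (max 0 (x - s)) * F (s, y)) * em (- n) y \<partial>IX)"
      by (simp add: mult_ac)
    also have "\<dots> = (\<integral>s. of_real (max 0 (x - s)) * F (s, y) \<partial>IX) * em (- n) y"
      by (rule integral_mult_left_zero)
    finally show "(\<integral>s. of_real (max 0 (x - s)) * F (s, y) \<partial>IX) * em (- n) y = (\<integral>s. F (s, y) * (of_real (max 0 (x - s)) * em (- n) y) \<partial>IX)" by simp
  qed
  also have "\<dots> = (LINT p | PM. F p * (of_real (max 0 (x - fst p)) * em (- n) (snd p)))"
  proof -
    have "integrable PM (case_prod (\<lambda>s y. F (s, y) * (of_real (max 0 (x - s)) * em (- n) y)))"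
      using i by (simp add: case_prod_beta')
    from MI2.integral_snd[OF this] show ?thesis by (simp add: case_prod_beta')
  qed
  also have "\<dots> = 2 * pi * (\<integral>s. md F n s * of_real (max 0 (x - s)) \<partial>IX)"
    by (rule integral_PM_em[OF i])
  also have "(\<integral>s. md F n s * of_real (max 0 (x - s)) \<partial>IX) = J (J (md F n)) x"
    using JJ_kernel[OF MI.L2_imp_integrable[OF L2_md[OF F]] x] by (simp add: mult.commute)
  finally show ?thesis by simp
qed

lemma norm_integral_sq_le:
  assumes f: "L2 IX f"
  shows "(norm (\<integral>s. f s \<partial>IX))\<^sup>2 \<le> 2 * nsq IX f"
proof (cases "(\<integral>s. f s \<partial>IX) = 0")
  case False
  define I where "I = norm (\<integral>s. f s \<partial>IX)"
  have I: "I > 0" using False by (simp add: I_def)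
  have L1: "L2 IX (\<lambda>x. 1)" by (intro L2_continuous continuous_intros)
  have "nsq IX (\<lambda>x. 1) = 2" by (simp add: nsq_def measure_MI)
  moreover have "I \<le> (2 / I * nsq IX f + nsq IX (\<lambda>x. 1) / (2 / I)) / 2"
    using norm_ip_le[OF f L1, of "2 / I"] I by (simp add: ip_def I_def)
  ultimately have "I \<le> nsq IX f / I + I / 2" using I by simp
  then have "I * I \<le> I * (nsq IX f / I + I / 2)" using I by (intro mult_left_mono) auto
  also have "\<dots> = nsq IX f + I * I / 2" using I by (simp add: distrib_left)
  finally show ?thesis by (simp add: I_def[symmetric] power2_eq_square)
qed (simp add: nsq_nonneg)

text \<open>For every \<open>x\<close> and not just almost every one, because the boundary argument
  evaluates at \<open>x = 1\<close>.\<close>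

lemma L2_TT:
  assumes Fm: "F \<in> borel_measurable borel" and F: "L2 PM F" and x: "x \<in> {-1..1}"
  shows "L2 IY (\<lambda>y. TT F (x, y))"
proof -
  have m: "(\<lambda>y. TT F (x, y)) \<in> borel_measurable IY"
    by (rule slice_measurable[OF TT_measurable[OF Fm]]) (use x in simp)
  have fi: "AE y in IY. integrable IX (\<lambda>s. (norm (F (s, y)))\<^sup>2)" "integrable IY (\<lambda>y. \<integral>s. (norm (F (s, y)))\<^sup>2 \<partial>IX)"
  proof -
    have i: "integrable PM (case_prod (\<lambda>s y. (norm (F (s, y)))\<^sup>2))"
      using L2_integrable_sq[OF F] by (simp add: case_prod_beta')
    show "AE y in IY. integrable IX (\<lambda>s. (norm (F (s, y)))\<^sup>2)" by (rule MI2.AE_integrable_snd[OF i])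
    show "integrable IY (\<lambda>y. \<integral>s. (norm (F (s, y)))\<^sup>2 \<partial>IX)" by (rule MI2.integrable_snd[OF i])
  qed
  have "AE y in IY. (norm (TT F (x, y)))\<^sup>2 \<le> 2 * (4 * (\<integral>s. (norm (F (s, y)))\<^sup>2 \<partial>IX))"
    using fi(1)
  proof eventually_elim
    case (elim y)
    have "(\<lambda>s. F (s, y)) \<in> borel_measurable borel" by (rule section_measurable[OF Fm])
    then have L: "L2 IX (\<lambda>s. F (s, y))" using elim by (simp add: L2_def borel_measurable_MI)
    have c: "continuous_on {-1..1} (\<lambda>s. complex_of_real (max 0 (x - s)))" by (intro continuous_intros)
    have "(norm (TT F (x, y)))\<^sup>2 \<le> 2 * nsq IX (\<lambda>s. of_real (max 0 (x - s)) * F (s, y))"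
      unfolding TT_def fst_conv snd_conv by (intro norm_integral_sq_le L2_continuous_mult c L)
    also have "nsq IX (\<lambda>s. of_real (max 0 (x - s)) * F (s, y)) \<le> nsq IX (\<lambda>s. 2 * F (s, y))"
    proof (rule nsq_mono)
      show "L2 IX (\<lambda>s. 2 * F (s, y))" by (rule L2_cmult[OF L])
      show "(\<lambda>s. of_real (max 0 (x - s)) * F (s, y)) \<in> borel_measurable IX"
        by (rule L2_measurable[OF L2_continuous_mult[OF c L]])
      show "norm (of_real (max 0 (x - s)) * F (s, y)) \<le> norm (2 * F (s, y))" if "s \<in> space IX" for s
        using that x by (auto simp: norm_mult intro!: mult_right_mono)
    qed
    also have "nsq IX (\<lambda>s. 2 * F (s, y)) = 4 * (\<integral>s. (norm (F (s, y)))\<^sup>2 \<partial>IX)"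
      unfolding nsq_cmult by (simp add: nsq_def)
    finally show ?case by simp
  qed
  then have le: "AE y in IY. norm ((norm (TT F (x, y)))\<^sup>2) \<le> norm (2 * (4 * (\<integral>s. (norm (F (s, y)))\<^sup>2 \<partial>IX)))"
    by eventually_elim simp
  have "integrable IY (\<lambda>y. (norm (TT F (x, y)))\<^sup>2)"
  proof (rule Bochner_Integration.integrable_bound[OF _ _ le])
    show "integrable IY (\<lambda>y. 2 * (4 * (\<integral>s. (norm (F (s, y)))\<^sup>2 \<partial>IX)))" by (intro integrable_mult_right fi)
    show "(\<lambda>y. (norm (TT F (x, y)))\<^sup>2) \<in> borel_measurable IY" using m by measurable
  qed
  then show ?thesis using m by (simp add: L2_def)
qed

lemma AE_MI_exists:
  assumes "AE x in MI a b. P x" "a \<le> c" "c < d" "d \<le> b"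
  obtains x where "c < x" "x < d" "P x"
proof -
  have "\<exists>x. c < x \<and> x < d \<and> P x"
  proof (rule ccontr)
    assume "\<not> ?thesis"
    then have "AE x in MI a b. (indicator {c<..<d} x :: real) = 0"
      using assms(1) by (auto elim!: eventually_mono simp: indicator_def)
    then have "(\<integral>x. indicator {c<..<d} x \<partial>MI a b) = (0 :: real)" by (rule integral_eq_zero_AE)
    moreover have "(\<integral>x. indicator {c<..<d} x \<partial>MI a b) = d - c"
    proof -
      have "(\<integral>x. indicator {c<..<d} x \<partial>MI a b) = (\<integral>x. indicator {c<..<d} x \<partial>lborel :: real)"
        unfolding integral_MI set_lebesgue_integral_def
        using assms by (intro Bochner_Integration.integral_cong refl) (auto simp: indicator_def)
      then show ?thesis using assms by simp
    qed
    ultimately show False using assms by simp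
  qed
  then show ?thesis using that by blast
qed

lemma continuous_AE_zero:
  fixes g :: "real \<Rightarrow> complex"
  assumes c: "continuous_on {-1..1} g" and z: "AE x in IX. g x = 0" and x: "x \<in> {-1..1}"
  shows "g x = 0"
proof -
  have "continuous_on {-1..1} (\<lambda>x. (norm (g x))\<^sup>2)" by (intro continuous_intros c)
  moreover have "integral {-1..1} (\<lambda>x. (norm (g x))\<^sup>2) = 0"
  proof -
    have "(\<integral>x. (norm (g x))\<^sup>2 \<partial>IX) = 0" by (rule integral_eq_zero_AE) (use z in \<open>auto elim: eventually_mono\<close>)
    then show ?thesis using integral_MI_HK(1)[OF integrable_continuous_MI[OF calculation]] by simp
  qed
  ultimately have "\<forall>x\<in>{-1..1}. (norm (g x))\<^sup>2 = 0"
    using integral_eq_0_iff[of "-1" 1 "\<lambda>x. (norm (g x))\<^sup>2"] by simp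
  then show ?thesis using x by simp
qed

text \<open>No measurability of \<open>P\<close> is available, so the order of the variables is
  exchanged for the complement of a measurable null set.\<close>

lemma AE_PM_swap:
  assumes "AE p in PM. P p"
  shows "AE y in IY. AE x in IX. P (x, y)"
proof -
  obtain N where N: "N \<in> null_sets PM" "{p \<in> space PM. \<not> P p} \<subseteq> N"
    using assms unfolding eventually_ae_filter by auto
  have "AE p in PM. p \<notin> N" using N(1) by (rule AE_not_in)
  then have 1: "AE x in IX. AE y in IY. (x, y) \<notin> N" by (rule MI2.AE_pair)
  have "{p \<in> space PM. (fst p, snd p) \<notin> N} = space PM - N" by auto
  then have m: "{p \<in> space PM. (fst p, snd p) \<notin> N} \<in> sets PM" using N(1) by auto
  have 2: "AE y in IY. AE x in IX. (x, y) \<notin> N"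
    using MI2.AE_commute[where P = "\<lambda>x y. (x, y) \<notin> N", OF m] 1 by blast
  have "AE y in IY. y \<in> space IY" by (rule AE_space)
  with 2 show ?thesis
  proof eventually_elim
    case (elim y)
    have "AE x in IX. x \<in> space IX" by (rule AE_space)
    with elim(1) show ?case
    proof eventually_elim
      case (elim x)
      then have "(x, y) \<in> space PM" using \<open>y \<in> space IY\<close> by (simp add: space_PM Box_def)
      then show ?case using N(2) elim(1) by blast
    qed
  qed
qed

lemma AE_lebesgue_on_Mset_PM:
  assumes "AE p in lebesgue_on Mset. P p"
  shows "AE p in PM. p \<in> Mset \<longrightarrow> P p"
proof -
  have M: "Mset \<inter> space lebesgue \<in> sets (lebesgue :: (real \<times> real) measure)" by simp
  have B: "Box \<inter> space lborel \<in> sets (lborel :: (real \<times> real) measure)" by simp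
  have "AE p in lebesgue. p \<in> Mset \<longrightarrow> P p" using assms by (subst (asm) AE_restrict_space_iff[OF M])
  then have "AE p in lborel. p \<in> Mset \<longrightarrow> P p" by (simp only: AE_completion_iff)
  then show ?thesis unfolding PM_eq AE_restrict_space_iff[OF B] by eventually_elim simp
qed

lemma AE_lebesgue_on_IY:
  assumes "AE y in lebesgue_on {0..2*pi}. P y"
  shows "AE y in IY. P y"
proof -
  have M: "{0..2*pi} \<inter> space lebesgue \<in> sets (lebesgue :: real measure)" by simp
  have B: "{0..2*pi} \<inter> space lborel \<in> sets (lborel :: real measure)" by simp
  have "AE y in lebesgue. y \<in> {0..2*pi} \<longrightarrow> P y" using assms by (subst (asm) AE_restrict_space_iff[OF M])
  then have "AE y in lborel. y \<in> {0..2*pi} \<longrightarrow> P y" by (simp only: AE_completion_iff)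
  then show ?thesis unfolding MI_def by (subst AE_restrict_space_iff[OF B])
qed

lemma mode_representation:
  assumes w: "weak_dxx v f" and u: "rep u v" and F: "rep F f"
  obtains c d where "AE x in IX. md u n x = c + d * of_real x + J (J (md F n)) x"
proof (rule weak_second_derivative)
  show "integrable IX (md u n)" "integrable IX (md F n)"
    by (intro MI.L2_imp_integrable L2_md rep_D(5)[OF u] rep_D(5)[OF F])+
qed (use weak_dxx_modes[OF w u F] that in blast)+

text \<open>Both \<open>u\<close> minus its double primitive and its modes are affine in \<open>x\<close>; comparing at two abscissae
  recovers the affine function of \<open>x\<close> for almost every \<open>y\<close>, where the trace condition is available.\<close>

lemma mode_boundary_values:
  assumes w: "weak_dxx v f" and u: "rep u v" and F: "rep F f" and tr: "trace_zero v"
    and cd: "\<And>n. AE x in IX. md u n x = c n + d n * of_real x + J (J (md F n)) x"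
  shows "c n - d n = 0" "c n + d n + J (J (md F n)) 1 = 0"
proof -
  note uB = rep_D(1)[OF u] and u2 = rep_D(5)[OF u] and FB = rep_D(1)[OF F] and F2 = rep_D(5)[OF F]
  define D where "D x y = u (x, y) - TT F (x, y)" for x y
  have mTT: "TT F \<in> borel_measurable PM" by (rule TT_measurable[OF FB])
  have "AE x in IX. \<forall>n. md u n x = c n + d n * of_real x + J (J (md F n)) x"
    using cd by (simp add: AE_all_countable)
  moreover have "AE x in IX. x \<in> space IX" by (rule AE_space)
  ultimately have good: "AE x in IX. L2 IY (D x) \<and> (\<forall>n. fc n (D x) = c n + d n * of_real x)"
    using AE_slice_L2[OF u2]
  proof eventually_elim
    case (elim x)
    then have x: "x \<in> {-1..1}" by simp
    note LT = L2_TT[OF FB F2 x]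
    have "fc n (D x) = c n + d n * of_real x" for n
    proof -
      have "fc n (D x) = md u n x - md (TT F) n x"
        unfolding D_def[abs_def] md_def by (rule fc_diff[OF elim(3) LT])
      then show ?thesis using elim(1) md_TT[OF F2 x] by simp
    qed
    moreover have "L2 IY (D x)" unfolding D_def[abs_def] by (rule L2_diff[OF elim(3) LT])
    ultimately show ?case by blast
  qed
  \<comment> \<open>Good abscissae on either side of 0 are distinct, so the values there determine
    an affine function.\<close>
  obtain x1 where x1: "- 1 < x1" "x1 < 0" "L2 IY (D x1)" "\<And>n. fc n (D x1) = c n + d n * of_real x1"
    using AE_MI_exists[OF good, of "-1" 0] by auto
  obtain x2 where x2: "0 < x2" "x2 < 1" "L2 IY (D x2)" "\<And>n. fc n (D x2) = c n + d n * of_real x2"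
    using AE_MI_exists[OF good, of 0 1] by auto
  define k where "k = complex_of_real (x2 - x1)"
  have k: "k \<noteq> 0" using x1 x2 by (simp add: k_def)
  \<comment> \<open>Slope and intercept by interpolation: functions of \<open>y\<close> whose
    Fourier coefficients are \<open>d n\<close> and \<open>c n\<close>. They lie in
    \<open>L2\<close> by construction, so no summability of \<open>c\<close> and \<open>d\<close>
    has to be proved.\<close>
  define B where "B y = (1 / k) * (D x2 y - D x1 y)" for y
  define A where "A y = D x1 y - of_real x1 * B y" for y
  have LB: "L2 IY B" unfolding B_def[abs_def] by (intro L2_cmult L2_diff x1 x2)
  have LA: "L2 IY A" unfolding A_def[abs_def] by (intro L2_diff L2_cmult LB x1)
  have fB: "fc n B = d n" for n
  proof -
    have "fc n B = (1 / k) * (fc n (D x2) - fc n (D x1))"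
      unfolding B_def[abs_def] fc_cmult by (simp only: fc_diff[OF x2(3) x1(3)])
    also have "fc n (D x2) - fc n (D x1) = k * d n" unfolding x1(4) x2(4) k_def by (simp add: algebra_simps)
    finally show ?thesis using k by simp
  qed
  have fA: "fc n A = c n" for n
  proof -
    have "fc n A = fc n (D x1) - of_real x1 * fc n B"
      unfolding A_def[abs_def] by (subst fc_diff[OF x1(3) L2_cmult[OF LB]]) (simp only: fc_cmult)
    then show ?thesis unfolding x1(4) fB by simp
  qed
  have "AE x in IX. AE y in IY. D x y - (A y + of_real x * B y) = 0"
    using good
  proof eventually_elim
    case (elim x)
    have LAB: "L2 IY (\<lambda>y. A y + of_real x * B y)" by (intro L2_add LA L2_cmult LB)
    show ?case
    proof (rule fc_zero_imp_AE_zero)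
      show "L2 IY (\<lambda>y. D x y - (A y + of_real x * B y))" using elim LAB by (intro L2_diff) auto
      fix n
      have "fc n (\<lambda>y. D x y - (A y + of_real x * B y)) = fc n (D x) - (fc n A + of_real x * fc n B)"
        using elim LAB by (subst fc_diff) (auto simp: fc_add[OF LA L2_cmult[OF LB]] fc_cmult)
      then show "fc n (\<lambda>y. D x y - (A y + of_real x * B y)) = 0" using elim by (simp add: fA fB)
    qed
  qed
  moreover have "{p \<in> space PM. D (fst p) (snd p) - (A (snd p) + of_real (fst p) * B (snd p)) = 0} \<in> sets PM"
  proof -
    have [measurable]: "(\<lambda>p. D (fst p) (snd p)) \<in> borel_measurable PM"
      unfolding D_def using mTT borel_measurable_PM[OF uB] by simp
    have [measurable]: "A \<in> borel_measurable IY" "B \<in> borel_measurable IY" using LA LB by (auto simp: L2_def)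
    show ?thesis by measurable
  qed
  ultimately have aff: "AE y in IY. AE x in IX. D x y - (A y + of_real x * B y) = 0"
    using MI2.AE_commute[where P = "\<lambda>x y. D x y - (A y + of_real x * B y) = 0"] by blast
  obtain wt where wt: "AE p in lebesgue_on Mset. wt p = v p"
    "AE y in lebesgue_on {0..2*pi}. continuous_on {-1..1} (\<lambda>x. wt (x, y)) \<and> wt (-1, y) = 0 \<and> wt (1, y) = 0"
    using tr unfolding trace_zero_def by blast
  have "AE p in lebesgue_on Mset. wt p = u p" using wt(1) rep_D(3)[OF u] by eventually_elim simp
  then have wu: "AE y in IY. AE x in IX. (x, y) \<in> Mset \<longrightarrow> wt (x, y) = u (x, y)"
    by (intro AE_PM_swap AE_lebesgue_on_Mset_PM)
  have iF: "AE y in IY. integrable IX (\<lambda>s. F (s, y))"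
  proof -
    interpret P: finite_measure PM by (rule finite_measure_pair_measure) (rule finite_measure_MI)+
    have "integrable PM (case_prod (\<lambda>s y. F (s, y)))" using P.L2_imp_integrable[OF F2] by simp
    from MI2.AE_integrable_snd[OF this] show ?thesis .
  qed
  have ne: "AE y in IY. y \<noteq> 2 * pi" by (rule AE_MI_neq)
  have spY: "AE y in IY. y \<in> space IY" by (rule AE_space)
  \<comment> \<open>For almost every fixed \<open>y\<close> the function \<open>g\<close> below is
    continuous and vanishes almost everywhere, hence also at the end points, where the trace
    condition gives the two relations. Fourier coefficients in \<open>y\<close> then lead back to
    \<open>c n\<close> and \<open>d n\<close>.\<close>
  have fin: "AE y in IY. A y - B y = 0 \<and> A y + B y + TT F (1, y) = 0"
    using aff wu AE_lebesgue_on_IY[OF wt(2)] iF ne spY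
  proof eventually_elim
    case (elim y)
    let ?Fy = "\<lambda>s. F (s, y)"
    define g where "g x = wt (x, y) - J (J ?Fy) x - A y - of_real x * B y" for x
    have TTJ: "TT F (x, y) = J (J ?Fy) x" if "x \<in> {-1..1}" for x
      unfolding TT_def fst_conv snd_conv by (rule JJ_kernel[OF elim(4) that, symmetric])
    have cg: "continuous_on {-1..1} g" unfolding g_def[abs_def]
      using elim(3) AC_continuous[OF AC_J[OF integrable_J[OF elim(4)]]] by (intro continuous_intros) auto
    have sp: "AE x in IX. x \<in> space IX" "AE x in IX. x \<noteq> 1" "AE x in IX. x \<noteq> - 1"
      by (rule AE_space AE_MI_neq)+
    have "AE x in IX. g x = 0"
      using elim(1,2) sp
    proof eventually_elim
      case (elim x)
      \<comment> \<open>The lines \<open>x = 1\<close>, \<open>x = -1\<close> and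
        \<open>y = 2 pi\<close> belong to \<open>Box\<close> but not to \<open>Mset\<close>, hence
        their exclusion.\<close>
      then have "(x, y) \<in> Mset" using \<open>y \<noteq> 2 * pi\<close> \<open>y \<in> space IY\<close> by (auto simp: Mset_def)
      then show ?case using elim TTJ[of x] by (simp add: g_def D_def algebra_simps)
    qed
    then have g0: "g x = 0" if "x \<in> {-1..1}" for x using continuous_AE_zero[OF cg _ that] by blast
    have "g (-1) = 0" "g 1 = 0" by (intro g0; simp)+
    moreover have "A y - B y = - g (-1)" "A y + B y + J (J ?Fy) 1 = - g 1"
      using elim(3) by (simp_all add: g_def)
    ultimately have "A y - B y = 0" "A y + B y + J (J ?Fy) 1 = 0" by (simp_all only: minus_zero)
    then show ?case using TTJ[of 1] by simp
  qed
  have m0: "(\<lambda>y. 0 :: complex) \<in> borel_measurable IY" by simp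
  have LT1: "L2 IY (\<lambda>y. TT F (1, y))" by (rule L2_TT[OF FB F2]) simp
  have fc0: "fc n (\<lambda>y. 0) = 0" by (simp add: fc_def)
  have "fc n (\<lambda>y. A y - B y) = fc n (\<lambda>y. 0)"
    by (rule fc_cong_AE) (use fin L2_diff[OF LA LB] in \<open>auto simp: L2_def elim: eventually_mono\<close>)
  then show "c n - d n = 0" using fc_diff[OF LA LB, of n] fA fB fc0 by simp
  have L3: "L2 IY (\<lambda>y. A y + B y + TT F (1, y))" by (intro L2_add LA LB LT1)
  have "fc n (\<lambda>y. A y + B y + TT F (1, y)) = fc n (\<lambda>y. 0)"
    by (rule fc_cong_AE) (use fin L3 in \<open>auto simp: L2_def elim: eventually_mono\<close>)
  moreover have "fc n (\<lambda>y. A y + B y + TT F (1, y)) = fc n A + fc n B + md (TT F) n 1"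
    unfolding md_def by (simp add: fc_add[OF L2_add[OF LA LB] LT1] fc_add[OF LA LB])
  ultimately show "c n + d n + J (J (md F n)) 1 = 0"
    using md_TT[OF F2, of 1 n] fA fB fc0 by simp
qed

lemma mode_solution:
  assumes w: "weak_dxx v f" and u: "rep u v" and F: "rep F f" and tr: "trace_zero v"
  obtains V W where "\<And>n. sol (V n) (W n) (md F n)" "\<And>n. AE x in IX. V n x = md u n x"
proof -
  have "\<exists>c d. AE x in IX. md u n x = c + d * of_real x + J (J (md F n)) x" for n
    using mode_representation[OF w u F, of n] by blast
  then obtain c d where cd: "\<And>n. AE x in IX. md u n x = c n + d n * of_real x + J (J (md F n)) x"
    by metis
  note bv = mode_boundary_values[OF w u F tr cd]
  define V W where "V n x = c n + d n * of_real x + J (J (md F n)) x" and "W n x = d n + J (md F n) x" for n x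
  have i: "integrable IX (md F n)" and L: "L2 IX (md F n)" for n
    by (intro MI.L2_imp_integrable L2_md rep_D(5)[OF F])+
  have const: "AC (\<lambda>x. k) (\<lambda>x. 0)" for k by (rule AC_C1) (auto intro!: derivative_eq_intros)
  have "sol (V n) (W n) (md F n)" for n
  proof -
    have "AC (\<lambda>x. c n + d n * of_real x + J (J (md F n)) x) (\<lambda>x. 0 + d n * 1 + J (md F n) x)"
      by (intro AC_add AC_cmult AC_ident const AC_J integrable_J i)
    moreover have "AC (\<lambda>x. d n + J (md F n) x) (\<lambda>x. 0 + md F n x)"
      by (intro AC_add const AC_J i)
    ultimately show ?thesis using bv[of n] L by (simp add: sol_def V_def[abs_def] W_def[abs_def])
  qed
  moreover have "AE x in IX. V n x = md u n x" for n
    using cd[of n] by eventually_elim (simp add: V_def)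
  ultimately show ?thesis using that by blast
qed

section \<open>The resolvent estimate\<close>

text \<open>The strip is given only modulo \<open>2 pi\<close>. Its midpoint is moved to
  \<open>z\<close> in \<open>[0, 2 pi)\<close>, and the window is placed to the right of
  \<open>z\<close>, ending before both the strip and the period do, so that it never wraps
  around.\<close>

lemma strip_contains_window:
  fixes a b :: real
  assumes "a < b"
  obtains \<alpha> \<beta> where "0 < \<alpha>" "\<alpha> < \<beta>" "\<beta> < 2 * pi"
    "\<And>y. \<alpha> \<le> y \<Longrightarrow> y \<le> \<beta> \<Longrightarrow> \<exists>k::int. a < y + 2 * pi * k \<and> y + 2 * pi * k < b"
proof -
  define y0 where "y0 = (a + b) / 2"
  define k where "k = \<lfloor>y0 / (2 * pi)\<rfloor>"
  define z where "z = y0 - 2 * pi * k"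
  have "of_int k \<le> y0 / (2 * pi)" "y0 / (2 * pi) < of_int k + 1" unfolding k_def by linarith+
  then have z: "0 \<le> z" "z < 2 * pi" by (simp_all add: z_def field_simps)
  define s where "s = min ((b - a) / 2) (2 * pi - z)"
  have s: "s > 0" "s \<le> (b - a) / 2" "s \<le> 2 * pi - z" unfolding s_def using assms z by (auto simp only: min_less_iff_conj min.cobounded1 min.cobounded2 less_divide_eq_numeral1 diff_gt_0_iff_gt mult_zero_left)
  show ?thesis
  proof (rule that[of "z + s / 3" "z + 2 * s / 3"])
    fix y assume "z + s / 3 \<le> y" "y \<le> z + 2 * s / 3"
    then have "y0 < y + 2 * pi * k" "y + 2 * pi * k < y0 + (b - a) / 2" using s unfolding z_def by linarith+
    then have "a < y + 2 * pi * k \<and> y + 2 * pi * k < b" using assms by (simp add: y0_def field_simps)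
    then show "\<exists>k::int. a < y + 2 * pi * k \<and> y + 2 * pi * k < b" by blast
  qed (use z s in auto)
qed

lemma nsq_cong_AE:
  assumes "AE x in M. f x = g x" "f \<in> borel_measurable M" "g \<in> borel_measurable M"
  shows "nsq M f = nsq M g"
proof -
  note [measurable] = assms(2,3)
  show ?thesis unfolding nsq_def using assms(1) by (intro integral_cong_AE) (auto elim: eventually_mono)
qed

lemma nsq_indicator_IY:
  assumes "0 \<le> \<alpha>" "\<beta> \<le> 2 * pi"
  shows "nsq IY (\<lambda>y. indicator {\<alpha>..\<beta>} y * t y) = (\<integral>y. (norm (t y))\<^sup>2 \<partial>MI \<alpha> \<beta>)"
  unfolding nsq_def integral_MI set_lebesgue_integral_def
  using assms by (intro Bochner_Integration.integral_cong refl) (auto simp: indicator_def)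

lemma L2norm_subset:
  assumes u: "rep u v" and \<omega>: "\<omega> \<in> sets borel"
  shows "(L2norm (\<omega> \<inter> Mset) v)\<^sup>2 = nsq PM (\<lambda>p. indicator \<omega> p * u p)"
proof -
  have M: "Mset \<inter> space lebesgue \<in> sets (lebesgue :: (real \<times> real) measure)" by simp
  have M': "(\<omega> \<inter> Mset) \<inter> space lebesgue \<in> sets (lebesgue :: (real \<times> real) measure)"
    using \<omega> by (auto intro: sets.Int)
  have "integral\<^sup>L (lebesgue_on (\<omega> \<inter> Mset)) (\<lambda>p. (norm (v p))\<^sup>2) = integral\<^sup>L (lebesgue_on Mset) (\<lambda>p. (norm (indicator \<omega> p * v p))\<^sup>2)"
    unfolding integral_restrict_space[OF M] integral_restrict_space[OF M']
    by (intro Bochner_Integration.integral_cong refl) (auto simp: indicator_def)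
  then have "(L2norm (\<omega> \<inter> Mset) v)\<^sup>2 = (L2norm Mset (\<lambda>p. indicator \<omega> p * v p))\<^sup>2"
    by (simp add: L2norm_def)
  also have "\<dots> = nsq PM (\<lambda>p. indicator \<omega> p * u p)"
  proof (rule L2norm_bridge)
    have ind: "(indicator \<omega> :: real \<times> real \<Rightarrow> complex) \<in> borel_measurable borel" using \<omega> by simp
    show "(\<lambda>p. indicator \<omega> p * u p) \<in> borel_measurable borel"
      by (intro borel_measurable_times ind rep_D(1)[OF u])
    show "(\<lambda>p. indicator \<omega> p * v p) \<in> borel_measurable (lebesgue_on Mset)"
      by (intro borel_measurable_times borel_measurable_lebesgue_on ind rep_D(4)[OF u])
    show "AE p in lebesgue_on Mset. indicator \<omega> p * u p = indicator \<omega> p * v p"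
      using rep_D(3)[OF u] by eventually_elim simp
  qed (simp add: rep_D(2)[OF u])
  finally show ?thesis .
qed

lemma rep_combination:
  assumes u: "rep u v" and F: "rep F f" and G: "rep G g"
  shows "(L2norm Mset (\<lambda>p. of_real (h\<^sup>2) * (f p + g p) + v p))\<^sup>2 = nsq PM (\<lambda>p. of_real (h\<^sup>2) * (F p + G p) + u p)"
proof (rule L2norm_bridge)
  show "(\<lambda>p. of_real (h\<^sup>2) * (F p + G p) + u p) \<in> borel_measurable borel"
    by (intro borel_measurable_add borel_measurable_times borel_measurable_const rep_D(1)[OF u] rep_D(1)[OF F] rep_D(1)[OF G])
  show "(\<lambda>p. of_real (h\<^sup>2) * (f p + g p) + v p) \<in> borel_measurable (lebesgue_on Mset)"
    by (intro borel_measurable_add borel_measurable_times borel_measurable_const rep_D(4)[OF u] rep_D(4)[OF F] rep_D(4)[OF G])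
  show "AE p in lebesgue_on Mset. of_real (h\<^sup>2) * (F p + G p) + u p = of_real (h\<^sup>2) * (f p + g p) + v p"
    using rep_D(3)[OF u] rep_D(3)[OF F] rep_D(3)[OF G] by eventually_elim simp
qed (simp add: rep_D(2)[OF u] rep_D(2)[OF F] rep_D(2)[OF G])

lemma rep_L2norm: "rep u v \<Longrightarrow> (L2norm Mset v)\<^sup>2 = nsq PM u"
  by (rule L2norm_bridge) (auto simp: rep_D)

text \<open>The modes of \<open>g\<close> are \<open>- n^2 q V\<close>, so the residual of the
  ordinary differential equation is a mode of \<open>h^(-2) (h^2 Delta + 1) v\<close> when
  \<open>\<Lambda> = h^(-2)\<close>.\<close>

lemma resid_eq_md:
  assumes \<gamma>: "\<gamma> \<ge> 1" and w: "weak_xdyy \<gamma> v g" and u: "rep u v" and F: "rep F f" and G: "rep G g"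
    and V: "AE x in IX. V x = md u n x"
  shows "AE x in IX. resid \<gamma> \<Lambda> (of_int n) V (md F n) x = md (\<lambda>p. F p + G p + of_real \<Lambda> * u p) n x"
proof -
  have L: "L2 PM (\<lambda>p. of_real \<Lambda> * u p)" by (rule L2_cmult[OF rep_D(5)[OF u]])
  show ?thesis
    using weak_xdyy_modes[OF \<gamma> w u G, of n] V md_add_AE[OF L2_add[OF rep_D(5)[OF F] rep_D(5)[OF G]] L, of n]
      md_add_AE[OF rep_D(5)[OF F] rep_D(5)[OF G], of n]
  proof eventually_elim
    case (elim x)
    show ?case unfolding elim(3) elim(4) md_cmult elim(1) resid_def elim(2) by (simp add: algebra_simps)
  qed
qed

lemma high_mode_small:
  assumes \<gamma>: "\<gamma> \<ge> 1" and s: "sol V W f" and h: "h > 0"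
    and n: "\<bar>n\<bar> > sqrt 10 powr (\<gamma> + 1) * h powr (- (\<gamma> + 1))"
  shows "nsq IX V \<le> h ^ 4 * nsq IX (resid \<gamma> (1 / h\<^sup>2) n V f)"
proof -
  \<comment> \<open>The largest value that \<open>mode_elliptic\<close> allows for
    \<open>\<Lambda> = 1 / h^2\<close>.\<close>
  define \<delta> where "\<delta> = h / sqrt 10"
  have \<delta>: "\<delta> > 0" using h by (simp add: \<delta>_def)
  have "sqrt 10 powr (\<gamma> + 1) * h powr (- (\<gamma> + 1)) = \<delta> powr (- (\<gamma> + 1))"
  proof -
    have "\<delta> powr (- (\<gamma> + 1)) = h powr (- (\<gamma> + 1)) / sqrt 10 powr (- (\<gamma> + 1))"
      unfolding \<delta>_def by (rule powr_divide)
    then show ?thesis unfolding powr_minus[of "sqrt 10"] by (simp only: divide_inverse inverse_inverse_eq mult.commute)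
  qed
  then have "\<delta> powr (- (\<gamma> + 1)) \<le> \<bar>n\<bar>" using n by linarith
  then have "\<delta> powr (- (\<gamma> + 1)) * \<delta> powr (\<gamma> + 1) \<le> \<bar>n\<bar> * \<delta> powr (\<gamma> + 1)" by (intro mult_right_mono) auto
  then have "1 \<le> \<bar>n\<bar> * \<delta> powr (\<gamma> + 1)" using \<delta> by (simp flip: powr_add)
  then have "1 \<le> (\<bar>n\<bar> * \<delta> powr (\<gamma> + 1))\<^sup>2" by (rule one_le_power)
  also have "\<dots> = n\<^sup>2 * \<delta> powr (2 * \<gamma> + 2)"
    by (simp add: power_mult_distrib power2_eq_square[of "\<delta> powr (\<gamma> + 1)"] flip: powr_add)
  finally have n': "n\<^sup>2 * \<delta> powr (2 * \<gamma> + 2) \<ge> 1" .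
  have "10 * (1 / h\<^sup>2) * \<delta>\<^sup>2 \<le> 1" using h by (simp add: \<delta>_def power_divide)
  from mode_elliptic[OF \<gamma> s _ \<delta> n' this] have "(1 / h\<^sup>2)\<^sup>2 * nsq IX V \<le> nsq IX (resid \<gamma> (1 / h\<^sup>2) n V f)" using h by simp
  then have "h ^ 4 * ((1 / h\<^sup>2)\<^sup>2 * nsq IX V) \<le> h ^ 4 * nsq IX (resid \<gamma> (1 / h\<^sup>2) n V f)"
    using h by (intro mult_left_mono) auto
  moreover have "h ^ 4 * ((1 / h\<^sup>2)\<^sup>2 * nsq IX V) = nsq IX V" using h by (simp add: power_divide)
  ultimately show ?thesis by simp
qed

lemma finite_abs_int_le: "finite {n::int. \<bar>of_int n\<bar> \<le> (N::real)}"
proof (rule finite_subset)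
  show "{n::int. \<bar>of_int n\<bar> \<le> N} \<subseteq> {- \<lceil>N\<rceil>..\<lceil>N\<rceil>}"
  proof
    fix n :: int assume "n \<in> {n. \<bar>of_int n\<bar> \<le> N}"
    then have "real_of_int n \<le> N" "- real_of_int n \<le> N" by auto
    then show "n \<in> {- \<lceil>N\<rceil>..\<lceil>N\<rceil>}" by (simp add: le_ceiling_iff) linarith
  qed
qed simp

text \<open>Parseval for \<open>u\<close> but only Bessel for \<open>R\<close>: partial sums are
  compared, and the limit is taken on the left alone.\<close>

lemma tail_le:
  assumes u: "L2 PM u" and R: "L2 PM R" and A: "finite A" and c: "c \<ge> 0"
    and le: "\<And>n. n \<notin> A \<Longrightarrow> nsq IX (md u n) \<le> c * nsq IX (md R n)"
  shows "nsq PM u - 2 * pi * (\<Sum>n\<in>A. nsq IX (md u n)) \<le> c * nsq PM R"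
proof -
  have "nsq PM u \<le> 2 * pi * (\<Sum>n\<in>A. nsq IX (md u n)) + c * nsq PM R"
  proof (rule LIMSEQ_le_const2[OF parseval_PM[OF u]], intro exI allI impI)
    fix M :: nat
    let ?B = "{- int M..int M}"
    have "(\<Sum>n\<in>?B. nsq IX (md u n)) = (\<Sum>n\<in>?B \<inter> A. nsq IX (md u n)) + (\<Sum>n\<in>?B - A. nsq IX (md u n))"
      by (rule sum.Int_Diff) simp
    also have "(\<Sum>n\<in>?B \<inter> A. nsq IX (md u n)) \<le> (\<Sum>n\<in>A. nsq IX (md u n))"
      using A by (intro sum_mono2) (auto simp: nsq_nonneg)
    also have "(\<Sum>n\<in>?B - A. nsq IX (md u n)) \<le> (\<Sum>n\<in>?B - A. c * nsq IX (md R n))"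
      by (intro sum_mono le) auto
    finally have "2 * pi * (\<Sum>n\<in>?B. nsq IX (md u n)) \<le> 2 * pi * ((\<Sum>n\<in>A. nsq IX (md u n)) + (\<Sum>n\<in>?B - A. c * nsq IX (md R n)))"
      by (intro mult_left_mono) auto
    also have "\<dots> = 2 * pi * (\<Sum>n\<in>A. nsq IX (md u n)) + c * (2 * pi * (\<Sum>n\<in>?B - A. nsq IX (md R n)))"
      by (simp add: distrib_left sum_distrib_left mult_ac)
    also have "\<dots> \<le> 2 * pi * (\<Sum>n\<in>A. nsq IX (md u n)) + c * nsq PM R"
      using c by (intro add_left_mono mult_left_mono bessel_PM R) auto
    finally show "2 * pi * (\<Sum>n\<in>?B. nsq IX (md u n)) \<le> 2 * pi * (\<Sum>n\<in>A. nsq IX (md u n)) + c * nsq PM R" .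
  qed
  then show ?thesis by simp
qed

text \<open>The finite-mode estimate observes a truncated sum, whereas it is \<open>u\<close> that
  is observed on the strip. The error there is bounded by its norm on all of \<open>Box\<close>,
  which is the Fourier tail.\<close>

lemma (in window) observation_le:
  assumes ab: "0 \<le> \<alpha>" "\<beta> \<le> 2 * pi" and u: "L2 PM u" and A: "finite A"
    and V: "\<And>n. continuous_on {-1..1} (V n)" "\<And>n. AE x in IX. V n x = md u n x"
  shows "Q A (\<lambda>y. 1) (\<lambda>x. 1) V \<le> 2 * nsq PM (\<lambda>p. indicator {\<alpha>..\<beta>} (snd p) * u p)
    + 2 * (nsq PM u - 2 * pi * (\<Sum>n\<in>A. nsq IX (md u n)))"
proof -
  define T where "T p = (\<Sum>n\<in>A. V n (fst p) * em n (snd p))" for p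
  have LV: "L2 IX (V n)" for n by (rule L2_continuous[OF V(1)])
  have LT: "L2 PM T" unfolding T_def[abs_def] by (intro L2_sum L2_fst LV)
  have im: "(\<lambda>p. indicator {\<alpha>..\<beta>} (snd p) :: complex) \<in> borel_measurable PM"
    by (rule measurable_compose[OF borel_measurable_snd_MI]) simp
  have Li: "L2 PM (\<lambda>p. indicator {\<alpha>..\<beta>} (snd p) * k p)" if "L2 PM k" for k
    by (rule L2_bounded_mult[OF that im, of 1]) (simp add: indicator_def)
  have "Q A (\<lambda>y. 1) (\<lambda>x. 1) V = (\<integral>x. nsq IY (\<lambda>y. indicator {\<alpha>..\<beta>} y * T (x, y)) \<partial>IX)"
    unfolding Q_def nsq_indicator_IY[OF ab] by (simp add: T_def trig_def)
  also have "\<dots> = nsq PM (\<lambda>p. indicator {\<alpha>..\<beta>} (snd p) * T p)"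
    using nsq_slices(2)[OF Li[OF LT]] by simp
  also have "\<dots> = nsq PM (\<lambda>p. indicator {\<alpha>..\<beta>} (snd p) * u p + indicator {\<alpha>..\<beta>} (snd p) * (T p - u p))"
    by (simp add: algebra_simps)
  also have "\<dots> \<le> 2 * nsq PM (\<lambda>p. indicator {\<alpha>..\<beta>} (snd p) * u p) + 2 * nsq PM (\<lambda>p. indicator {\<alpha>..\<beta>} (snd p) * (T p - u p))"
    by (intro nsq_add_le Li u L2_diff LT)
  also have "nsq PM (\<lambda>p. indicator {\<alpha>..\<beta>} (snd p) * (T p - u p)) \<le> nsq PM (\<lambda>p. u p - T p)"
    by (rule nsq_mono[OF L2_diff[OF u LT] L2_measurable[OF Li[OF L2_diff[OF LT u]]]])
      (simp add: norm_mult indicator_def norm_minus_commute)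
  also have "nsq PM (\<lambda>p. u p - T p) = nsq PM (\<lambda>p. u p - (\<Sum>n\<in>A. md u n (fst p) * em n (snd p)))"
  proof -
    have LP: "L2 PM (\<lambda>p. u p - (\<Sum>n\<in>A. md u n (fst p) * em n (snd p)))"
      by (intro L2_diff u L2_sum L2_fst L2_md)
    have ae: "AE x in IX. \<forall>n. V n x = md u n x" using V(2) by (simp add: AE_all_countable)
    show ?thesis unfolding nsq_slices(2)[OF L2_diff[OF u LT], symmetric] nsq_slices(2)[OF LP, symmetric]
    proof (rule integral_cong_AE)
      show "AE x in IX. nsq IY (\<lambda>y. u (x, y) - T (x, y)) = nsq IY (\<lambda>y. u (x, y) - (\<Sum>n\<in>A. md u n (fst (x, y)) * em n (snd (x, y))))"
        using ae by eventually_elim (simp add: T_def)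
    qed (intro borel_measurable_integrable nsq_slices(1) L2_diff u LT LP)+
  qed
  also have "\<dots> = nsq PM u - 2 * pi * (\<Sum>n\<in>A. nsq IX (md u n))" by (rule nsq_diff_projection[OF u A])
  finally show ?thesis by simp
qed

theorem theorem1p1:
  fixes \<gamma> a b :: real and \<omega> :: "(real \<times> real) set"
  assumes "\<gamma> \<ge> 1"
    and "open \<omega>"
    and "\<omega> \<subseteq> {-1<..<1} \<times> UNIV"
    and "\<forall>x y. (x, y) \<in> \<omega> \<longleftrightarrow> (x, y + 2*pi) \<in> \<omega>"
    and "a < b"
    and "{-1<..<1} \<times> {y. \<exists>k::int. a < y + 2*pi*k \<and> y + 2*pi*k < b} \<subseteq> \<omega>"
  shows "\<exists>C>0. \<exists>h0>0. \<forall>v f g h. in_dom \<gamma> v f g \<longrightarrow> 0 < h \<longrightarrow> h \<le> h0 \<longrightarrow>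
           L2norm Mset v \<le> C * (L2norm (\<omega> \<inter> Mset) v
              + h powr (-(\<gamma> + 1)) * L2norm Mset (\<lambda>p. of_real (h^2) * (f p + g p) + v p))"
proof -
  note \<gamma> = assms(1)
  obtain \<alpha> \<beta> where ab: "0 < \<alpha>" "\<alpha> < \<beta>" "\<beta> < 2 * pi"
    and win: "\<And>y. \<alpha> \<le> y \<Longrightarrow> y \<le> \<beta> \<Longrightarrow> \<exists>k::int. a < y + 2 * pi * k \<and> y + 2 * pi * k < b"
    using strip_contains_window[OF assms(5)] by metis
  interpret window \<alpha> \<beta> by unfold_locales (rule ab)
  obtain C \<Lambda>\<^sub>0 where C: "C > 0" and \<Lambda>\<^sub>0: "\<Lambda>\<^sub>0 \<ge> 1"
    and obs: "observability \<gamma> C \<Lambda>\<^sub>0"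
    using finite_mode_observability[OF \<gamma>] by blast
  \<comment> \<open>Cutoff constant dictated by \<open>high_mode_small\<close>.\<close>
  define K where "K = sqrt 10 powr (\<gamma> + 1)"
  have K: "K \<ge> 0" by (simp add: K_def)
  \<comment> \<open>Sum of the two coefficients, of the observation and of the residual, that the
    estimate of \<open>nsq PM u\<close> below ends with.\<close>
  define D where "D = 4 * pi * C + 2 * pi * C * (2 + (1 + K)\<^sup>2) + 1"
  have D: "D > 0" using C by (auto simp: D_def intro!: add_nonneg_pos add_nonneg_nonneg mult_nonneg_nonneg)
  define h\<^sub>0 where "h\<^sub>0 = 1 / sqrt \<Lambda>\<^sub>0"
  have h\<^sub>0: "h\<^sub>0 > 0" using \<Lambda>\<^sub>0 by (simp add: h\<^sub>0_def)
  have main: "L2norm Mset v \<le> sqrt D * (L2norm (\<omega> \<inter> Mset) v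
        + h powr (-(\<gamma> + 1)) * L2norm Mset (\<lambda>p. of_real (h^2) * (f p + g p) + v p))"
    if dom: "in_dom \<gamma> v f g" and h: "0 < h" "h \<le> h\<^sub>0" for v f g h
  proof -
    define \<Lambda> where "\<Lambda> = 1 / h\<^sup>2"
    have "h\<^sup>2 \<le> h\<^sub>0\<^sup>2" using h by (intro power_mono) auto
    then have h2: "h\<^sup>2 \<le> 1 / \<Lambda>\<^sub>0" using \<Lambda>\<^sub>0 by (simp add: h\<^sub>0_def power_divide)
    then have \<Lambda>: "\<Lambda> \<ge> \<Lambda>\<^sub>0" using h \<Lambda>\<^sub>0 by (simp add: \<Lambda>_def field_simps)
    have "h\<^sup>2 \<le> 1" using h2 \<Lambda>\<^sub>0 by (smt (verit) divide_le_eq_1)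
    then have h1: "h \<le> 1" using h by (simp add: power_le_one_iff abs_square_le_1)
    obtain u F G where u: "rep u v" and F: "rep F f" and G: "rep G g"
      using dom rep_exists unfolding in_dom_def by metis
    have wxx: "weak_dxx v f" and wyy: "weak_xdyy \<gamma> v g" and tr: "trace_zero v" using dom by (auto simp: in_dom_def)
    note u2 = rep_D(5)[OF u]
    obtain V W where s: "\<And>n. sol (V n) (W n) (md F n)" and V: "\<And>n. AE x in IX. V n x = md u n x"
      using mode_solution[OF wxx u F tr] by metis
    define R where "R p = F p + G p + of_real \<Lambda> * u p" for p
    have LR: "L2 PM R" unfolding R_def[abs_def]
      by (intro L2_add L2_cmult rep_D(5)[OF u] rep_D(5)[OF F] rep_D(5)[OF G])
    have nV: "nsq IX (V n) = nsq IX (md u n)" for n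
      by (rule nsq_cong_AE[OF V L2_measurable[OF sol_L2(1)[OF s]] L2_measurable[OF L2_md[OF u2]]])
    have nR: "nsq IX (resid \<gamma> \<Lambda> (of_int n) (V n) (md F n)) = nsq IX (md R n)" for n
      using resid_eq_md[OF \<gamma> wyy u F G V, of \<Lambda>, folded R_def]
      by (rule nsq_cong_AE[OF _ L2_measurable[OF L2_resid[OF \<gamma> s]] L2_measurable[OF L2_md[OF LR]]])
    define N where "N = K * h powr (- (\<gamma> + 1))"
    have N: "N \<ge> 0" using K by (simp add: N_def)
    define A where "A = {n::int. \<bar>of_int n\<bar> \<le> N}"
    have A: "finite A" unfolding A_def by (rule finite_abs_int_le)
    define t where "t = nsq PM u - 2 * pi * (\<Sum>n\<in>A. nsq IX (md u n))"
    have t: "t \<le> h ^ 4 * nsq PM R"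
      unfolding t_def
    proof (rule tail_le[OF u2 LR A])
      fix n assume "n \<notin> A"
      then have "\<bar>of_int n\<bar> > sqrt 10 powr (\<gamma> + 1) * h powr (- (\<gamma> + 1))" by (simp add: A_def N_def K_def)
      from high_mode_small[OF \<gamma> s[of n] h(1) this] show "nsq IX (md u n) \<le> h ^ 4 * nsq IX (md R n)"
        by (simp only: nV nR[unfolded \<Lambda>_def])
    qed simp
    define o1 where "o1 = nsq PM (\<lambda>p. indicator {\<alpha>..\<beta>} (snd p) * u p)"
    have Qle: "Q A (\<lambda>y. 1) (\<lambda>x. 1) V \<le> 2 * o1 + 2 * t"
      unfolding o1_def t_def using ab by (intro observation_le u2 A sol_continuous(1)[OF s] V) auto
    define c where "c = 1 + N / \<Lambda>"
    \<comment> \<open>The whole loss: \<open>N / \<Lambda> = K e\<close>, so \<open>c\<close> is at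
      most \<open>(1 + K) e\<close>. As \<open>R\<close> carries the factor \<open>h^(-2)\<close>,
      this \<open>e\<close> corresponds to the power \<open>- (\<gamma> + 1)\<close> of the
      statement.\<close>
    define e where "e = h powr (1 - \<gamma>)"
    define r where "r = nsq PM R"
    have r0: "r \<ge> 0" unfolding r_def by (rule nsq_nonneg)
    have o0: "o1 \<ge> 0" unfolding o1_def by (rule nsq_nonneg)
    have e_eq: "h powr (- (\<gamma> + 1)) * h\<^sup>2 = e"
    proof -
      have h2: "h\<^sup>2 = h powr 2" using h by simp
      have "- (\<gamma> + 1) + 2 = 1 - \<gamma>" by simp
      then show ?thesis unfolding h2 e_def powr_add[symmetric] by (rule arg_cong)
    qed
    have "h powr 0 \<le> e" unfolding e_def using h(1) h1 \<gamma> by (intro powr_mono') auto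
    then have e1: "e \<ge> 1" using h by simp
    have c_eq: "c = 1 + K * e" using e_eq by (simp add: c_def N_def \<Lambda>_def mult.assoc)
    have "c \<le> (1 + K) * e" using e1 by (simp add: c_eq distrib_right)
    moreover have "c \<ge> 0" using K e1 by (simp add: c_eq)
    ultimately have c2: "c\<^sup>2 \<le> (1 + K)\<^sup>2 * e\<^sup>2" using power_mono[of c "(1 + K) * e" 2] by (simp add: power_mult_distrib)
    \<comment> \<open>The elliptic tail costs only \<open>h^4\<close>, no more than the
      \<open>e^2\<close> paid for the low modes.\<close>
    have "h ^ 4 \<le> 1" using h(1) h1 by (intro power_le_one) auto
    also have "1 \<le> e\<^sup>2" using e1 by (rule one_le_power)
    finally have h4: "h ^ 4 * r \<le> e\<^sup>2 * r" using r0 by (rule mult_right_mono)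
    define S where "S = (\<Sum>n\<in>A. nsq IX (md u n))"
    have SR: "(\<Sum>n\<in>A. nsq IX (md R n)) \<le> r"
    proof -
      have "1 * (\<Sum>n\<in>A. nsq IX (md R n)) \<le> 2 * pi * (\<Sum>n\<in>A. nsq IX (md R n))"
        using pi_ge_two by (intro mult_right_mono sum_nonneg nsq_nonneg) auto
      then show ?thesis using bessel_PM[OF LR A] by (simp add: r_def)
    qed
    have "S \<le> C * (Q A (\<lambda>y. 1) (\<lambda>x. 1) V + c\<^sup>2 * (\<Sum>n\<in>A. nsq IX (md R n)))"
      using obs[unfolded observability_def, rule_format, OF \<Lambda> N A, of V W "md F"] s
      by (simp add: A_def nV nR S_def c_def)
    also have "\<dots> \<le> C * ((2 * o1 + 2 * (e\<^sup>2 * r)) + ((1 + K)\<^sup>2 * e\<^sup>2) * r)"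
    proof (intro mult_left_mono add_mono)
      show "Q A (\<lambda>y. 1) (\<lambda>x. 1) V \<le> 2 * o1 + 2 * (e\<^sup>2 * r)" using Qle t h4 by (simp add: r_def)
      have "c\<^sup>2 * (\<Sum>n\<in>A. nsq IX (md R n)) \<le> c\<^sup>2 * r" using SR by (intro mult_left_mono) auto
      also have "\<dots> \<le> ((1 + K)\<^sup>2 * e\<^sup>2) * r" using c2 r0 by (rule mult_right_mono)
      finally show "c\<^sup>2 * (\<Sum>n\<in>A. nsq IX (md R n)) \<le> ((1 + K)\<^sup>2 * e\<^sup>2) * r" .
    qed (use C in simp)
    finally have S: "S \<le> C * ((2 * o1 + 2 * (e\<^sup>2 * r)) + ((1 + K)\<^sup>2 * e\<^sup>2) * r)" .
    have "nsq PM u = 2 * pi * S + t" by (simp add: t_def S_def)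
    also have "\<dots> \<le> 2 * pi * (C * ((2 * o1 + 2 * (e\<^sup>2 * r)) + ((1 + K)\<^sup>2 * e\<^sup>2) * r)) + e\<^sup>2 * r"
      using S t h4 by (intro add_mono mult_left_mono) (auto simp: r_def)
    also have "\<dots> = (4 * pi * C) * o1 + (2 * pi * C * (2 + (1 + K)\<^sup>2) + 1) * (e\<^sup>2 * r)"
      by (simp add: algebra_simps)
    also have "\<dots> \<le> D * o1 + D * (e\<^sup>2 * r)"
      using C o0 r0 by (intro add_mono mult_right_mono) (auto simp: D_def intro!: add_nonneg_nonneg mult_nonneg_nonneg)
    finally have est: "nsq PM u \<le> D * (o1 + e\<^sup>2 * r)" by (simp add: distrib_left)
    have ob: "o1 \<le> (L2norm (\<omega> \<inter> Mset) v)\<^sup>2"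
    proof -
      have \<omega>B: "\<omega> \<in> sets borel" using assms(2) by simp
      have ind: "(indicator \<omega> :: real \<times> real \<Rightarrow> complex) \<in> borel_measurable PM" using \<omega>B by (intro borel_measurable_PM) simp
      have im: "(\<lambda>p. indicator {\<alpha>..\<beta>} (snd p) :: complex) \<in> borel_measurable PM"
        by (rule measurable_compose[OF borel_measurable_snd_MI]) simp
      have L: "L2 PM (\<lambda>p. indicator \<omega> p * u p)"
        by (rule L2_bounded_mult[OF u2 ind, of 1]) (simp add: indicator_def)
      have "o1 \<le> nsq PM (\<lambda>p. indicator \<omega> p * u p)" unfolding o1_def
      proof (rule nsq_mono[OF L borel_measurable_times[OF im L2_measurable[OF u2]]])
        fix p
        show "norm (indicator {\<alpha>..\<beta>} (snd p) * u p) \<le> norm (indicator \<omega> p * u p)"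
        proof (cases "p \<in> Mset \<and> snd p \<in> {\<alpha>..\<beta>}")
          case True
          then have "p \<in> {-1<..<1} \<times> {y. \<exists>k::int. a < y + 2*pi*k \<and> y + 2*pi*k < b}"
            using win[of "snd p"] by (cases p) (auto simp: Mset_def)
          then have "p \<in> \<omega>" using assms(6) by blast
          then show ?thesis by (simp add: indicator_def)
        next
          case False
          then show ?thesis using rep_D(2)[OF u, of p] by (auto simp: indicator_def)
        qed
      qed
      then show ?thesis by (simp only: L2norm_subset[OF u \<omega>B])
    qed
    define \<rho> where "\<rho> = h powr (-(\<gamma> + 1)) * L2norm Mset (\<lambda>p. of_real (h^2) * (f p + g p) + v p)"
    define o2 where "o2 = L2norm (\<omega> \<inter> Mset) v"
    have "\<rho>\<^sup>2 = (h powr (- (\<gamma> + 1)))\<^sup>2 * nsq PM (\<lambda>p. of_real (h\<^sup>2) * (F p + G p) + u p)"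
      unfolding \<rho>_def power_mult_distrib rep_combination[OF u F G] ..
    \<comment> \<open>\<open>R\<close> was normalised by \<open>\<Lambda> = 1 / h^2\<close>; the
      factor \<open>h^2\<close> restores the operator of the statement.\<close>
    also have "(\<lambda>p. of_real (h\<^sup>2) * (F p + G p) + u p) = (\<lambda>p. of_real (h\<^sup>2) * R p)"
      using h by (intro ext) (simp add: R_def \<Lambda>_def distrib_left flip: of_real_power)
    also have "nsq PM (\<lambda>p. of_real (h\<^sup>2) * R p) = (h\<^sup>2)\<^sup>2 * r"
      unfolding nsq_cmult r_def norm_of_real by simp
    also have "(h powr (- (\<gamma> + 1)))\<^sup>2 * ((h\<^sup>2)\<^sup>2 * r) = e\<^sup>2 * r"
      unfolding e_eq[symmetric] by (simp add: power_mult_distrib)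
    finally have \<rho>: "\<rho>\<^sup>2 = e\<^sup>2 * r" .
    have pos: "o2 \<ge> 0" "\<rho> \<ge> 0" unfolding o2_def \<rho>_def L2norm_def by simp_all
    have "(L2norm Mset v)\<^sup>2 \<le> D * (o2\<^sup>2 + \<rho>\<^sup>2)"
    proof -
      have "D * (o1 + e\<^sup>2 * r) \<le> D * (o2\<^sup>2 + \<rho>\<^sup>2)"
        using D ob \<rho> by (intro mult_left_mono) (auto simp: o2_def)
      then show ?thesis using est by (simp add: rep_L2norm[OF u])
    qed
    also have "\<dots> \<le> D * (o2 + \<rho>)\<^sup>2"
      using D pos by (intro mult_left_mono) (auto simp: power2_sum)
    also have "\<dots> = (sqrt D * (o2 + \<rho>))\<^sup>2" using D by (simp add: power_mult_distrib)
    finally have "L2norm Mset v \<le> sqrt D * (o2 + \<rho>)"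
      by (rule power2_le_imp_le) (use pos D in simp)
    then show ?thesis by (simp only: o2_def \<rho>_def)
  qed
  show ?thesis
    using D h\<^sub>0 main by (intro exI[of _ "sqrt D"] conjI exI[of _ "h\<^sub>0"]) auto
qed

end
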